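(* Let $I\subset\mathbb R$ be an interval and let $\mathcal H:I\to\mathbb C^{2n\times2n}$ be locally absolutely continuous with $\mathcal H>0$ and $\mathcal HJ\mathcal H=J$ (equivalently $J\mathcal HJ=\mathcal H^{-1}$). Among all locally absolutely continuous $J$-unitary gauges $\Theta$ on $I$ representing $\mathcal H$, i.e. $\mathcal H=\Theta^{-*}\Theta^{-1}$, $$\inf_\Theta\int_I\operatorname{Tr}|Q_\Theta|^2\,dt=\frac14\int_I\operatorname{Tr}\Big[\big(\mathcal H^{-1/2}\mathcal H'\mathcal H^{-1/2}\big)^2\Big]dt.$$ The infimum is attained by gauges for which $(Q_\Theta)_\parallel=0$.
   Context: Fix $n\ge1$ and $J,B\in\mathbb C^{2n\times2n}$ with $J=J^*$, $B=B^*$, $J^2=B^2=I$, $JB=-BJ$. $\Theta$ is $J$-unitary if $\Theta^*J\Theta=J$. For a locally absolutely continuous $J$-unitary $\Theta$, $Q_\Theta=-i\Theta^*J\Theta'$, which is Hermitian a.e. For a matrix $Q$, $Q_\parallel=\frac12(Q+JQJ)$. Both sides are understood in $[0,\infty]$ (equality in the extended sense). *)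

theory Defs
  imports "HOL-Analysis.Analysis"
begin

definition ctranspose :: "complex^'n^'m \<Rightarrow> complex^'m^'n" where
  "ctranspose A = (\<chi> i j. cnj (A $ j $ i))"

definition hermitian :: "complex^'m^'m \<Rightarrow> bool" where
  "hermitian A \<longleftrightarrow> ctranspose A = A"

definition qform :: "complex^'m^'m \<Rightarrow> complex^'m \<Rightarrow> complex" where
  "qform A x = (\<Sum>i\<in>UNIV. cnj (x $ i) * (A *v x) $ i)"

text \<open>The quadratic form of a Hermitian matrix is real-valued, so taking its real part below
  only serves to state the inequalities in the reals.\<close>

definition pos_semidef :: "complex^'m^'m \<Rightarrow> bool" where
  "pos_semidef A \<longleftrightarrow> hermitian A \<and> (\<forall>x. Re (qform A x) \<ge> 0)"

definition pos_def :: "complex^'m^'m \<Rightarrow> bool" where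
  "pos_def A \<longleftrightarrow> hermitian A \<and> (\<forall>x. x \<noteq> 0 \<longrightarrow> Re (qform A x) > 0)"

text \<open>The principal square root \<open>A\<^sup>1\<^sup>/\<^sup>2\<close>; meaningful for positive semidefinite \<open>A\<close>, for which
  the positive semidefinite root exists and is unique.\<close>

definition msqrt :: "complex^'m^'m \<Rightarrow> complex^'m^'m" where
  "msqrt A = (THE R. pos_semidef R \<and> R ** R = A)"

definition mabs :: "complex^'m^'m \<Rightarrow> complex^'m^'m" where
  "mabs A = msqrt (ctranspose A ** A)"

text \<open>Absolute continuity in the epsilon-delta sense. The members of a division \<open>D\<close> are finitely
  many nonempty compact intervals with pairwise disjoint interiors; \<open>Inf K\<close> and \<open>Sup K\<close> are the
  endpoints of \<open>K\<close>.\<close>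

definition abs_continuous_on :: "real set \<Rightarrow> (real \<Rightarrow> 'a::real_normed_vector) \<Rightarrow> bool" where
  "abs_continuous_on S f \<longleftrightarrow>
    (\<forall>\<epsilon>>0. \<exists>\<delta>>0. \<forall>D. D division_of \<Union>D \<and> \<Union>D \<subseteq> S \<and> (\<Sum>K\<in>D. Sup K - Inf K) < \<delta> \<longrightarrow>
       (\<Sum>K\<in>D. norm (f (Sup K) - f (Inf K))) < \<epsilon>)"

definition loc_abs_continuous_on :: "real set \<Rightarrow> (real \<Rightarrow> 'a::real_normed_vector) \<Rightarrow> bool" where
  "loc_abs_continuous_on I f \<longleftrightarrow> (\<forall>a b. {a..b} \<subseteq> I \<longrightarrow> abs_continuous_on {a..b} f)"

definition J_unitary :: "complex^'m^'m \<Rightarrow> complex^'m^'m \<Rightarrow> bool" where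
  "J_unitary J \<Theta> \<longleftrightarrow> ctranspose \<Theta> ** J ** \<Theta> = J"

text \<open>\<open>Q\<^sub>\<Theta>(t) = -i \<Theta>(t)\<^sup>* J \<Theta>'(t)\<close>. Functions on \<open>I\<close> are represented by total functions; all
  notions below only depend on the values on \<open>I\<close>. The derivative has an arbitrary value on the
  null set where it does not exist.\<close>

definition potential ::
  "complex^'m^'m \<Rightarrow> real set \<Rightarrow> (real \<Rightarrow> complex^'m^'m) \<Rightarrow> real \<Rightarrow> complex^'m^'m" where
  "potential J I \<Theta> t =
    mat (- \<i>) ** ctranspose (\<Theta> t) ** J ** vector_derivative \<Theta> (at t within I)"

definition parallel_part :: "complex^'m^'m \<Rightarrow> complex^'m^'m \<Rightarrow> complex^'m^'m" where
  "parallel_part J Q = (1/2) *\<^sub>R (Q + J ** Q ** J)"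

definition representing_gauges ::
  "complex^'m^'m \<Rightarrow> real set \<Rightarrow> (real \<Rightarrow> complex^'m^'m) \<Rightarrow> (real \<Rightarrow> complex^'m^'m) set" where
  "representing_gauges J I H =
    {\<Theta>. loc_abs_continuous_on I \<Theta> \<and> (\<forall>t\<in>I. J_unitary J (\<Theta> t)) \<and>
        (\<forall>t\<in>I. H t = matrix_inv (ctranspose (\<Theta> t)) ** matrix_inv (\<Theta> t))}"

text \<open>Both traces below are real and nonnegative for almost every \<open>t\<close> in the setting of interest,
  so \<open>ennreal\<close> and \<open>Re\<close> do not change the integrands.\<close>

definition gauge_energy ::
  "complex^'m^'m \<Rightarrow> real set \<Rightarrow> (real \<Rightarrow> complex^'m^'m) \<Rightarrow> ennreal" where
  "gauge_energy J I \<Theta> =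
    (\<integral>\<^sup>+t\<in>I. ennreal (Re (trace (mabs (potential J I \<Theta> t) ** mabs (potential J I \<Theta> t)))) \<partial>lebesgue)"

text \<open>\<open>H\<^sup>-\<^sup>1\<^sup>/\<^sup>2 H' H\<^sup>-\<^sup>1\<^sup>/\<^sup>2\<close>\<close>

definition log_velocity ::
  "real set \<Rightarrow> (real \<Rightarrow> complex^'m^'m) \<Rightarrow> real \<Rightarrow> complex^'m^'m" where
  "log_velocity I H t =
    matrix_inv (msqrt (H t)) ** vector_derivative H (at t within I) ** matrix_inv (msqrt (H t))"

definition hamiltonian_energy :: "real set \<Rightarrow> (real \<Rightarrow> complex^'m^'m) \<Rightarrow> ennreal" where
  "hamiltonian_energy I H =
    (\<integral>\<^sup>+t\<in>I. ennreal (Re (trace (log_velocity I H t ** log_velocity I H t))) \<partial>lebesgue)"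

end

theory Submission
  imports Defs
begin

text \<open>
  Let \<open>G = \<Theta>\<^sup>* J \<Theta>'\<close> for a gauge \<open>\<Theta>\<close>. Differentiating \<open>\<Theta>\<^sup>* J \<Theta> = J\<close> shows that \<open>G\<close> is anti-Hermitian, and
  \<open>H = J \<Theta> \<Theta>\<^sup>* J\<close> gives \<open>Tr [(H\<^sup>-\<^sup>1\<^sup>/\<^sup>2 H' H\<^sup>-\<^sup>1\<^sup>/\<^sup>2)\<^sup>2] = |J G J - G|\<^sup>2\<close> in the Frobenius norm, so the parallelogram
  identity \<open>|G|\<^sup>2 = |J G J - G|\<^sup>2 / 4 + |J G J + G|\<^sup>2 / 4\<close> yields the bound almost everywhere, with
  equality exactly where the parallel part vanishes.

  For attainment put \<open>R = H\<^sup>1\<^sup>/\<^sup>2\<close>, so that \<open>R\<^sup>-\<^sup>1 = J R J\<close> is itself a gauge, and look for \<open>\<Theta> = R\<^sup>-\<^sup>1 U\<close> with \<open>U\<close>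
  unitary and commuting with \<open>J\<close>. The parallel part vanishes when \<open>U' = 1/2 (R' R\<^sup>-\<^sup>1 - R\<^sup>-\<^sup>1 R') U\<close>. Instead
  of solving this equation with merely integrable coefficients, \<open>U\<close> is obtained by compactness from
  finite products of Cayley transforms of increments of \<open>R\<close>. Such a product over \<open>[s, t]\<close> differs from the
  single Cayley transform of \<open>(s, t)\<close> by at most a constant times \<open>(v t - v s)\<^sup>2\<close>, where \<open>v\<close> is the
  variation of \<open>R\<close>. The limit inherits the estimate, which gives the derivative of \<open>U\<close> wherever \<open>R\<close>
  and the monotone function \<open>v\<close> are differentiable.
\<close>

subsection \<open>Variation of absolutely continuous functions\<close>

text \<open>Derivatives must be extracted from an epsilon-delta definition of absolute continuity.
  They come from one monotone continuous function \<open>v\<close> that dominates the increments: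
  each real component of \<open>f\<close> is a difference of two monotone continuous functions, and
  Vitali coverings compare Lebesgue measure with the Stieltjes measure of such a function. The same
  kind of \<open>v\<close> is then the clock of the transport, so \<open>R'\<close> is never
  integrated. Cayley transforms send anti-Hermitian matrices commuting with \<open>J\<close> exactly
  to unitaries commuting with \<open>J\<close>: every finite product is admissible, and hence every
  limit. As \<open>cayley A\<close> is \<open>1 + 2 A\<close> up to second order, the discrete
  connection carries half of the wanted increment. Compactness gives no rate of convergence;
  differentiability survives because the composition error is bilinear in adjacent increments of
  \<open>v\<close>, a bound stable under chaining and closure. Square roots come from a Cholesky
  factor and a polar decomposition, without eigenvalues.\<close>

inductive var_sum :: "(real \<Rightarrow> 'a::real_normed_vector) \<Rightarrow> real \<Rightarrow> real \<Rightarrow> real \<Rightarrow> bool" for f where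
  refl: "var_sum f r r 0"
| step: "var_sum f r s x \<Longrightarrow> s < t \<Longrightarrow> var_sum f r t (x + norm (f t - f s))"

lemma var_sum_nonneg: "var_sum f r t x \<Longrightarrow> r \<le> t \<and> 0 \<le> x"
  by (induction rule: var_sum.induct) auto

lemma var_sum_single: "s \<le> t \<Longrightarrow> var_sum f s t (norm (f t - f s))"
  using var_sum.step[OF var_sum.refl[of f s], of t] var_sum.refl[of f s]
  by (cases "s = t") auto

lemma var_sum_trans: "var_sum f s t y \<Longrightarrow> var_sum f r s x \<Longrightarrow> var_sum f r t (x + y)"
proof (induction rule: var_sum.induct)
  case (refl r) then show ?case by simp
next
  case (step s t' y t)
  then show ?case using var_sum.step[of f r t' "x + y" t] by (simp add: add.assoc)
qed

text \<open>Inserting \<open>s\<close> cuts the jump that straddles it into two, and by the triangle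
  inequality the total can only grow.\<close>

lemma var_sum_split:
  assumes "var_sum f r t x" "r \<le> s" "s \<le> t"
  shows "\<exists>y z. var_sum f r s y \<and> var_sum f s t z \<and> x \<le> y + z"
  using assms
proof (induction rule: var_sum.induct)
  case (refl r)
  then have "s = r" by simp
  then show ?case using var_sum.refl[of f r] by force
next
  case (step r s' x t)
  show ?case
  proof (cases "s \<le> s'")
    case True
    then obtain y z where yz: "var_sum f r s y" "var_sum f s s' z" "x \<le> y + z"
      using step by blast
    then have "var_sum f s t (z + norm (f t - f s'))" using step(2) by (intro var_sum.step)
    then show ?thesis using yz by force
  next
    case False
    then have "var_sum f r s (x + norm (f s - f s'))" using step(1) by (intro var_sum.step) auto
    moreover have "var_sum f s t (norm (f t - f s))" using step by (intro var_sum_single)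
    moreover have "norm (f t - f s') \<le> norm (f s - f s') + norm (f t - f s)"
      using norm_triangle_ineq[of "f s - f s'" "f t - f s"] by simp
    ultimately show ?thesis by force
  qed
qed

text \<open>Translates partition sums into the divisions by which \<open>abs_continuous_on\<close>
  is stated. Nondegenerate members are kept so that divisions of neighbouring intervals cannot share
  a member.\<close>

lemma var_sum_division:
  assumes "var_sum f r t x"
  shows "\<exists>D. D division_of \<Union>D \<and> \<Union>D \<subseteq> {r..t} \<and> (\<forall>K\<in>D. Inf K < Sup K) \<and>
    (\<Sum>K\<in>D. Sup K - Inf K) = t - r \<and> (\<Sum>K\<in>D. norm (f (Sup K) - f (Inf K))) = x"
  using assms
proof (induction rule: var_sum.induct)
  case (refl r)
  then show ?case by (intro exI[of _ "{}"]) (auto simp: division_of_def)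
next
  case (step r s x t)
  then obtain D where D: "D division_of \<Union>D" "\<Union>D \<subseteq> {r..s}" "\<forall>K\<in>D. Inf K < Sup K"
    "(\<Sum>K\<in>D. Sup K - Inf K) = s - r" "(\<Sum>K\<in>D. norm (f (Sup K) - f (Inf K))) = x" by blast
  have rs: "r \<le> s" using step(1) var_sum_nonneg by blast
  have fin: "finite D" using D(1) by auto
  \<comment> \<open>Divisions are sets, so the sums gain exactly one term only if the new interval
    is not yet a member.\<close>
  have notin: "{s..t} \<notin> D"
  proof
    assume "{s..t} \<in> D"
    then have "{s..t} \<subseteq> {r..s}" using D(2) by blast
    then show False using step(2) by auto
  qed
  have int: "interior K \<inter> interior {s..t} = {}" if "K \<in> D" for K
  proof -
    have "interior K \<subseteq> interior {..s}" using that D(2) by (intro interior_mono) auto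
    then show ?thesis by auto
  qed
  have "insert {s..t} D division_of \<Union>(insert {s..t} D)"
    unfolding division_of_def
  proof (intro conjI ballI impI)
    fix K1 K2 assume *: "K1 \<in> insert {s..t} D" "K2 \<in> insert {s..t} D" "K1 \<noteq> K2"
    then show "interior K1 \<inter> interior K2 = {}"
      using int[of K1] int[of K2] D(1) by (auto simp del: interior_atLeastAtMost_real)
  next
    fix K assume "K \<in> insert {s..t} D"
    then show "\<exists>a b. K = cbox a b" using D(1) by (auto simp: division_of_def)
  next
    fix K assume "K \<in> insert {s..t} D"
    then show "K \<noteq> {}" using D(1) step(2) by (auto simp: division_of_def)
  qed (use fin in auto)
  moreover have "\<Union>(insert {s..t} D) \<subseteq> {r..t}" using D(2) rs step(2) by auto
  moreover have "Inf {s..t} = s" "Sup {s..t} = t" using step(2) by auto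
  ultimately show ?case using D notin fin step(2)
    by (intro exI[of _ "insert {s..t} D"]) auto
qed

text \<open>The total variation on \<open>[r, t]\<close>. The supremum is meaningful for absolutely
  continuous \<open>f\<close>, by \<open>var_sum_bdd\<close>.\<close>

definition variation :: "(real \<Rightarrow> 'a::real_normed_vector) \<Rightarrow> real \<Rightarrow> real \<Rightarrow> real" where
  "variation f r t = Sup {x. var_sum f r t x}"

lemma abs_continuous_on_var_sum_small:
  assumes "abs_continuous_on {a..b} f" "0 < \<epsilon>"
  shows "\<exists>\<delta>>0. \<forall>r t x. a \<le> r \<and> t \<le> b \<and> t - r < \<delta> \<and> var_sum f r t x \<longrightarrow> x < \<epsilon>"
proof -
  obtain \<delta> where d: "\<delta> > 0" "\<And>D. D division_of \<Union>D \<Longrightarrow> \<Union>D \<subseteq> {a..b} \<Longrightarrow> (\<Sum>K\<in>D. Sup K - Inf K) < \<delta> \<Longrightarrow>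
       (\<Sum>K\<in>D. norm (f (Sup K) - f (Inf K))) < \<epsilon>"
    using assms unfolding abs_continuous_on_def by meson
  show ?thesis
  proof (intro exI[of _ \<delta>] conjI allI impI)
    fix r t x assume *: "a \<le> r \<and> t \<le> b \<and> t - r < \<delta> \<and> var_sum f r t x"
    then obtain D where D: "D division_of \<Union>D" "\<Union>D \<subseteq> {r..t}"
      "(\<Sum>K\<in>D. Sup K - Inf K) = t - r" "(\<Sum>K\<in>D. norm (f (Sup K) - f (Inf K))) = x"
      using var_sum_division by blast
    then have "\<Union>D \<subseteq> {a..b}" using * by fastforce
    then show "x < \<epsilon>" using d(2)[OF D(1)] D * by auto
  qed (fact d(1))
qed

text \<open>Interval bisection: on intervals shorter than \<open>\<delta>\<close> all sums stay
  below 1, and bounds on two adjacent intervals add up by \<open>var_sum_split\<close>.\<close>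

lemma var_sum_bdd:
  assumes "abs_continuous_on {a..b} f" "a \<le> r" "r \<le> t" "t \<le> b"
  shows "bdd_above {x. var_sum f r t x}"
proof -
  obtain \<delta> where d: "\<delta> > 0" "\<And>r t x. a \<le> r \<Longrightarrow> t \<le> b \<Longrightarrow> t - r < \<delta> \<Longrightarrow> var_sum f r t x \<Longrightarrow> x < 1"
    using abs_continuous_on_var_sum_small[OF assms(1), of 1] by auto
  have "a \<le> r \<and> t \<le> b \<longrightarrow> bdd_above {x. var_sum f r t x}"
    using assms(3)
  proof (induction rule: Bolzano)
    case (trans u v w)
    show ?case
    proof (intro impI)
      assume *: "a \<le> u \<and> w \<le> b"
      then obtain M N where M: "\<And>x. var_sum f u v x \<Longrightarrow> x \<le> M" and N: "\<And>x. var_sum f v w x \<Longrightarrow> x \<le> N"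
        using trans by (force simp: bdd_above_def)
      show "bdd_above {x. var_sum f u w x}"
        unfolding bdd_above_def
      proof (intro exI[of _ "M + N"] ballI)
        fix x assume "x \<in> {x. var_sum f u w x}"
        then obtain y z where "var_sum f u v y" "var_sum f v w z" "x \<le> y + z"
          using var_sum_split[of f u w x v] trans by auto
        then show "x \<le> M + N" using M[of y] N[of z] by linarith
      qed
    qed
  next
    case (local x)
    show ?case
      using d by (intro exI[of _ \<delta>]) (fastforce simp: bdd_above_def intro: less_imp_le)
  qed
  then show ?thesis using assms by auto
qed

lemma var_sum_le_variation:
  assumes "abs_continuous_on {a..b} f" "a \<le> r" "t \<le> b" "var_sum f r t x"
  shows "x \<le> variation f r t"
  unfolding variation_def using assms var_sum_nonneg[OF assms(4)]
  by (intro cSup_upper var_sum_bdd[OF assms(1)]) auto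

text \<open>Splitting a partition at \<open>s\<close> gives one inequality, concatenating two
  partitions the other.\<close>

lemma variation_additive:
  assumes ac: "abs_continuous_on {a..b} f" and "a \<le> r" "r \<le> s" "s \<le> t" "t \<le> b"
  shows "variation f r t = variation f r s + variation f s t"
proof (rule antisym)
  have ne: "{x. var_sum f r t x} \<noteq> {}" if "r \<le> t" for r t using var_sum_single[OF that] by blast
  show "variation f r t \<le> variation f r s + variation f s t"
    unfolding variation_def[of f r t]
  proof (rule cSup_least)
    fix x assume "x \<in> {x. var_sum f r t x}"
    then obtain y z where "var_sum f r s y" "var_sum f s t z" "x \<le> y + z"
      using var_sum_split[of f r t x s] assms by auto
    then show "x \<le> variation f r s + variation f s t"
      using var_sum_le_variation[OF ac, of r s y] var_sum_le_variation[OF ac, of s t z] assms by auto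
  qed (use ne assms in auto)
  have 1: "x + y \<le> variation f r t" if "var_sum f r s x" "var_sum f s t y" for x y
    using var_sum_le_variation[OF ac, of r t "x + y"] var_sum_trans[OF that(2,1)] assms by auto
  have "variation f r s \<le> variation f r t - y" if "var_sum f s t y" for y
    unfolding variation_def[of f r s]
    by (rule cSup_least) (use ne assms 1 that in \<open>force+\<close>)
  then have "variation f s t \<le> variation f r t - variation f r s"
    unfolding variation_def[of f s t]
    by (intro cSup_least) (use ne[of s t] assms in \<open>force+\<close>)
  then show "variation f r s + variation f s t \<le> variation f r t" by simp
qed

lemma norm_diff_le_variation:
  assumes "abs_continuous_on {a..b} f" "a \<le> r" "r \<le> t" "t \<le> b"
  shows "norm (f t - f r) \<le> variation f r t"
  using var_sum_le_variation[OF assms(1,2,4) var_sum_single[OF assms(3)]] .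

lemma division_of_real_interval:
  fixes K :: "real set"
  assumes "D division_of S" "K \<in> D"
  shows "{Inf K..Sup K} = K" "Inf K \<le> Sup K" "Inf K \<in> K" "Sup K \<in> K"
proof -
  obtain c d where "K = cbox c d" "K \<noteq> {}" using division_ofD(3,4)[OF assms] by auto
  then have "K = {c..d}" "c \<le> d" by auto
  then show "{Inf K..Sup K} = K" "Inf K \<le> Sup K" "Inf K \<in> K" "Sup K \<in> K" by auto
qed

text \<open>Each member of a division is replaced by a partition that almost attains its variation.
  Together these form a division of the same total length, to which the absolute continuity of
  \<open>f\<close> applies.\<close>

lemma abs_continuous_on_variation:
  assumes ac: "abs_continuous_on {a..b} f"
  shows "abs_continuous_on {a..b} (variation f a)"
  unfolding abs_continuous_on_def
proof (intro allI impI)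
  fix \<epsilon> :: real assume "\<epsilon> > 0"
  then obtain \<delta> where d: "\<delta> > 0" "\<And>D. D division_of \<Union>D \<Longrightarrow> \<Union>D \<subseteq> {a..b} \<Longrightarrow> (\<Sum>K\<in>D. Sup K - Inf K) < \<delta> \<Longrightarrow>
       (\<Sum>K\<in>D. norm (f (Sup K) - f (Inf K))) < \<epsilon> / 2"
    using ac unfolding abs_continuous_on_def by (meson half_gt_zero)
  show "\<exists>\<delta>>0. \<forall>D. D division_of \<Union>D \<and> \<Union>D \<subseteq> {a..b} \<and> (\<Sum>K\<in>D. Sup K - Inf K) < \<delta> \<longrightarrow>
    (\<Sum>K\<in>D. norm (variation f a (Sup K) - variation f a (Inf K))) < \<epsilon>"
  proof (intro exI[of _ \<delta>] conjI allI impI)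
    fix D assume *: "D division_of \<Union>D \<and> \<Union>D \<subseteq> {a..b} \<and> (\<Sum>K\<in>D. Sup K - Inf K) < \<delta>"
    then have D: "D division_of \<Union>D" and sub: "\<Union>D \<subseteq> {a..b}" by auto
    have fin: "finite D" using D by auto
    have K: "{Inf K..Sup K} = K" "Inf K \<le> Sup K" "a \<le> Inf K" "Sup K \<le> b" if "K \<in> D" for K
    proof -
      have "Inf K \<in> {a..b}" "Sup K \<in> {a..b}"
        using division_of_real_interval(3,4)[OF D that] sub that by blast+
      then show "{Inf K..Sup K} = K" "Inf K \<le> Sup K" "a \<le> Inf K" "Sup K \<le> b"
        using division_of_real_interval(1,2)[OF D that] by auto
    qed
    \<comment> \<open>Each of the \<open>card D\<close> members may lose \<open>\<eta>\<close>, at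
      most \<open>\<epsilon> / 2\<close> in all; the \<open>+ 1\<close> keeps the denominator
      positive when \<open>D\<close> is empty.\<close>
    define \<eta> where "\<eta> = \<epsilon> / (2 * (real (card D) + 1))"
    have eta: "\<eta> > 0" using \<open>\<epsilon> > 0\<close> by (simp add: \<eta>_def)
    define P where "P K E \<longleftrightarrow> E division_of \<Union>E \<and> \<Union>E \<subseteq> K \<and> (\<forall>L\<in>E. Inf L < Sup L) \<and>
      (\<Sum>L\<in>E. Sup L - Inf L) = Sup K - Inf K \<and>
      variation f (Inf K) (Sup K) \<le> (\<Sum>L\<in>E. norm (f (Sup L) - f (Inf L))) + \<eta>" for K E
    have "\<exists>E. P K E"
      if "K \<in> D" for K
    proof -
      have "\<exists>x\<in>{x. var_sum f (Inf K) (Sup K) x}. variation f (Inf K) (Sup K) - \<eta> < x"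
        using var_sum_bdd[OF ac K(3,2,4)[OF that]] eta
          var_sum_single[OF K(2)[OF that], of f]
        unfolding variation_def by (subst less_cSup_iff[symmetric]) auto
      then obtain x where x: "var_sum f (Inf K) (Sup K) x" "variation f (Inf K) (Sup K) - \<eta> < x" by auto
      from var_sum_division[OF x(1)] obtain E where E: "E division_of \<Union>E"
        "\<Union>E \<subseteq> {Inf K..Sup K}" "\<forall>L\<in>E. Inf L < Sup L"
        "(\<Sum>L\<in>E. Sup L - Inf L) = Sup K - Inf K"
        "(\<Sum>L\<in>E. norm (f (Sup L) - f (Inf L))) = x" by blast
      have "\<Union>E \<subseteq> K" using E(2) K(1)[OF that] by simp
      then show ?thesis using E x(2) unfolding P_def by (intro exI[of _ E]) simp
    qed
    then obtain E where "\<forall>K\<in>D. P K (E K)" by metis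
    then have E: "\<And>K. K \<in> D \<Longrightarrow> E K division_of \<Union>(E K)" "\<And>K. K \<in> D \<Longrightarrow> \<Union>(E K) \<subseteq> K"
      "\<And>K L. K \<in> D \<Longrightarrow> L \<in> E K \<Longrightarrow> Inf L < Sup L"
      "\<And>K. K \<in> D \<Longrightarrow> (\<Sum>L\<in>E K. Sup L - Inf L) = Sup K - Inf K"
      "\<And>K. K \<in> D \<Longrightarrow> variation f (Inf K) (Sup K) \<le> (\<Sum>L\<in>E K. norm (f (Sup L) - f (Inf L))) + \<eta>"
      unfolding P_def by blast+
    have finE: "finite (E K)" if "K \<in> D" for K using E(1)[OF that] by auto
    have disj: "interior L \<inter> interior M = {}" if "K \<in> D" "K' \<in> D" "K \<noteq> K'" "L \<in> E K" "M \<in> E K'" for K K' L M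
    proof -
      have "interior L \<subseteq> interior K" "interior M \<subseteq> interior K'"
        using E(2) that by (auto intro!: interior_mono)
      then show ?thesis using division_ofD(5)[OF D that(1,2,3)] by blast
    qed
    \<comment> \<open>Disjoint interiors alone do not make two intervals different sets; with
      nonempty interiors they do, so the sum over the union splits.\<close>
    have nonint: "interior L \<noteq> {}" if "K \<in> D" "L \<in> E K" for K L
      using E(3)[OF that] division_of_real_interval(1)[OF E(1)[OF that(1)] that(2)]
        interior_atLeastAtMost_real[of "Inf L" "Sup L"] by auto
    have disjE: "E K \<inter> E K' = {}" if "K \<in> D" "K' \<in> D" "K \<noteq> K'" for K K'
      using disj[OF that] nonint that by blast
    let ?E = "\<Union>K\<in>D. E K"
    have "?E division_of \<Union>?E"
      unfolding division_of_def
    proof (intro conjI ballI impI)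
      show "finite ?E" using fin finE by auto
    next
      fix L assume "L \<in> ?E"
      then show "L \<noteq> {}" "\<exists>a b. L = cbox a b" using E(1) by (auto simp: division_of_def)
    next
      fix L M assume "L \<in> ?E" "M \<in> ?E" "L \<noteq> M"
      then obtain K K' where "K \<in> D" "K' \<in> D" "L \<in> E K" "M \<in> E K'" by auto
      then show "interior L \<inter> interior M = {}"
        using disj[of K K' L M] division_ofD(5)[OF E(1)[of K], of L M] \<open>L \<noteq> M\<close>
        by (cases "K = K'") auto
    qed auto
    moreover have "\<Union>?E \<subseteq> {a..b}" using E(2) sub by blast
    moreover have "(\<Sum>L\<in>?E. Sup L - Inf L) = (\<Sum>K\<in>D. Sup K - Inf K)"
      using fin finE disjE E(4) by (subst sum.UNION_disjoint) auto
    ultimately have small: "(\<Sum>L\<in>?E. norm (f (Sup L) - f (Inf L))) < \<epsilon> / 2"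
      using d(2) * by auto
    have "(\<Sum>K\<in>D. norm (variation f a (Sup K) - variation f a (Inf K))) =
        (\<Sum>K\<in>D. variation f (Inf K) (Sup K))"
    proof (rule sum.cong)
      fix M assume M: "M \<in> D"
      have "variation f a (Sup M) = variation f a (Inf M) + variation f (Inf M) (Sup M)"
        by (rule variation_additive[OF ac]) (use K(2-)[OF M] in auto)
      moreover have "0 \<le> variation f (Inf M) (Sup M)"
        using norm_diff_le_variation[OF ac K(3,2,4)[OF M]] norm_ge_zero order_trans by blast
      ultimately show "norm (variation f a (Sup M) - variation f a (Inf M)) = variation f (Inf M) (Sup M)"
        by simp
    qed simp
    also have "\<dots> \<le> (\<Sum>K\<in>D. (\<Sum>L\<in>E K. norm (f (Sup L) - f (Inf L))) + \<eta>)"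
      using E(5) by (intro sum_mono)
    also have "\<dots> = (\<Sum>L\<in>?E. norm (f (Sup L) - f (Inf L))) + card D * \<eta>"
      using fin finE disjE by (subst sum.UNION_disjoint) (auto simp: sum.distrib)
    also have "card D * \<eta> \<le> \<epsilon> / 2"
      using \<open>\<epsilon> > 0\<close> by (simp add: \<eta>_def field_simps)
    finally show "(\<Sum>K\<in>D. norm (variation f a (Sup K) - variation f a (Inf K))) < \<epsilon>"
      using small by linarith
  qed (fact d(1))
qed

lemma abs_continuous_on_imp_continuous_on:
  assumes "abs_continuous_on {a..b} f"
  shows "continuous_on {a..b} f"
  unfolding continuous_on_iff
proof (intro ballI allI impI)
  fix x \<epsilon> :: real assume x: "x \<in> {a..b}" and "\<epsilon> > 0"
  obtain \<delta> where d: "\<delta> > 0" "\<And>r t x. a \<le> r \<Longrightarrow> t \<le> b \<Longrightarrow> t - r < \<delta> \<Longrightarrow> var_sum f r t x \<Longrightarrow> x < \<epsilon>"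
    using abs_continuous_on_var_sum_small[OF assms \<open>\<epsilon> > 0\<close>] by auto
  show "\<exists>d>0. \<forall>x'\<in>{a..b}. dist x' x < d \<longrightarrow> dist (f x') (f x) < \<epsilon>"
  proof (intro exI[of _ \<delta>] conjI ballI impI)
    fix y assume y: "y \<in> {a..b}" "dist y x < \<delta>"
    show "dist (f y) (f x) < \<epsilon>"
    proof (cases "x \<le> y")
      case True
      then show ?thesis using d(2)[OF _ _ _ var_sum_single[OF True, of f]] x y
        by (auto simp: dist_norm)
    next
      case False
      then show ?thesis using d(2)[OF _ _ _ var_sum_single[of y x f]] x y
        by (auto simp: dist_norm norm_minus_commute)
    qed
  qed (fact d(1))
qed

lemma abs_continuous_on_dominated:
  assumes v: "abs_continuous_on {a..b} v" and "C \<ge> 0"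
    and le: "\<And>s t. a \<le> s \<Longrightarrow> s \<le> t \<Longrightarrow> t \<le> b \<Longrightarrow> norm (f t - f s) \<le> C * norm (v t - v s)"
  shows "abs_continuous_on {a..b} f"
  unfolding abs_continuous_on_def
proof (intro allI impI)
  fix \<epsilon> :: real assume "\<epsilon> > 0"
  \<comment> \<open>\<open>C + 1\<close> in place of \<open>C\<close> also covers
    \<open>C = 0\<close>.\<close>
  then have "\<epsilon> / (C + 1) > 0" using assms by simp
  then obtain \<delta> where d: "\<delta> > 0" "\<And>D. D division_of \<Union>D \<Longrightarrow> \<Union>D \<subseteq> {a..b} \<Longrightarrow> (\<Sum>K\<in>D. Sup K - Inf K) < \<delta> \<Longrightarrow>
       (\<Sum>K\<in>D. norm (v (Sup K) - v (Inf K))) < \<epsilon> / (C + 1)"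
    using v unfolding abs_continuous_on_def by meson
  show "\<exists>\<delta>>0. \<forall>D. D division_of \<Union>D \<and> \<Union>D \<subseteq> {a..b} \<and> (\<Sum>K\<in>D. Sup K - Inf K) < \<delta> \<longrightarrow>
    (\<Sum>K\<in>D. norm (f (Sup K) - f (Inf K))) < \<epsilon>"
  proof (intro exI[of _ \<delta>] conjI allI impI)
    fix D assume *: "D division_of \<Union>D \<and> \<Union>D \<subseteq> {a..b} \<and> (\<Sum>K\<in>D. Sup K - Inf K) < \<delta>"
    then have D: "D division_of \<Union>D" and sub: "\<Union>D \<subseteq> {a..b}" by auto
    have K: "Inf K \<le> Sup K" "a \<le> Inf K" "Sup K \<le> b" if "K \<in> D" for K
      using division_of_real_interval(2-4)[OF D that] sub that by (meson UnionI atLeastAtMost_iff subsetD)+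
    have "(\<Sum>K\<in>D. norm (f (Sup K) - f (Inf K))) \<le> (\<Sum>K\<in>D. C * norm (v (Sup K) - v (Inf K)))"
      by (intro sum_mono le K)
    also have "\<dots> = C * (\<Sum>K\<in>D. norm (v (Sup K) - v (Inf K)))" by (simp add: sum_distrib_left)
    also have "\<dots> \<le> (C + 1) * (\<Sum>K\<in>D. norm (v (Sup K) - v (Inf K)))"
      by (intro mult_right_mono sum_nonneg) auto
    also have "\<dots> < (C + 1) * (\<epsilon> / (C + 1))"
      using d(2)[of D] * \<open>C \<ge> 0\<close> by (intro mult_strict_left_mono) auto
    finally show "(\<Sum>K\<in>D. norm (f (Sup K) - f (Inf K))) < \<epsilon>" using \<open>C \<ge> 0\<close> by simp
  qed (fact d(1))
qed

text \<open>The variation from \<open>a\<close> serves as control. Clamping its argument to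
  \<open>[a, b]\<close> makes it monotone and continuous on the whole line, as the Stieltjes measure
  and the differentiation theorem require.\<close>

lemma abs_continuous_on_control:
  assumes ac: "abs_continuous_on {a..b} f" and "a \<le> b"
  obtains v :: "real \<Rightarrow> real" where "mono v" "continuous_on UNIV v" "abs_continuous_on {a..b} v"
    "\<And>s t. a \<le> s \<Longrightarrow> s \<le> t \<Longrightarrow> t \<le> b \<Longrightarrow> norm (f t - f s) \<le> v t - v s"
proof
  let ?v = "\<lambda>x. variation f a (max a (min b x))"
  have inc: "norm (f t - f s) \<le> variation f a t - variation f a s" if "a \<le> s" "s \<le> t" "t \<le> b" for s t
    using variation_additive[OF ac order_refl that] norm_diff_le_variation[OF ac that] by linarith
  show "mono ?v"
  proof (intro monoI)
    fix x y :: real assume "x \<le> y"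
    then have "norm (f (max a (min b y)) - f (max a (min b x))) \<le> ?v y - ?v x"
      using \<open>a \<le> b\<close> by (intro inc) auto
    then show "?v x \<le> ?v y" using norm_ge_zero[of "f (max a (min b y)) - f (max a (min b x))"] by linarith
  qed
  show "norm (f t - f s) \<le> ?v t - ?v s" if "a \<le> s" "s \<le> t" "t \<le> b" for s t
    using inc[OF that] that by (simp add: max_def min_def)
  have *: "abs_continuous_on {a..b} (variation f a)" by (rule abs_continuous_on_variation[OF ac])
  show "continuous_on UNIV ?v"
    by (rule continuous_on_compose2[OF abs_continuous_on_imp_continuous_on[OF *]])
      (use \<open>a \<le> b\<close> in \<open>auto intro!: continuous_intros\<close>)
  show "abs_continuous_on {a..b} ?v"
    by (rule abs_continuous_on_dominated[OF *, of 1]) auto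
qed

subsection \<open>Almost everywhere differentiability\<close>

text \<open>Intervals are the closed balls of the line. The intervals spanned by \<open>x\<close>
  and nearby \<open>y\<close> with \<open>P x y\<close> contain \<open>x\<close> and are arbitrarily
  short, so they form a fine cover of \<open>E\<close>; symmetry of \<open>P\<close> makes the order
  of the two points irrelevant.\<close>

lemma Vitali_intervals:
  fixes P :: "real \<Rightarrow> real \<Rightarrow> bool"
  assumes "open W" "E \<subseteq> W" and sym: "\<And>x y. P x y \<Longrightarrow> P y x"
    and freq: "\<And>x. x \<in> E \<Longrightarrow> \<exists>\<^sub>F y in at x. P x y"
  obtains C where "countable C" "\<forall>(l, r)\<in>C. l < r \<and> {l..r} \<subseteq> W \<and> P l r"
    "disjoint_family_on (\<lambda>(l, r). {l..r}) C" "negligible (E - (\<Union>(l, r)\<in>C. {l..r}))"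
proof -
  let ?K = "{(l, r). l < r \<and> {l..r} \<subseteq> W \<and> P l r}"
  let ?a = "\<lambda>(l::real, r). (l + r) / 2" and ?r = "\<lambda>(l::real, r). (r - l) / 2"
  have cb: "cball (?a i) (?r i) = (case i of (l, r) \<Rightarrow> {l..r})" for i
    by (cases i) (auto simp: cball_eq_atLeastAtMost field_simps)
  have "\<exists>i. i \<in> ?K \<and> x \<in> cball (?a i) (?r i) \<and> ?r i < d" if "x \<in> E" "d > 0" for x d
  proof -
    obtain e where e: "e > 0" "ball x e \<subseteq> W" using assms(1,2) \<open>x \<in> E\<close> by (meson openE subsetD)
    have "\<forall>\<^sub>F y in at x. dist y x < min e d \<and> y \<noteq> x"
      using e(1) \<open>d > 0\<close> unfolding eventually_at by (intro exI[of _ "min e d"]) auto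
    then obtain y where y: "P x y" "dist y x < e" "dist y x < d" "y \<noteq> x"
      using frequently_ex[OF frequently_eventually_frequently[OF freq[OF \<open>x \<in> E\<close>]]] by auto
    have sub: "{min x y..max x y} \<subseteq> W"
    proof
      fix z assume "z \<in> {min x y..max x y}"
      then have "z \<in> ball x e" using y(2) by (auto simp: dist_real_def min_def max_def split: if_splits)
      then show "z \<in> W" using e(2) by blast
    qed
    have "P (min x y) (max x y)" using y(1) sym by (auto simp: min_def max_def)
    moreover have "x \<in> cball (?a (min x y, max x y)) (?r (min x y, max x y))" unfolding cb by auto
    moreover have "?r (min x y, max x y) < d" using y(3) \<open>d > 0\<close> by (auto simp: dist_real_def min_def max_def)
    moreover have "min x y < max x y" using y(4) by auto
    ultimately show ?thesis using sub by (intro exI[of _ "(min x y, max x y)"]) auto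
  qed
  note cover = this
  have pos: "0 < ?r i" if "i \<in> ?K" for i using that by auto
  obtain C where C: "countable C" "C \<subseteq> ?K"
     "pairwise (\<lambda>i j. disjnt (cball (?a i) (?r i)) (cball (?a j) (?r j))) C"
     "negligible (E - (\<Union>i \<in> C. cball (?a i) (?r i)))"
    by (rule Vitali_covering_theorem_cballs[of ?K ?r E ?a, OF pos cover])
  show thesis
  proof (rule that[of C])
    show "disjoint_family_on (\<lambda>(l, r). {l..r}) C"
      using C(3) unfolding cb by (auto simp: disjoint_family_on_def pairwise_def disjnt_def)
    show "negligible (E - (\<Union>(l, r)\<in>C. {l..r}))" using C(4) unfolding cb .
  qed (use C in auto)
qed

abbreviation diff_quot :: "(real \<Rightarrow> real) \<Rightarrow> real \<Rightarrow> real \<Rightarrow> real" where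
  "diff_quot v x y \<equiv> (v y - v x) / (y - x)"

lemma diff_quot_commute: "diff_quot v x y = diff_quot v y x"
  by (metis minus_diff_eq minus_divide_divide)

context
  fixes v :: "real \<Rightarrow> real"
  assumes mono_v: "mono v" and cont_v: "continuous_on UNIV v"
begin

lemma emeasure_v_Icc: "a \<le> b \<Longrightarrow> emeasure (interval_measure v) {a..b} = ennreal (v b - v a)"
  using mono_v cont_v by (intro emeasure_interval_measure_Icc) (auto simp: mono_def)

text \<open>On every interval of the Vitali cover the \<open>v\<close>-mass exceeds \<open>q\<close>
  times the length, and disjointness allows summation.\<close>

lemma upper_quotient_cover:
  assumes "open W" "E \<subseteq> W" "q > 0"
    and "\<And>x. x \<in> E \<Longrightarrow> \<exists>\<^sub>F y in at x. q < diff_quot v x y"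
  obtains S where "S \<in> sets borel" "S \<subseteq> W" "negligible (E - S)"
    "ennreal q * emeasure lborel S \<le> emeasure (interval_measure v) S"
proof -
  have sym: "q < diff_quot v y x" if "q < diff_quot v x y" for x y
    using that by (simp only: diff_quot_commute[of v y x])
  obtain C where C: "countable C" "\<forall>(l, r)\<in>C. l < r \<and> {l..r} \<subseteq> W \<and> q < diff_quot v l r"
    "disjoint_family_on (\<lambda>(l, r). {l..r}) C" "negligible (E - (\<Union>(l, r)\<in>C. {l..r}))"
    by (rule Vitali_intervals[of W E "\<lambda>x y. q < diff_quot v x y", OF assms(1,2) sym assms(4)])
  let ?S = "\<Union>i\<in>C. case i of (l, r) \<Rightarrow> {l..r}"
  have "ennreal q * emeasure lborel ?S = (\<integral>\<^sup>+i. ennreal q * emeasure lborel (case i of (l, r) \<Rightarrow> {l..r}) \<partial>count_space C)"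
    using C(1,3) by (subst emeasure_UN_countable) (auto simp: nn_integral_cmult)
  also have "\<dots> \<le> (\<integral>\<^sup>+i. emeasure (interval_measure v) (case i of (l, r) \<Rightarrow> {l..r}) \<partial>count_space C)"
  proof (rule nn_integral_mono, clarsimp)
    fix l r assume that: "(l, r) \<in> C"
    have "l < r" "q * (r - l) \<le> v r - v l"
      using bspec[OF C(2) that] by (auto simp: pos_less_divide_eq)
    moreover from this have "ennreal q * ennreal (r - l) \<le> ennreal (v r - v l)"
      using \<open>q > 0\<close> by (simp add: ennreal_mult[symmetric] ennreal_leI)
    ultimately show "ennreal q * emeasure lborel {l..r} \<le> emeasure (interval_measure v) {l..r}"
      by (simp add: emeasure_v_Icc)
  qed
  also have "\<dots> = emeasure (interval_measure v) ?S"
    using C(1,3) by (subst emeasure_UN_countable) auto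
  finally show thesis using C by (intro that[of ?S]) auto
qed

text \<open>Open intervals are taken here because the resulting \<open>S\<close> must later serve as
  the open neighbourhood \<open>W\<close> of a second, upper cover.\<close>

lemma lower_quotient_cover:
  assumes "open W" "E \<subseteq> W" "p > 0"
    and "\<And>x. x \<in> E \<Longrightarrow> \<exists>\<^sub>F y in at x. diff_quot v x y < p"
  obtains S where "open S" "S \<subseteq> W" "negligible (E - S)"
    "emeasure (interval_measure v) S \<le> ennreal p * emeasure lborel S"
proof -
  have sym: "diff_quot v y x < p" if "diff_quot v x y < p" for x y
    using that by (simp only: diff_quot_commute[of v y x])
  obtain C where C: "countable C" "\<forall>(l, r)\<in>C. l < r \<and> {l..r} \<subseteq> W \<and> diff_quot v l r < p"
    "disjoint_family_on (\<lambda>(l, r). {l..r}) C" "negligible (E - (\<Union>(l, r)\<in>C. {l..r}))"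
    by (rule Vitali_intervals[of W E "\<lambda>x y. diff_quot v x y < p", OF assms(1,2) sym assms(4)])
  let ?S = "\<Union>i\<in>C. case i of (l, r) \<Rightarrow> {l<..<r}"
  have disj: "disjoint_family_on (\<lambda>(l, r). {l<..<r}) C"
    using C(3) unfolding disjoint_family_on_def by (fastforce split: prod.splits)
  have "emeasure (interval_measure v) ?S =
      (\<integral>\<^sup>+i. emeasure (interval_measure v) (case i of (l, r) \<Rightarrow> {l<..<r}) \<partial>count_space C)"
    using C(1) disj by (subst emeasure_UN_countable) auto
  also have "\<dots> \<le> (\<integral>\<^sup>+i. ennreal p * emeasure lborel (case i of (l, r) \<Rightarrow> {l<..<r}) \<partial>count_space C)"
  proof (rule nn_integral_mono, clarsimp)
    fix l r assume that: "(l, r) \<in> C"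
    have "l < r" "v r - v l \<le> p * (r - l)"
      using bspec[OF C(2) that] by (auto simp: pos_divide_less_eq)
    then have le: "ennreal (v r - v l) \<le> ennreal p * ennreal (r - l)"
      using \<open>p > 0\<close> by (simp add: ennreal_mult[symmetric] ennreal_leI)
    have "emeasure (interval_measure v) {l<..<r} \<le> emeasure (interval_measure v) {l..r}"
      by (intro emeasure_mono) auto
    also have "\<dots> \<le> ennreal p * emeasure lborel {l<..<r}"
      using le \<open>l < r\<close> by (simp add: emeasure_v_Icc)
    finally show "emeasure (interval_measure v) {l<..<r} \<le> ennreal p * emeasure lborel {l<..<r}" .
  qed
  also have "\<dots> = ennreal p * emeasure lborel ?S"
    using C(1) disj by (subst emeasure_UN_countable) (auto simp: nn_integral_cmult)
  finally have le: "emeasure (interval_measure v) ?S \<le> ennreal p * emeasure lborel ?S" .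
  \<comment> \<open>Passing to open intervals loses only the countably many end points.\<close>
  have "countable (fst ` C \<union> snd ` C)" using C(1) by auto
  then have "negligible (fst ` C \<union> snd ` C)"
    unfolding negligible_iff_null_sets by (intro null_sets_completionI countable_imp_null_set_lborel)
  then have "negligible ((E - (\<Union>(l, r)\<in>C. {l..r})) \<union> (fst ` C \<union> snd ` C))"
    by (rule negligible_Un[OF C(4)])
  then have "negligible (E - ?S)"
    by (rule negligible_subset) (force simp: image_iff split: prod.splits)
  moreover have "?S \<subseteq> W" using C(2) by fastforce
  ultimately show thesis using le by (intro that[of ?S]) auto
qed

end

text \<open>Sets described by difference quotients are not known to be measurable at this stage, so
  they are sized by outer measure.\<close>

lemma outer_measure_of_lborel_zero:
  assumes "outer_measure_of lborel E = 0"
  shows "negligible E"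
proof -
  obtain G where "G \<in> sets lborel" "E \<subseteq> G" "emeasure lborel G = 0"
    using outer_measure_of_attain[of E lborel] assms by auto
  then show ?thesis
    unfolding negligible_iff_null_sets null_sets_completion_iff2 by (auto intro!: bexI[of _ G])
qed

lemma outer_measure_of_lborel_le:
  assumes "negligible (E - S)" "S \<in> sets borel"
  shows "outer_measure_of lborel E \<le> emeasure lborel S"
proof -
  obtain N where N: "N \<in> null_sets lborel" "E - S \<subseteq> N"
    using assms(1) unfolding negligible_iff_null_sets null_sets_completion_iff2 by auto
  then have "outer_measure_of lborel E \<le> outer_measure_of lborel (S \<union> N)"
    by (intro outer_measure_of_mono) auto
  also have "\<dots> = emeasure lborel S"
    using emeasure_Un_null_set[of S lborel N] null_setsD2[OF N(1)] N(1) assms(2) by simp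
  finally show ?thesis .
qed

lemma outer_measure_of_lborel_bounded:
  assumes "E \<subseteq> {-N..N::real}"
  obtains e where "e \<ge> 0" "outer_measure_of lborel E = ennreal e"
proof -
  have "outer_measure_of lborel E \<le> emeasure lborel {-N..N}"
    using outer_measure_of_mono[OF assms, of lborel] by simp
  then have "outer_measure_of lborel E < \<infinity>"
    by (rule order.strict_trans1) (cases "0 \<le> N", auto)
  then show thesis using that
    by (metis enn2real_nonneg ennreal_enn2real infinity_ennreal_def)
qed

context
  fixes v :: "real \<Rightarrow> real"
  assumes mono_v: "mono v" and cont_v: "continuous_on UNIV v"
begin

text \<open>An upper cover inside \<open>(-N-1, N+1)\<close> has \<open>v\<close>-mass at least
  \<open>q\<close> times the outer measure of \<open>E\<close>, while the mass available there is
  fixed and \<open>q\<close> is arbitrary.\<close>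

lemma negligible_infinite_quotient_bounded:
  assumes "E \<subseteq> {-N..N}" and "\<And>x q. x \<in> E \<Longrightarrow> \<exists>\<^sub>F y in at x. q < diff_quot v x y"
  shows "negligible E"
proof (cases "E = {}")
  case False
  then have N: "N \<ge> 0" using assms(1) by auto
  obtain e where e: "e \<ge> 0" "outer_measure_of lborel E = ennreal e"
    using outer_measure_of_lborel_bounded[OF assms(1)] .
  have "q * e \<le> v (N + 1) - v (- N - 1)" if "q > 0" for q
  proof -
    have sub: "E \<subseteq> {-N-1<..<N+1}" using assms(1) by auto
    obtain S where S: "S \<in> sets borel" "S \<subseteq> {-N-1<..<N+1}" "negligible (E - S)"
      "ennreal q * emeasure lborel S \<le> emeasure (interval_measure v) S"
      by (rule upper_quotient_cover[OF mono_v cont_v open_greaterThanLessThan sub \<open>q > 0\<close> assms(2)])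
    have "ennreal (q * e) = ennreal q * outer_measure_of lborel E"
      using e that by (simp add: ennreal_mult)
    also have "\<dots> \<le> ennreal q * emeasure lborel S"
      by (intro mult_left_mono outer_measure_of_lborel_le S) auto
    also have "\<dots> \<le> emeasure (interval_measure v) S" by (rule S(4))
    also have "\<dots> \<le> emeasure (interval_measure v) {-N-1..N+1}" using S(2) by (intro emeasure_mono) auto
    also have "\<dots> = ennreal (v (N + 1) - v (- N - 1))"
      using N by (intro emeasure_v_Icc[OF mono_v cont_v]) auto
    finally show ?thesis
      using monoD[OF mono_v, of "-N-1" "N+1"] N by (subst (asm) ennreal_le_iff) auto
  qed
  note * = this
  have "e = 0"
  proof (rule ccontr)
    assume "e \<noteq> 0"
    define M where "M = v (N + 1) - v (- N - 1)"
    \<comment> \<open>This \<open>q\<close> is chosen so that \<open>q * e\<close> is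
      \<open>\<bar>M\<bar> + 1\<close>, more than the mass available.\<close>
    have "(\<bar>M\<bar> + 1) / e * e \<le> M" unfolding M_def using * e \<open>e \<noteq> 0\<close> by (intro *) (auto simp: add_nonneg_pos)
    then show False using \<open>e \<noteq> 0\<close> by simp
  qed
  then show ?thesis using e by (intro outer_measure_of_lborel_zero) auto
qed simp

text \<open>Two nested covers: \<open>S\<close> inside an open \<open>W\<close> of measure at most
  \<open>e + \<epsilon>\<close> has small \<open>v\<close>-mass, and \<open>T\<close> inside
  \<open>S\<close> still covers almost all of \<open>E\<close> but has large \<open>v\<close>-mass.
  Hence \<open>q * e \<le> p * (e + \<epsilon>)\<close>, which for small \<open>\<epsilon>\<close>
  and \<open>p < q\<close> forces \<open>e = 0\<close>.\<close>

lemma negligible_oscillating_quotient_bounded: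
  assumes "E \<subseteq> {-N..N}" "0 < p" "p < q"
    and "\<And>x. x \<in> E \<Longrightarrow> \<exists>\<^sub>F y in at x. diff_quot v x y < p"
    and "\<And>x. x \<in> E \<Longrightarrow> \<exists>\<^sub>F y in at x. q < diff_quot v x y"
  shows "negligible E"
proof -
  obtain e where e: "e \<ge> 0" "outer_measure_of lborel E = ennreal e"
    using outer_measure_of_lborel_bounded[OF assms(1)] .
  obtain G where G: "G \<in> sets borel" "E \<subseteq> G" "emeasure lborel G = ennreal e"
    using outer_measure_of_attain[of E lborel] e by auto
  have "q * e \<le> p * (e + \<epsilon>)" if "\<epsilon> > 0" for \<epsilon> :: real
  proof -
    obtain W where W: "open W" "G \<subseteq> W" "W - G \<in> lmeasurable" "emeasure lebesgue (W - G) < ennreal \<epsilon>"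
      using sets_lebesgue_outer_open[of G \<epsilon>] G(1) \<open>\<epsilon> > 0\<close> by (auto simp: sets_completionI_sets)
    have "emeasure lborel W = emeasure lborel G + emeasure lborel (W - G)"
      using G(1) W(1,2) by (subst plus_emeasure) (auto simp: Un_absorb1)
    also have "\<dots> \<le> ennreal e + ennreal \<epsilon>"
      using G W by (intro add_mono) (auto simp: borel_open intro: less_imp_le)
    finally have WE: "emeasure lborel W \<le> ennreal (e + \<epsilon>)" using e that by simp
    have sub: "E \<subseteq> W" using G W by auto
    obtain S where S: "open S" "S \<subseteq> W" "negligible (E - S)"
      "emeasure (interval_measure v) S \<le> ennreal p * emeasure lborel S"
      by (rule lower_quotient_cover[OF mono_v cont_v W(1) sub assms(2,4)])
    have "0 < q" using assms by simp
    obtain T where T: "T \<in> sets borel" "T \<subseteq> S" "negligible (E \<inter> S - T)"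
      "ennreal q * emeasure lborel T \<le> emeasure (interval_measure v) T"
      by (rule upper_quotient_cover[OF mono_v cont_v S(1) _ \<open>0 < q\<close>, of "E \<inter> S"]) (use assms(5) in auto)
    have "negligible (E - T)"
      using negligible_Un[OF S(3) T(3)] by (rule negligible_subset) auto
    have "ennreal (q * e) = ennreal q * outer_measure_of lborel E"
      using e \<open>0 < q\<close> by (simp add: ennreal_mult)
    also have "\<dots> \<le> ennreal q * emeasure lborel T"
      by (intro mult_left_mono outer_measure_of_lborel_le T \<open>negligible (E - T)\<close>) auto
    also have "\<dots> \<le> emeasure (interval_measure v) S"
      using S T by (intro order_trans[OF T(4)] emeasure_mono) auto
    also have "\<dots> \<le> ennreal p * emeasure lborel W"
      using S W by (intro order_trans[OF S(4)] mult_left_mono emeasure_mono) auto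
    also have "\<dots> \<le> ennreal p * ennreal (e + \<epsilon>)" using WE by (intro mult_left_mono) auto
    also have "\<dots> = ennreal (p * (e + \<epsilon>))" using assms(2) e that by (simp add: ennreal_mult)
    finally show ?thesis using assms(2) e that by (subst (asm) ennreal_le_iff) auto
  qed
  note * = this
  have "e = 0"
  proof (rule ccontr)
    assume "e \<noteq> 0"
    then have "(q - p) * e > 0" using e assms by simp
    \<comment> \<open>With this \<open>\<epsilon>\<close> the right side exceeds
      \<open>p * e\<close> by only half of \<open>(q - p) * e\<close>.\<close>
    then have "q * e \<le> p * (e + (q - p) * e / (2 * p))" using assms(2) by (intro *) simp
    also have "\<dots> = p * e + (q - p) * e / 2" using assms(2) by (simp add: field_simps)
    finally show False using \<open>(q - p) * e > 0\<close> by (simp add: field_simps)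
  qed
  then show ?thesis using e by (intro outer_measure_of_lborel_zero) auto
qed

lemma negligible_by_bounded_parts:
  assumes "\<And>N::nat. negligible (E \<inter> {-real N..real N})"
  shows "negligible E"
proof -
  have "negligible (\<Union>N::nat. E \<inter> {-real N..real N})"
    by (rule negligible_countable_Union) (use assms in auto)
  moreover have "E \<subseteq> (\<Union>N::nat. E \<inter> {-real N..real N})"
  proof
    fix x assume "x \<in> E"
    moreover obtain N :: nat where "\<bar>x\<bar> \<le> real N" using real_arch_simple by blast
    ultimately show "x \<in> (\<Union>N::nat. E \<inter> {-real N..real N})" by (auto intro!: exI[of _ N])
  qed
  ultimately show ?thesis by (rule negligible_subset)
qed

text \<open>Where the derivative fails to exist, the quotients are either unbounded or have a lower
  limit below their upper limit; rational \<open>p\<close> and \<open>q\<close> separating the two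
  reduce the second case to countably many sets.\<close>

theorem mono_continuous_ae_differentiable:
  "negligible {x. \<not> v differentiable (at x)}"
proof -
  define A where "A = {x. \<forall>q. \<exists>\<^sub>F y in at x. q < diff_quot v x y}"
  define B where "B p q = {x. (\<exists>\<^sub>F y in at x. diff_quot v x y < p) \<and> (\<exists>\<^sub>F y in at x. q < diff_quot v x y)}" for p q
  have "negligible A"
    by (rule negligible_by_bounded_parts, rule negligible_infinite_quotient_bounded) (auto simp: A_def)
  moreover have "negligible (B p q)" if "0 < p" "p < q" for p q
    by (rule negligible_by_bounded_parts, rule negligible_oscillating_quotient_bounded[OF _ that])
      (auto simp: B_def)
  moreover have "countable {B p q |p q. p \<in> \<rat> \<and> q \<in> \<rat> \<and> 0 < p \<and> p < q}"
  proof (rule countable_subset)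
    show "{B p q |p q. p \<in> \<rat> \<and> q \<in> \<rat> \<and> 0 < p \<and> p < q} \<subseteq> (\<lambda>(p, q). B p q) ` (\<rat> \<times> \<rat>)" by auto
    show "countable ((\<lambda>(p, q). B p q) ` (\<rat> \<times> \<rat>))" using countable_rat by auto
  qed
  ultimately have "negligible (A \<union> \<Union>{B p q |p q. p \<in> \<rat> \<and> q \<in> \<rat> \<and> 0 < p \<and> p < q})"
    by (intro negligible_Un negligible_countable_Union) auto
  then show ?thesis
  proof (rule negligible_subset, safe)
    fix x assume nd: "\<not> v differentiable (at x)" and "x \<notin> \<Union>{B p q |p q. p \<in> \<rat> \<and> q \<in> \<rat> \<and> 0 < p \<and> p < q}"
    then have nB: "x \<notin> B p q" if "p \<in> \<rat>" "q \<in> \<rat>" "0 < p" "p < q" for p q using that by blast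
    show "x \<in> A"
    proof (rule ccontr)
      assume "x \<notin> A"
      then obtain M where M: "\<forall>\<^sub>F y in at x. diff_quot v x y \<le> M"
        by (auto simp: A_def not_frequently not_less)
      \<comment> \<open>Nonnegative quotients are the reason why only pairs with
        \<open>0 < p\<close> have to be excluded.\<close>
      have nonneg: "0 \<le> diff_quot v x y" for y
        using monoD[OF mono_v, of x y] monoD[OF mono_v, of y x]
        by (cases "x \<le> y") (auto simp: divide_nonpos_nonpos divide_nonneg_nonneg)
      let ?f = "\<lambda>y. ereal (diff_quot v x y)"
      have up: "Limsup (at x) ?f \<le> ereal M" by (intro Limsup_bounded) (use M in auto)
      have lo: "0 \<le> Liminf (at x) ?f" by (intro Liminf_bounded) (use nonneg in auto)
      have le: "Liminf (at x) ?f \<le> Limsup (at x) ?f" by (intro Liminf_le_Limsup) auto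
      have "Liminf (at x) ?f = Limsup (at x) ?f"
      proof (rule ccontr)
        assume "Liminf (at x) ?f \<noteq> Limsup (at x) ?f"
        then have "Liminf (at x) ?f < Limsup (at x) ?f" using le by auto
        \<comment> \<open>Two intermediate reals leave room for a rational on either side:
          \<open>p\<close> between the lower limit and \<open>p'\<close>, and \<open>q\<close>
          between \<open>p'\<close> and \<open>q'\<close>.\<close>
        then obtain p' where p': "Liminf (at x) ?f < ereal p'" "ereal p' < Limsup (at x) ?f"
          using ereal_dense2 by blast
        then obtain q' where q': "p' < q'" "ereal q' < Limsup (at x) ?f"
          using ereal_dense2[of "ereal p'"] by auto
        obtain l where l: "Liminf (at x) ?f = ereal l"
          using lo p'(1) by (cases "Liminf (at x) ?f") auto
        have "l < p'" "0 \<le> l" using l p'(1) lo by auto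
        obtain p where p: "p \<in> \<rat>" "l < p" "p < p'" using Rats_dense_in_real[OF \<open>l < p'\<close>] by auto
        obtain q where q: "q \<in> \<rat>" "p' < q" "q < q'" using Rats_dense_in_real[OF \<open>p' < q'\<close>] by auto
        have "\<exists>\<^sub>F y in at x. diff_quot v x y < p"
        proof (rule ccontr)
          assume "\<not> (\<exists>\<^sub>F y in at x. diff_quot v x y < p)"
          then have "\<forall>\<^sub>F y in at x. ereal p \<le> ?f y" by (simp add: not_frequently not_less)
          then have "ereal p \<le> Liminf (at x) ?f" by (rule Liminf_bounded)
          then show False using l p by simp
        qed
        moreover have "\<exists>\<^sub>F y in at x. q < diff_quot v x y"
        proof (rule ccontr)
          assume "\<not> (\<exists>\<^sub>F y in at x. q < diff_quot v x y)"
          then have "\<forall>\<^sub>F y in at x. ?f y \<le> ereal q" by (simp add: not_frequently not_less)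
          then have "Limsup (at x) ?f \<le> ereal q" by (rule Limsup_bounded)
          then have "ereal q' < ereal q" using q'(2) by (rule order.strict_trans2[rotated])
          then show False using q by simp
        qed
        ultimately have "x \<in> B p q" by (simp add: B_def)
        then show False using nB[OF p(1) q(1)] p q \<open>0 \<le> l\<close> by simp
      qed
      moreover obtain L where "Limsup (at x) ?f = ereal L"
        using up lo le by (cases "Limsup (at x) ?f") auto
      ultimately have "(?f \<longlongrightarrow> ereal L) (at x)"
        by (intro Liminf_eq_Limsup) auto
      then have "((diff_quot v x) \<longlongrightarrow> L) (at x)" by simp
      then have "(v has_field_derivative L) (at x)"
        unfolding has_field_derivative_iff by simp
      then show False using nd by (auto simp: differentiable_def has_field_derivative_def)
    qed
  qed
qed

end

text \<open>Each component is the difference of the monotone functions \<open>w i\<close> and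
  \<open>v\<close> on the open interval, so Lebesgue's theorem applies to both.\<close>

lemma abs_continuous_on_ae_differentiable:
  fixes f :: "real \<Rightarrow> 'a::euclidean_space"
  assumes ac: "abs_continuous_on {a..b} f"
  shows "negligible {x \<in> {a<..<b}. \<not> f differentiable (at x)}"
proof (cases "a \<le> b")
  case True
  obtain v where v: "mono v" "continuous_on UNIV v"
    "\<And>s t. a \<le> s \<Longrightarrow> s \<le> t \<Longrightarrow> t \<le> b \<Longrightarrow> norm (f t - f s) \<le> v t - v s"
    using abs_continuous_on_control[OF ac True] by metis
  have fc: "continuous_on {a..b} f" by (rule abs_continuous_on_imp_continuous_on[OF ac])
  define c where "c x = max a (min b x)" for x
  have cm: "a \<le> c x" "c x \<le> b" "x \<le> y \<Longrightarrow> c x \<le> c y" for x y using True by (auto simp: c_def)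
  \<comment> \<open>Adding \<open>v\<close> compensates every decrease of the component, since
    \<open>v\<close> grows at least as fast as \<open>f\<close> moves. The clamp \<open>c\<close>
    makes \<open>w i\<close> monotone on the whole line and is the identity on
    \<open>[a, b]\<close>.\<close>
  define w where "w i x = v (c x) + f (c x) \<bullet> i" for i x
  have wm: "mono (w i)" if "i \<in> Basis" for i
  proof (intro monoI)
    fix x y :: real assume "x \<le> y"
    have "f (c x) \<bullet> i - f (c y) \<bullet> i \<le> \<bar>(f (c y) - f (c x)) \<bullet> i\<bar>" by (simp add: inner_diff_left)
    also have "\<dots> \<le> norm (f (c y) - f (c x))" by (rule Basis_le_norm[OF that])
    also have "\<dots> \<le> v (c y) - v (c x)" using cm \<open>x \<le> y\<close> by (intro v(3))
    finally show "w i x \<le> w i y" by (simp add: w_def)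
  qed
  have cc: "continuous_on UNIV c" unfolding c_def by (intro continuous_intros)
  have wc: "continuous_on UNIV (w i)" for i
    unfolding w_def using cm
    by (intro continuous_intros continuous_on_compose2[OF v(2) cc] continuous_on_compose2[OF fc cc]) auto
  have "negligible ({x. \<not> v differentiable (at x)} \<union> \<Union>((\<lambda>i. {x. \<not> w i differentiable (at x)}) ` Basis))"
    using mono_continuous_ae_differentiable v wm wc
    by (intro negligible_Un negligible_Union) auto
  then show ?thesis
  proof (rule negligible_subset, safe)
    fix x assume x: "x \<in> {a<..<b}" and nd: "\<not> f differentiable (at x)"
      and w: "x \<notin> \<Union>((\<lambda>i. {x. \<not> w i differentiable (at x)}) ` Basis)" and "v differentiable (at x)"
    have "(\<lambda>x. f x \<bullet> i) differentiable (at x)" if "i \<in> Basis" for i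
    proof -
      have "(\<lambda>x. w i x - v x) differentiable (at x)"
        using w that \<open>v differentiable (at x)\<close> by (intro differentiable_diff) auto
      then obtain D where "((\<lambda>x. w i x - v x) has_derivative D) (at x)" by (auto simp: differentiable_def)
      then have "((\<lambda>x. f x \<bullet> i) has_derivative D) (at x)"
        by (rule has_derivative_transform_within_open[of _ _ _ _ "{a<..<b}"]) (use x in \<open>auto simp: w_def c_def\<close>)
      then show ?thesis by (auto simp: differentiable_def)
    qed
    then show False using nd differentiable_componentwise_within[of f x UNIV] by simp
  qed
qed auto

subsection \<open>Complex matrices and positive square roots\<close>

lemma norm_matrix_power2:
  fixes A :: "complex^'n^'m"
  shows "(norm A)\<^sup>2 = (\<Sum>i\<in>UNIV. \<Sum>j\<in>UNIV. (cmod (A $ i $ j))\<^sup>2)"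
  by (simp add: norm_vec_def L2_set_def sum_nonneg)

text \<open>The norm on nested vectors is the Frobenius norm, and Cauchy-Schwarz on each entry of
  the product makes it submultiplicative.\<close>

lemma norm_matrix_mult_le:
  fixes A :: "complex^'n^'m" and B :: "complex^'p^'n"
  shows "norm (A ** B) \<le> norm A * norm B"
proof -
  have "(cmod ((A ** B) $ i $ k))\<^sup>2 \<le> (\<Sum>j\<in>UNIV. (cmod (A $ i $ j))\<^sup>2) * (\<Sum>j\<in>UNIV. (cmod (B $ j $ k))\<^sup>2)" for i k
  proof -
    have "cmod ((A ** B) $ i $ k) \<le> (\<Sum>j\<in>UNIV. \<bar>cmod (A $ i $ j)\<bar> * \<bar>cmod (B $ j $ k)\<bar>)"
      unfolding matrix_matrix_mult_def by (auto intro!: order_trans[OF norm_sum] sum_mono simp: norm_mult)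
    also have "\<dots> \<le> L2_set (\<lambda>j. cmod (A $ i $ j)) UNIV * L2_set (\<lambda>j. cmod (B $ j $ k)) UNIV"
      by (rule L2_set_mult_ineq)
    finally have "(cmod ((A ** B) $ i $ k))\<^sup>2 \<le>
      (L2_set (\<lambda>j. cmod (A $ i $ j)) UNIV * L2_set (\<lambda>j. cmod (B $ j $ k)) UNIV)\<^sup>2"
      by (intro power_mono) auto
    then show ?thesis by (simp add: power_mult_distrib L2_set_def sum_nonneg)
  qed
  then have "(norm (A ** B))\<^sup>2 \<le>
      (\<Sum>i\<in>UNIV. \<Sum>k\<in>UNIV. (\<Sum>j\<in>UNIV. (cmod (A $ i $ j))\<^sup>2) * (\<Sum>j\<in>UNIV. (cmod (B $ j $ k))\<^sup>2))"
    unfolding norm_matrix_power2 by (intro sum_mono)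
  also have "\<dots> = (norm A)\<^sup>2 * (\<Sum>k\<in>UNIV. \<Sum>j\<in>UNIV. (cmod (B $ j $ k))\<^sup>2)"
    unfolding norm_matrix_power2 by (simp add: sum_product)
  also have "(\<Sum>k\<in>UNIV. \<Sum>j\<in>UNIV. (cmod (B $ j $ k))\<^sup>2) = (norm B)\<^sup>2"
    unfolding norm_matrix_power2 by (rule sum.swap)
  finally have "(norm (A ** B))\<^sup>2 \<le> (norm A * norm B)\<^sup>2" by (simp add: power_mult_distrib)
  then show ?thesis by (rule power2_le_imp_le) simp
qed

text \<open>Provides linearity, continuity and the product rule for derivatives of matrix products
  in one stroke.\<close>

interpretation mm: bounded_bilinear "(**) :: complex^'n^'m \<Rightarrow> complex^'p^'n \<Rightarrow> complex^'p^'m"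
proof
  fix A A' :: "complex^'n^'m" and B B' :: "complex^'p^'n" and r :: real
  show "(A + A') ** B = A ** B + A' ** B"
    by (simp add: matrix_matrix_mult_def vec_eq_iff sum.distrib distrib_right)
  show "A ** (B + B') = A ** B + A ** B'" by (rule matrix_add_ldistrib)
  show "(r *\<^sub>R A) ** B = r *\<^sub>R (A ** B)" "A ** (r *\<^sub>R B) = r *\<^sub>R (A ** B)"
    by (simp_all add: matrix_matrix_mult_def vec_eq_iff scaleR_right.sum)
  show "\<exists>K. \<forall>(a :: complex^'n^'m) (b :: complex^'p^'n). norm (a ** b) \<le> norm a * norm b * K"
    using norm_matrix_mult_le by (intro exI[of _ 1]) auto
qed

lemmas mm_simps = mm.add_left mm.add_right mm.diff_left mm.diff_right mm.minus_left mm.minus_right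
  mm.scaleR_left mm.scaleR_right mm.zero_left mm.zero_right matrix_mul_assoc[symmetric]

lemma ctranspose_ctranspose [simp]: "ctranspose (ctranspose A) = A"
  by (simp add: ctranspose_def vec_eq_iff)

lemma ctranspose_add: "ctranspose (A + B) = ctranspose A + ctranspose B"
  by (simp add: ctranspose_def vec_eq_iff)

lemma ctranspose_diff: "ctranspose (A - B) = ctranspose A - ctranspose B"
  by (simp add: ctranspose_def vec_eq_iff)

lemma ctranspose_minus: "ctranspose (- A) = - ctranspose A"
  by (simp add: ctranspose_def vec_eq_iff)

lemma ctranspose_scaleR: "ctranspose (r *\<^sub>R A) = r *\<^sub>R ctranspose A"
  by (simp add: ctranspose_def vec_eq_iff)

lemma ctranspose_mult: "ctranspose (A ** B) = ctranspose B ** ctranspose A"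
  by (simp add: ctranspose_def vec_eq_iff matrix_matrix_mult_def mult.commute)

lemma ctranspose_zero [simp]: "ctranspose 0 = 0"
  by (simp add: ctranspose_def vec_eq_iff)

lemma ctranspose_mat: "ctranspose (mat c) = mat (cnj c)"
  by (auto simp: ctranspose_def vec_eq_iff mat_def)

lemma ctranspose_one [simp]: "ctranspose (mat 1) = mat 1"
  by (simp add: ctranspose_mat)

lemmas ct_simps = ctranspose_add ctranspose_diff ctranspose_minus ctranspose_scaleR ctranspose_mult

lemma norm_ctranspose [simp]: "norm (ctranspose A) = norm A"
proof -
  have "(norm (ctranspose A))\<^sup>2 = (norm A)\<^sup>2"
    unfolding norm_matrix_power2 ctranspose_def by (simp, rule sum.swap)
  then show ?thesis by simp
qed

lemma bounded_linear_ctranspose: "bounded_linear ctranspose"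
  by (rule bounded_linear_intro[of _ 1]) (simp_all add: ctranspose_add ctranspose_scaleR)

lemma inner_matrix: "A \<bullet> B = Re (trace (ctranspose A ** B))"
proof -
  have "A \<bullet> B = (\<Sum>i\<in>UNIV. \<Sum>j\<in>UNIV. Re (cnj (A $ i $ j) * B $ i $ j))"
    by (simp add: inner_vec_def inner_complex_def)
  also have "\<dots> = (\<Sum>j\<in>UNIV. \<Sum>i\<in>UNIV. Re (cnj (A $ i $ j) * B $ i $ j))" by (rule sum.swap)
  finally show ?thesis by (simp add: trace_def matrix_matrix_mult_def ctranspose_def)
qed

lemma inner_ctranspose: "ctranspose A \<bullet> ctranspose B = B \<bullet> A"
  by (simp only: inner_matrix ctranspose_ctranspose) (rule arg_cong[OF trace_mul_sym])

lemma inner_mult_left: "(A ** M) \<bullet> N = M \<bullet> (ctranspose A ** N)"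
  by (simp add: inner_matrix ct_simps matrix_mul_assoc)

lemma inner_mult_right: "(M ** A) \<bullet> N = M \<bullet> (N ** ctranspose A)"
proof -
  have "(M ** A) \<bullet> N = Re (trace (ctranspose A ** (ctranspose M ** N)))"
    by (simp add: inner_matrix ct_simps matrix_mul_assoc)
  also have "\<dots> = Re (trace ((ctranspose M ** N) ** ctranspose A))" by (rule arg_cong[OF trace_mul_sym])
  finally show ?thesis by (simp add: inner_matrix matrix_mul_assoc)
qed

section \<open>Hermitian forms, positive semidefinite matrices and Cholesky factors\<close>

definition cip :: "complex^'n \<Rightarrow> complex^'n \<Rightarrow> complex" where
  "cip x y = (\<Sum>i\<in>UNIV. cnj (x $ i) * y $ i)"

lemma qform_cip: "qform A x = cip x (A *v x)"
  by (simp add: qform_def cip_def)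

lemma cip_add_left: "cip (x + y) z = cip x z + cip y z"
  and cip_add_right: "cip x (y + z) = cip x y + cip x z"
  and cip_diff_right: "cip x (y - z) = cip x y - cip x z"
  by (simp_all add: cip_def algebra_simps sum.distrib sum_subtractf)

lemma cip_scale_left: "cip (c *s x) y = cnj c * cip x y"
  and cip_scale_right: "cip x (c *s y) = c * cip x y"
  by (simp_all add: cip_def sum_distrib_left mult_ac)

lemma cip_cnj: "cnj (cip x y) = cip y x"
  by (simp add: cip_def mult.commute)

lemma cip_adjoint: "cip x (A *v y) = cip (ctranspose A *v x) y"
  by (simp add: cip_def matrix_vector_mult_def ctranspose_def sum_distrib_left sum_distrib_right mult_ac)
    (rule sum.swap)

lemma cip_self: "cip x x = of_real ((norm x)\<^sup>2)"
  by (simp add: cip_def norm_vec_def L2_set_def sum_nonneg complex_norm_square[symmetric] mult.commute)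

lemma cip_zero [simp]: "cip x 0 = 0" "cip 0 x = 0"
  by (simp_all add: cip_def)

lemma cip_axis: "cip (axis i 1) y = y $ i"
proof -
  have "cip (axis i 1) y = (\<Sum>j\<in>UNIV. if j = i then y $ i else 0)"
    unfolding cip_def by (rule sum.cong) (auto simp: axis_def)
  then show ?thesis by simp
qed

lemma mult_axis: "((A :: complex^'n^'m) *v axis j 1) $ i = A $ i $ j"
  by (simp add: matrix_vector_mult_def axis_def if_distrib[of "\<lambda>x. _ * x"] cong: if_cong)

lemma matrix_scale_vec: "(A :: complex^'n^'m) *v (c *s y) = c *s (A *v y)"
  by (simp add: matrix_vector_mult_def vec_eq_iff sum_distrib_left mult_ac)

text \<open>Polarisation over the complex numbers: testing \<open>x + y\<close> and
  \<open>x + \<i> y\<close> isolates the sesquilinear form.\<close>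

lemma matrix_eq_zero_if_qform_zero:
  assumes "\<And>x. cip x (A *v x) = 0"
  shows "A = (0 :: complex^'n^'n)"
proof -
  have "cip x (A *v y) = 0" for x y
  proof -
    have 1: "cip x (A *v y) + cip y (A *v x) = 0"
      using assms[of "x + y"] assms[of x] assms[of y]
      by (simp add: matrix_vector_right_distrib cip_add_left cip_add_right add.commute)
    have "\<i> * cip x (A *v y) - \<i> * cip y (A *v x) = 0"
      using assms[of "x + \<i> *s y"] assms[of x] assms[of y]
      by (simp add: matrix_vector_right_distrib cip_add_left cip_add_right cip_scale_left cip_scale_right
          matrix_scale_vec)
    then have "cip x (A *v y) = cip y (A *v x)" by simp
    with 1 show ?thesis by simp
  qed
  then have "A $ i $ j = 0" for i j
    using cip_axis[of i "A *v axis j 1"] by (simp add: mult_axis)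
  then show ?thesis by (simp add: vec_eq_iff)
qed

lemma pos_semidefD:
  assumes "pos_semidef A"
  shows "ctranspose A = A" "0 \<le> Re (cip x (A *v x))"
  using assms by (auto simp: pos_semidef_def hermitian_def qform_cip)

lemma pos_semidefI:
  assumes "ctranspose A = A" "\<And>x. 0 \<le> Re (cip x (A *v x))"
  shows "pos_semidef A"
  using assms by (auto simp: pos_semidef_def hermitian_def qform_cip)

lemma pos_semidef_Gram: "pos_semidef (ctranspose C ** C)"
proof (rule pos_semidefI)
  fix x
  have "cip x ((ctranspose C ** C) *v x) = cip (C *v x) (C *v x)"
    using cip_adjoint[of x "ctranspose C" "C *v x"] by (simp add: matrix_vector_mul_assoc)
  then show "0 \<le> Re (cip x ((ctranspose C ** C) *v x))" by (simp add: cip_self)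
qed (simp add: ct_simps)

lemma pos_semidef_Cauchy_Schwarz:
  assumes "pos_semidef A"
  shows "(cmod (cip y (A *v x)))\<^sup>2 \<le> Re (cip y (A *v y)) * Re (cip x (A *v x))"
proof -
  define a b c where "a = Re (cip y (A *v y))" and "b = cip y (A *v x)" and "c = Re (cip x (A *v x))"
  have a: "0 \<le> a" using pos_semidefD[OF assms] by (simp add: a_def)
  have cb: "cip x (A *v y) = cnj b"
    unfolding b_def using pos_semidefD(1)[OF assms] cip_adjoint[of y A x] cip_cnj[of "A *v y" x] by simp
  have *: "0 \<le> c - 2 * t * (cmod b)\<^sup>2 + t\<^sup>2 * (cmod b)\<^sup>2 * a" for t :: real
  proof -
    \<comment> \<open>The phase of \<open>b\<close> turns the cross term into the real number
      \<open>- 2 t\<close> times the squared modulus of \<open>b\<close>.\<close>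
    define z where "z = - of_real t * b"
    have "cip (x + z *s y) (A *v (x + z *s y)) =
        cip x (A *v x) + (z * cnj b + cnj z * b) + (cnj z * z) * cip y (A *v y)"
      by (simp add: matrix_vector_right_distrib cip_add_left cip_add_right cip_scale_left cip_scale_right
          matrix_scale_vec cb b_def[symmetric] algebra_simps)
    also have "z * cnj b + cnj z * b = of_real (- 2 * t * (cmod b)\<^sup>2)"
      by (simp add: z_def complex_norm_square[symmetric] algebra_simps)
    also have "cnj z * z = of_real (t\<^sup>2 * (cmod b)\<^sup>2)"
      using complex_norm_square[of b] by (simp add: z_def power2_eq_square algebra_simps)
    finally show ?thesis
      using pos_semidefD(2)[OF assms, of "x + z *s y"] by (simp add: a_def c_def)
  qed
  have "(cmod b)\<^sup>2 \<le> a * c"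
  proof (cases "a = 0")
    case True
    have "(cmod b)\<^sup>2 = 0"
    proof (rule ccontr)
      assume "(cmod b)\<^sup>2 \<noteq> 0"
      then have "2 * ((c + 1) / (cmod b)\<^sup>2) * (cmod b)\<^sup>2 = 2 * (c + 1)" by simp
      \<comment> \<open>With \<open>a = 0\<close> the quadratic in \<open>t\<close> is affine, and
        this \<open>t\<close> would bring it down to \<open>- c - 2\<close>.\<close>
      then show False using *[of "(c + 1) / (cmod b)\<^sup>2"] *[of 0] True by simp
    qed
    then show ?thesis using True by simp
  next
    case False
    then show ?thesis using *[of "1 / a"] a by (simp add: power2_eq_square field_simps)
  qed
  then show ?thesis by (simp add: a_def b_def c_def)
qed

definition outer :: "complex^'m \<Rightarrow> complex^'n \<Rightarrow> complex^'n^'m" where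
  "outer a b = (\<chi> i j. a $ i * cnj (b $ j))"

lemma ctranspose_outer: "ctranspose (outer a b) = outer b a"
  by (simp add: outer_def ctranspose_def vec_eq_iff)

lemma outer_mult_vec: "outer a b *v x = cip b x *s a"
  by (simp add: outer_def matrix_vector_mult_def vec_eq_iff cip_def sum_distrib_right sum_distrib_left mult_ac)

lemma trace_outer_mult: "trace (outer a b ** M) = cip b (M *v a)"
  by (simp add: trace_def outer_def matrix_matrix_mult_def matrix_vector_mult_def cip_def sum_distrib_left mult_ac)
    (rule sum.swap)

lemma outer_mult_outer: "outer a b ** outer c d = outer (cip b c *s a) d"
  by (simp add: outer_def matrix_matrix_mult_def vec_eq_iff cip_def sum_distrib_left sum_distrib_right mult_ac)

text \<open>Elimination of one index at a time, as in the Cholesky decomposition.\<close>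

lemma pos_semidef_factorization_supported:
  assumes "finite S" "pos_semidef H" "\<And>i j. i \<notin> S \<or> j \<notin> S \<Longrightarrow> H $ i $ j = 0"
  shows "\<exists>C. ctranspose C ** C = H \<and> (\<forall>k. k \<notin> S \<longrightarrow> C $ k = 0)"
  using assms
proof (induction S arbitrary: H rule: finite_induct)
  case empty
  then have "H = 0" by (simp add: vec_eq_iff)
  then show ?case by (intro exI[of _ 0]) simp
next
  case (insert i S)
  note psd = insert.prems(1)
  define h where "h = Re (H $ i $ i)"
  have qa: "cip (axis a 1) (H *v axis b 1) = H $ a $ b" for a b by (simp add: cip_axis mult_axis)
  have h0: "0 \<le> h" using pos_semidefD(2)[OF psd, of "axis i 1"] by (simp add: qa h_def)
  have herm: "H $ a $ b = cnj (H $ b $ a)" for a b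
    using arg_cong[OF pos_semidefD(1)[OF psd], of "\<lambda>M. M $ a $ b"] by (simp add: ctranspose_def)
  show ?case
  proof (cases "h = 0")
    case True
    \<comment> \<open>By Cauchy-Schwarz a vanishing pivot annihilates its whole row, so
      \<open>H\<close> is already supported on \<open>S\<close>.\<close>
    have row: "H $ i $ j = 0" for j
      using pos_semidef_Cauchy_Schwarz[OF psd, of "axis i 1" "axis j 1"] True by (simp add: qa h_def)
    then have "H $ a $ b = 0" if "a \<notin> S \<or> b \<notin> S" for a b
      using that insert.prems(2)[of a b] herm[of a b] by (cases "a = i"; cases "b = i") auto
    from insert.IH[OF psd this] show ?thesis by auto
  next
    case False
    then have "h > 0" using h0 by simp
    have hH: "H $ i $ i = of_real h"
      using herm[of i i] by (simp add: h_def complex_eq_iff)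
    \<comment> \<open>The pivot column, scaled so that \<open>outer w w\<close> agrees with
      \<open>H\<close> in row and column \<open>i\<close>; what remains is the Schur
      complement.\<close>
    define w where "w = (\<chi> a. H $ a $ i / of_real (sqrt h))"
    have ww: "outer w w $ a $ b = H $ a $ i * H $ i $ b / of_real h" for a b
    proof -
      have "of_real (sqrt h) * of_real (sqrt h) = (of_real h :: complex)"
        using h0 by (metis of_real_mult real_sqrt_mult_self abs_of_nonneg)
      then show ?thesis using herm[of i b] by (simp add: outer_def w_def)
    qed
    let ?H = "H - outer w w"
    have psd': "pos_semidef ?H"
    proof (rule pos_semidefI)
      show "ctranspose ?H = ?H" using pos_semidefD(1)[OF psd] by (simp add: ct_simps ctranspose_outer)
    next
      fix x
      have "cip w x = (H *v x) $ i / of_real (sqrt h)"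
        unfolding cip_def w_def matrix_vector_mult_def
        by (simp add: sum_divide_distrib herm[of i])
      then have "(cmod (cip w x))\<^sup>2 = (cmod ((H *v x) $ i))\<^sup>2 / h"
        using h0 by (simp add: norm_divide power_divide)
      moreover have "(cmod ((H *v x) $ i))\<^sup>2 \<le> h * Re (cip x (H *v x))"
        using pos_semidef_Cauchy_Schwarz[OF psd, of "axis i 1" x] by (simp add: cip_axis mult_axis h_def)
      ultimately have "(cmod (cip w x))\<^sup>2 \<le> Re (cip x (H *v x))"
        using \<open>h > 0\<close> by (simp add: divide_le_eq mult.commute)
      moreover have "cip x (outer w w *v x) = of_real ((cmod (cip w x))\<^sup>2)"
        unfolding outer_mult_vec cip_scale_right complex_norm_square cip_cnj ..
      ultimately show "0 \<le> Re (cip x (?H *v x))"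
        by (simp add: matrix_vector_mult_diff_rdistrib cip_diff_right)
    qed
    have "?H $ a $ b = 0" if "a \<notin> S \<or> b \<notin> S" for a b
      using that insert.prems(2)[of a b] insert.prems(2)[of a i] insert.prems(2)[of i b] hH \<open>h > 0\<close>
      by (cases "a = i"; cases "b = i") (auto simp: ww)
    from insert.IH[OF psd' this] obtain C where C: "ctranspose C ** C = ?H" "\<forall>k. k \<notin> S \<longrightarrow> C $ k = 0"
      by blast
    \<comment> \<open>The new factor gets the adjoint of \<open>w\<close> as row \<open>i\<close>.
      That row of \<open>C\<close> is zero, so the mixed terms vanish in the product.\<close>
    define C' where "C' = C + outer (axis i 1) w"
    have "ctranspose C ** outer (axis i 1) w = 0"
      using C(2) insert.hyps(2)
      by (auto simp: vec_eq_iff matrix_matrix_mult_def outer_def ctranspose_def axis_def intro!: sum.neutral)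
    moreover from arg_cong[OF this, of ctranspose] have "outer w (axis i 1) ** C = 0"
      by (simp add: ct_simps ctranspose_outer)
    moreover have "outer w (axis i 1) ** outer (axis i 1) w = outer w w"
      by (simp add: outer_mult_outer cip_axis)
    ultimately have "ctranspose C' ** C' = H"
      using C(1) by (simp add: C'_def ct_simps ctranspose_outer mm_simps)
    moreover have "\<forall>k. k \<notin> insert i S \<longrightarrow> C' $ k = 0"
      using C(2) by (auto simp: C'_def outer_def vec_eq_iff axis_def)
    ultimately show ?thesis by blast
  qed
qed

lemma pos_semidef_factorization:
  fixes H :: "complex^'m^'m"
  assumes "pos_semidef H"
  obtains C :: "complex^'m^'m" where "ctranspose C ** C = H"
  using pos_semidef_factorization_supported[of UNIV H] assms by auto

section \<open>Unitary matrices and the polar decomposition\<close>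

definition unitary :: "complex^'m^'m \<Rightarrow> bool" where
  "unitary W \<longleftrightarrow> ctranspose W ** W = mat 1"

lemma unitary_mult: "unitary V \<Longrightarrow> unitary W \<Longrightarrow> unitary (V ** W)"
  unfolding unitary_def by (simp add: ct_simps) (metis matrix_mul_assoc matrix_mul_lid)

lemma unitary_right: "unitary W \<Longrightarrow> W ** ctranspose W = mat 1"
  unfolding unitary_def by (rule matrix_left_right_inverse[THEN iffD1])

lemma unitary_norm_left: "unitary W \<Longrightarrow> norm (W ** M) = norm M"
proof -
  assume "unitary W"
  then have "(W ** M) \<bullet> (W ** M) = M \<bullet> M"
    by (simp add: inner_mult_left matrix_mul_assoc unitary_def)
  then show ?thesis by (simp add: norm_eq_sqrt_inner)
qed

lemma unitary_norm_right: "unitary W \<Longrightarrow> norm (M ** W) = norm M"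
proof -
  assume "unitary W"
  then have "(M ** W) \<bullet> (M ** W) = M \<bullet> M"
    by (simp add: inner_mult_right matrix_mul_assoc[symmetric] unitary_right)
  then show ?thesis by (simp add: norm_eq_sqrt_inner)
qed

text \<open>Compactness is used twice: for the maximiser in the polar decomposition and for the
  limit in the parallel transport.\<close>

lemma compact_unitary: "compact {W :: complex^'m^'m. unitary W}"
  unfolding compact_eq_bounded_closed
proof
  have "norm W \<le> norm (mat 1 :: complex^'m^'m)" if "unitary W" for W :: "complex^'m^'m"
    using unitary_norm_left[OF that, of "mat 1"] by simp
  then show "bounded {W :: complex^'m^'m. unitary W}" unfolding bounded_iff by blast
  have "continuous_on UNIV (\<lambda>W :: complex^'m^'m. ctranspose W ** W)"
    by (intro mm.continuous_on bounded_linear.continuous_on[OF bounded_linear_ctranspose] continuous_on_id)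
  then show "closed {W :: complex^'m^'m. unitary W}"
    unfolding unitary_def by (intro closed_Collect_eq) auto
qed

text \<open>A unitary \<open>W\<close> maximising \<open>Re tr(W C)\<close> makes \<open>W C\<close> positive semidefinite: multiplying \<open>W\<close> by a
  rotation of the line through \<open>u\<close> cannot increase the trace.\<close>

lemma polar_decomposition:
  fixes C :: "complex^'m^'m"
  obtains W where "unitary W" "pos_semidef (W ** C)"
proof -
  have cont: "continuous_on {W. unitary W} (\<lambda>W. Re (trace (W ** C)))"
    unfolding trace_def by (intro continuous_intros mm.continuous_on)
  have "unitary (mat 1 :: complex^'m^'m)" by (simp add: unitary_def)
  then obtain W where W: "unitary W" "\<And>V. unitary V \<Longrightarrow> Re (trace (V ** C)) \<le> Re (trace (W ** C))"
    using continuous_attains_sup[OF compact_unitary _ cont] by blast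
  let ?M = "W ** C"
  have rot: "Re ((1 - c) * cip u (?M *v u)) \<ge> 0" if "norm u = 1" "cmod c = 1" for u c
  proof -
    have cc: "c * cnj c = 1" using that(2) by (metis complex_norm_square of_real_1 one_power2)
    have uu: "cip u u = 1" using that(1) by (simp add: cip_self)
    define k where "k = 1 - c"
    \<comment> \<open>\<open>mat 1 - ?P\<close> multiplies the line through \<open>u\<close> by
      \<open>c\<close> and fixes its orthogonal complement.\<close>
    let ?P = "outer (k *s u) u"
    have "ctranspose ?P = outer u (k *s u)" by (rule ctranspose_outer)
    also have "\<dots> = outer (cnj k *s u) u" by (simp add: outer_def vec_eq_iff algebra_simps)
    finally have "ctranspose (mat 1 - ?P) ** (mat 1 - ?P) =
        mat 1 - ?P - outer (cnj k *s u) u + outer (cnj k *s u) u ** ?P"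
      by (simp only: ct_simps mm_simps) simp
    also have "outer (cnj k *s u) u ** ?P = ?P + outer (cnj k *s u) u"
    proof -
      have "k * cnj k = k + cnj k" using cc by (simp add: k_def algebra_simps)
      then have "k * (cnj k * z) = k * z + cnj k * z" for z
        by (simp only: distrib_right mult.assoc[symmetric])
      moreover have "cip u (k *s u) = k" by (simp only: cip_scale_right uu) simp
      ultimately show ?thesis
        by (simp add: outer_mult_outer) (simp add: outer_def vec_eq_iff mult.assoc distrib_right)
    qed
    finally have "unitary (mat 1 - ?P)" by (simp add: unitary_def)
    from W(2)[OF unitary_mult[OF this W(1)]]
    have "Re (trace (?M - ?P ** ?M)) \<le> Re (trace ?M)"
      by (simp add: mm_simps)
    moreover have "trace (?P ** ?M) = k * cip u (?M *v u)"
      unfolding trace_outer_mult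
      by (simp only: matrix_scale_vec cip_scale_right)
    ultimately show ?thesis by (simp add: trace_sub k_def)
  qed
  have unit: "cip u (?M *v u) = of_real (cmod (cip u (?M *v u)))" if u: "norm u = 1" for u
  proof (cases "cip u (?M *v u) = 0")
    case False
    define z where "z = cip u (?M *v u)"
    have "z \<noteq> 0" using False by (simp add: z_def)
    \<comment> \<open>The phase that makes \<open>c * z\<close> equal to the modulus of
      \<open>z\<close>; maximality then leaves no room for an imaginary part.\<close>
    define c where "c = cnj z / of_real (cmod z)"
    have "cmod c = 1" using \<open>z \<noteq> 0\<close> by (simp add: c_def norm_divide)
    moreover have "c * z = of_real (cmod z)"
    proof -
      have "c * z = (z * cnj z) / of_real (cmod z)" by (simp add: c_def mult.commute)
      also have "\<dots> = of_real ((cmod z)\<^sup>2) / of_real (cmod z)" by (simp only: complex_norm_square)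
      also have "\<dots> = of_real (cmod z)" using \<open>z \<noteq> 0\<close> by (simp add: power2_eq_square)
      finally show ?thesis .
    qed
    ultimately have "cmod z \<le> Re z" using rot[OF u, of c] by (simp add: z_def[symmetric] left_diff_distrib)
    then have "Re z = cmod z" using complex_Re_le_cmod[of z] by simp
    moreover from this have "Im z = 0" using cmod_power2[of z] by simp
    ultimately show ?thesis by (simp add: z_def[symmetric] complex_eq_iff)
  qed simp
  have all: "cip x (?M *v x) = of_real (cmod (cip x (?M *v x)))" for x
  proof (cases "x = 0")
    case False
    define r where "r = norm x"
    define u where "u = (1 / of_real r) *s x"
    define z where "z = cip u (?M *v u)"
    have "r \<noteq> 0" using False by (simp add: r_def)
    then have x: "x = of_real r *s u" by (simp add: u_def vec_eq_iff)
    have "u = (1 / r) *\<^sub>R x" by (simp add: u_def vec_eq_iff scaleR_conv_of_real[where 'a=complex])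
    then have "norm u = 1" using False by (simp add: r_def)
    then have z: "z = of_real (cmod z)" unfolding z_def by (rule unit)
    have "cip x (?M *v x) = cip (of_real r *s u) (?M *v (of_real r *s u))"
      by (rule arg_cong[OF x, of "\<lambda>y. cip y (?M *v y)"])
    also have "\<dots> = of_real (r\<^sup>2) * z"
      by (simp only: matrix_scale_vec cip_scale_left cip_scale_right z_def) (simp add: power2_eq_square)
    also have "\<dots> = of_real (r\<^sup>2 * cmod z)" by (subst z) simp
    finally have eq: "cip x (?M *v x) = of_real (r\<^sup>2 * cmod z)" .
    then have "cmod (cip x (?M *v x)) = r\<^sup>2 * cmod z" by (simp only: norm_of_real) simp
    with eq show ?thesis by simp
  qed simp
  \<comment> \<open>A form with real values only belongs to a Hermitian matrix, by
    polarisation.\<close>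
  have "cip x ((ctranspose ?M - ?M) *v x) = 0" for x
  proof -
    have "cip x (ctranspose ?M *v x) = cnj (cip x (?M *v x))"
      using cip_adjoint[of x "ctranspose ?M" x] by (simp add: cip_cnj)
    also have "\<dots> = cip x (?M *v x)" using all[of x] by (metis complex_cnj_complex_of_real)
    finally show ?thesis by (simp add: matrix_vector_mult_diff_rdistrib cip_diff_right)
  qed
  then have "ctranspose ?M - ?M = 0" by (rule matrix_eq_zero_if_qform_zero)
  moreover have "0 \<le> Re (cip x (?M *v x))" for x using arg_cong[OF all[of x], of Re] by simp
  ultimately have "pos_semidef ?M" by (intro pos_semidefI) auto
  then show thesis using W(1) that by blast
qed

text \<open>The positive factor \<open>W ** C\<close> is Hermitian, so its square is its Gram
  matrix, in which the unitary \<open>W\<close> cancels.\<close>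

lemma pos_semidef_sqrt_exists:
  fixes H :: "complex^'m^'m"
  assumes "pos_semidef H"
  obtains R where "pos_semidef R" "R ** R = H"
proof -
  obtain C :: "complex^'m^'m" where C: "ctranspose C ** C = H" using pos_semidef_factorization[OF assms] .
  obtain W where W: "unitary W" "pos_semidef (W ** C)" using polar_decomposition[of C] .
  have "(W ** C) ** (W ** C) = ctranspose (W ** C) ** (W ** C)" using pos_semidefD(1)[OF W(2)] by simp
  also have "\<dots> = ctranspose C ** ((ctranspose W ** W) ** C)" by (simp add: ct_simps mm_simps)
  also have "\<dots> = H" using W(1) C by (simp add: unitary_def)
  finally show thesis using W(2) that by blast
qed

text \<open>With a Hermitian root \<open>R\<close> of \<open>A\<close>, the number
  \<open>M \<bullet> (A ** M)\<close> is the squared norm of \<open>R ** M\<close>; the right-handed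
  version follows by adjoints.\<close>

lemma inner_pos_semidef:
  fixes A M :: "complex^'m^'m"
  assumes "pos_semidef A"
  shows "0 \<le> M \<bullet> (A ** M)" "M \<bullet> (A ** M) = 0 \<Longrightarrow> A ** M = 0" "0 \<le> M \<bullet> (M ** A)"
proof -
  obtain R where R: "pos_semidef R" "R ** R = A" using pos_semidef_sqrt_exists[OF assms] .
  have *: "M \<bullet> (A ** M) = (R ** M) \<bullet> (R ** M)" for M :: "complex^'m^'m"
    by (simp add: inner_mult_left pos_semidefD(1)[OF R(1)] mm_simps R(2)[symmetric])
  show "0 \<le> M \<bullet> (A ** M)" by (simp add: *)
  have "M \<bullet> (M ** A) = (ctranspose M) \<bullet> (A ** ctranspose M)"
    using inner_ctranspose[of M "M ** A"] pos_semidefD(1)[OF assms] by (simp add: ct_simps inner_commute)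
  then show "0 \<le> M \<bullet> (M ** A)" using * by simp
  assume "M \<bullet> (A ** M) = 0"
  then have "R ** M = 0" using * by simp
  then show "A ** M = 0" by (simp add: mm_simps R(2)[symmetric])
qed

text \<open>For \<open>D = R - S\<close> one has \<open>R D + D S = R R - S S = 0\<close>. Paired
  with \<open>D\<close>, both summands are nonnegative, so both vanish, whence
  \<open>R D = S D = 0\<close> and finally \<open>D D = 0\<close>.\<close>

lemma pos_semidef_sqrt_unique:
  assumes "pos_semidef R" "pos_semidef S" "R ** R = S ** S"
  shows "R = S"
proof -
  define D where "D = R - S"
  have cD: "ctranspose D = D" using assms by (simp add: D_def ct_simps pos_semidefD(1))
  have "D \<bullet> (R ** D) + D \<bullet> (D ** S) = D \<bullet> (R ** R - S ** S)"
    unfolding inner_add_right[symmetric] by (rule arg_cong[of _ _ "inner D"]) (simp add: D_def mm_simps)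
  then have "D \<bullet> (R ** D) = 0" "D \<bullet> (D ** S) = 0"
    using inner_pos_semidef(1)[OF assms(1), of D] inner_pos_semidef(3)[OF assms(2), of D] assms(3) by auto
  moreover have "D \<bullet> (D ** S) = D \<bullet> (S ** D)"
    using inner_ctranspose[of D "D ** S"] cD pos_semidefD(1)[OF assms(2)]
    by (simp add: ct_simps inner_commute)
  ultimately have "R ** D = 0" "S ** D = 0" using inner_pos_semidef(2) assms by auto
  then have "D ** D = 0" by (simp add: D_def mm_simps)
  then have "D \<bullet> D = 0" using cD by (simp add: inner_matrix trace_def)
  then show ?thesis by (simp add: D_def)
qed

lemma msqrt_unique: "pos_semidef R \<Longrightarrow> R ** R = A \<Longrightarrow> msqrt A = R"
  unfolding msqrt_def using pos_semidef_sqrt_unique by (intro the_equality) auto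

lemma msqrt_pos_semidef:
  assumes "pos_semidef A"
  shows "pos_semidef (msqrt A)" "msqrt A ** msqrt A = A"
proof -
  obtain R where "pos_semidef R" "R ** R = A" using pos_semidef_sqrt_exists[OF assms] .
  moreover from this have "msqrt A = R" by (rule msqrt_unique)
  ultimately show "pos_semidef (msqrt A)" "msqrt A ** msqrt A = A" by auto
qed

lemma trace_mabs_square: "Re (trace (mabs Q ** mabs Q)) = (norm Q)\<^sup>2"
  using msqrt_pos_semidef(2)[OF pos_semidef_Gram[of Q]] inner_matrix[of Q Q]
  by (simp add: mabs_def power2_norm_eq_inner)

text \<open>A quantitative form of positivity: the trace of the inverse replaces the reciprocal of
  the smallest eigenvalue. It appears as the squared norm of \<open>S ** T\<close>, where
  \<open>T\<close> is a root of \<open>R\<close>.\<close>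

lemma inner_inverse_lower_bound:
  assumes "pos_semidef R" "S ** R = mat 1" "ctranspose S = S"
  shows "(norm M)\<^sup>2 \<le> Re (trace S) * (M \<bullet> (R ** M))"
proof -
  obtain T where T: "pos_semidef T" "T ** T = R" using pos_semidef_sqrt_exists[OF assms(1)] .
  note cT = pos_semidefD(1)[OF T(1)]
  have "M = (S ** T) ** (T ** M)"
    using assms(2) T(2) by (metis matrix_mul_assoc matrix_mul_lid)
  then have "norm M \<le> norm (S ** T) * norm (T ** M)" using norm_matrix_mult_le by metis
  then have "(norm M)\<^sup>2 \<le> (norm (S ** T))\<^sup>2 * (norm (T ** M))\<^sup>2"
    by (metis norm_ge_zero power_mono power_mult_distrib)
  also have "(norm (T ** M))\<^sup>2 = M \<bullet> (R ** M)"
    using cT by (simp add: power2_norm_eq_inner inner_mult_left mm_simps T(2)[symmetric])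
  also have "(norm (S ** T))\<^sup>2 = Re (trace (T ** (S ** S ** T)))"
    using cT assms(3) by (simp add: power2_norm_eq_inner inner_matrix ct_simps mm_simps)
  also have "trace (T ** (S ** S ** T)) = trace (S ** (S ** (T ** T)))"
    by (subst trace_mul_sym) (simp add: mm_simps)
  also have "\<dots> = trace S" using assms(2) T(2) by simp
  finally show ?thesis .
qed

text \<open>The identity \<open>R D + D R' = R R - R' R'\<close> is paired with \<open>D\<close>;
  the second summand is nonnegative and is dropped, so only \<open>R\<close> has to be
  invertible.\<close>

lemma sqrt_Lipschitz:
  fixes R :: "complex^'m^'m"
  assumes "pos_semidef R" "S ** R = mat 1" "ctranspose S = S" "pos_semidef R'"
  shows "norm (R - R') \<le> Re (trace S) * norm (R ** R - R' ** R')"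
proof -
  define D where "D = R - R'"
  have "D \<bullet> (R ** D) + D \<bullet> (D ** R') = D \<bullet> (R ** R - R' ** R')"
    unfolding inner_add_right[symmetric] by (rule arg_cong[of _ _ "inner D"]) (simp add: D_def mm_simps)
  then have 1: "D \<bullet> (R ** D) \<le> norm D * norm (R ** R - R' ** R')"
    using inner_pos_semidef(3)[OF assms(4), of D] Cauchy_Schwarz_ineq2[of D "R ** R - R' ** R'"] by auto
  \<comment> \<open>A negative trace would contradict the lower bound at \<open>M = mat 1\<close>,
    as the identity matrix has positive norm.\<close>
  have 2: "0 \<le> Re (trace S)"
  proof (rule ccontr)
    assume "\<not> 0 \<le> Re (trace S)"
    then have "Re (trace S) * (mat 1 \<bullet> (R ** mat 1)) \<le> 0"
      using inner_pos_semidef(1)[OF assms(1), of "mat 1"] by (intro mult_nonpos_nonneg) auto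
    then have "(norm (mat 1 :: complex^'m^'m))\<^sup>2 \<le> 0"
      using inner_inverse_lower_bound[OF assms(1-3), of "mat 1"] by linarith
    moreover have "(mat 1 :: complex^'m^'m) $ undefined $ undefined \<noteq> 0 $ undefined $ undefined"
      by (simp add: mat_def)
    then have "(mat 1 :: complex^'m^'m) \<noteq> 0" by metis
    ultimately show False by simp
  qed
  have "norm D * norm D \<le> Re (trace S) * (D \<bullet> (R ** D))"
    using inner_inverse_lower_bound[OF assms(1-3), of D] by (simp add: power2_eq_square)
  also have "\<dots> \<le> Re (trace S) * (norm D * norm (R ** R - R' ** R'))"
    using 1 2 by (intro mult_left_mono)
  finally have "norm D * norm D \<le> norm D * (Re (trace S) * norm (R ** R - R' ** R'))"
    by (simp add: mult_ac)
  then show ?thesis using 2 by (cases "D = 0") (auto simp: D_def[symmetric])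
qed

subsection \<open>The Cayley transform\<close>

lemma mm_cancel:
  fixes A B C :: "complex^'m^'m"
  assumes "A ** B = C"
  shows "A ** (B ** X) = C ** X"
  using assms by (simp add: matrix_mul_assoc)

lemma norm_mm_le:
  fixes A B :: "complex^'m^'m"
  assumes "norm A \<le> a" "norm B \<le> b"
  shows "norm (A ** B) \<le> a * b"
  by (rule order_trans[OF norm_matrix_mult_le mult_mono])
    (use assms norm_ge_zero[of A] in \<open>auto intro: order_trans[OF norm_ge_zero]\<close>)

lemma matrix_inv_eq:
  fixes A B :: "complex^'m^'m"
  assumes "A ** B = mat 1"
  shows "matrix_inv A = B"
proof -
  have BA: "B ** A = mat 1" using assms matrix_left_right_inverse by blast
  have "A ** matrix_inv A = mat 1 \<and> matrix_inv A ** A = mat 1"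
    unfolding matrix_inv_def by (rule someI[of _ B]) (use assms BA in auto)
  then show ?thesis using BA by (metis matrix_mul_assoc matrix_mul_lid matrix_mul_rid)
qed

definition resolvent :: "complex^'m^'m \<Rightarrow> complex^'m^'m" where
  "resolvent A = matrix_inv (mat 1 - A)"

text \<open>An anti-Hermitian \<open>A\<close> cannot have eigenvalue 1: from
  \<open>A x = x\<close>, moving \<open>A\<close> to the other side gives
  \<open>cip x x = - cip x x\<close>.\<close>

lemma resolvent_inverse:
  fixes A :: "complex^'m^'m"
  assumes "ctranspose A = - A"
  shows "resolvent A ** (mat 1 - A) = mat 1" "(mat 1 - A) ** resolvent A = mat 1"
proof -
  have "x = 0" if "(mat 1 - A) *v x = 0" for x
  proof -
    have "A *v x = x" using that by (simp add: matrix_vector_mult_diff_rdistrib)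
    moreover have "(- A) *v x = - (A *v x)"
      by (simp add: matrix_vector_mult_def vec_eq_iff sum_negf)
    moreover have "cip (- y) z = - cip y z" for y z :: "complex^'m"
      by (simp add: cip_def sum_negf)
    ultimately have "cip x x = - cip x x" using cip_adjoint[of x A x] assms by simp
    then show ?thesis by (simp add: cip_self)
  qed
  then have "inj ((*v) (mat 1 - A))"
    by (intro injI) (metis matrix_vector_mult_diff_distrib right_minus_eq)
  then obtain B where "B ** (mat 1 - A) = mat 1" using matrix_left_invertible_injective by blast
  then have "(mat 1 - A) ** B = mat 1" using matrix_left_right_inverse by blast
  moreover from this have "resolvent A = B" unfolding resolvent_def by (rule matrix_inv_eq)
  ultimately show "resolvent A ** (mat 1 - A) = mat 1" "(mat 1 - A) ** resolvent A = mat 1"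
    using \<open>B ** (mat 1 - A) = mat 1\<close> by auto
qed

lemma resolvent_antihermitian_ctranspose:
  fixes A :: "complex^'m^'m"
  assumes "ctranspose A = - A"
  shows "ctranspose (resolvent A) = resolvent (- A)"
proof -
  have "(mat 1 - (- A)) ** ctranspose (resolvent A) = mat 1"
    using arg_cong[OF resolvent_inverse(1)[OF assms], of ctranspose] assms by (simp add: ct_simps)
  then show ?thesis unfolding resolvent_def[of "- A"] by (rule matrix_inv_eq[symmetric])
qed

text \<open>For \<open>N = resolvent A ** M\<close> the product \<open>N \<bullet> (A ** N)\<close>
  vanishes by antisymmetry, so the squared norm of \<open>N\<close> is \<open>N \<bullet> M\<close>.
  The bound does not depend on the size of \<open>A\<close>.\<close>

lemma norm_resolvent_mult:
  fixes A :: "complex^'m^'m"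
  assumes "ctranspose A = - A"
  shows "norm (resolvent A ** M) \<le> norm M"
proof -
  let ?N = "resolvent A ** M"
  have "?N \<bullet> (A ** ?N) = - (?N \<bullet> (A ** ?N))"
    using inner_mult_left[of A ?N ?N] assms by (simp add: inner_commute mm.minus_left)
  then have "?N \<bullet> ?N = ?N \<bullet> ((mat 1 - A) ** ?N)"
    by (simp add: mm.diff_left inner_diff_right)
  also have "(mat 1 - A) ** ?N = M"
    by (simp add: matrix_mul_assoc resolvent_inverse(2)[OF assms])
  finally have "norm ?N * norm ?N \<le> norm ?N * norm M"
    using Cauchy_Schwarz_ineq2[of ?N M] by (simp add: power2_norm_eq_inner[symmetric] power2_eq_square)
  then show ?thesis by (cases "?N = 0") auto
qed

lemma norm_mult_resolvent:
  fixes A :: "complex^'m^'m"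
  assumes "ctranspose A = - A"
  shows "norm (M ** resolvent A) \<le> norm M"
proof -
  have "norm (M ** resolvent A) = norm (resolvent (- A) ** ctranspose M)"
    using norm_ctranspose[of "M ** resolvent A"] assms
    by (simp only: ct_simps resolvent_antihermitian_ctranspose)
  also have "\<dots> \<le> norm (ctranspose M)"
    by (rule norm_resolvent_mult) (use assms in \<open>simp add: ct_simps\<close>)
  finally show ?thesis by simp
qed

text \<open>The Cayley transform \<open>(1 - A)\<^sup>-\<^sup>1(1 + A)\<close>, written as \<open>2(1 - A)\<^sup>-\<^sup>1 - 1\<close>.\<close>

definition cayley :: "complex^'m^'m \<Rightarrow> complex^'m^'m" where
  "cayley A = 2 *\<^sub>R resolvent A - mat 1"

lemma cayley_alt:
  assumes "ctranspose A = - A"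
  shows "cayley A = resolvent A ** (mat 1 + A)" "cayley A = (mat 1 + A) ** resolvent A"
proof -
  have "resolvent A ** A = resolvent A - mat 1" "A ** resolvent A = resolvent A - mat 1"
    using resolvent_inverse[OF assms] by (simp_all add: mm_simps algebra_simps)
  then show "cayley A = resolvent A ** (mat 1 + A)" "cayley A = (mat 1 + A) ** resolvent A"
    by (simp_all add: mm_simps cayley_def scaleR_2)
qed

lemma unitary_cayley:
  assumes "ctranspose A = - A"
  shows "unitary (cayley A)"
proof -
  have A': "ctranspose (- A) = - (- A)" using assms by (simp add: ct_simps)
  have "ctranspose (cayley A) = resolvent (- A) ** (mat 1 + - A)"
    using resolvent_antihermitian_ctranspose[OF assms] cayley_alt(1)[OF A']
    by (simp add: cayley_def ct_simps)
  then have "ctranspose (cayley A) ** cayley A =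
      resolvent (- A) ** (((mat 1 - A) ** (mat 1 + A)) ** resolvent A)"
    using cayley_alt(2)[OF assms] by (simp add: matrix_mul_assoc)
  also have "(mat 1 - A) ** (mat 1 + A) = (mat 1 - (- A)) ** (mat 1 - A)"
    by (simp add: mm_simps)
  also have "resolvent (- A) ** (((mat 1 - (- A)) ** (mat 1 - A)) ** resolvent A) =
      (resolvent (- A) ** (mat 1 - (- A))) ** ((mat 1 - A) ** resolvent A)"
    by (simp only: matrix_mul_assoc)
  also have "\<dots> = mat 1"
    by (simp only: resolvent_inverse[OF assms] resolvent_inverse[OF A']) simp
  finally show ?thesis by (simp add: unitary_def)
qed

lemma cayley_commute:
  assumes "ctranspose A = - A" "J ** A = A ** J"
  shows "J ** cayley A = cayley A ** J"
proof -
  let ?X = "resolvent A"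
  have "J ** ?X = (?X ** (mat 1 - A)) ** (J ** ?X)" by (simp add: resolvent_inverse[OF assms(1)])
  also have "\<dots> = ?X ** (J ** ((mat 1 - A) ** ?X))"
    using assms(2) by (simp add: mm_simps mm_cancel[OF assms(2)])
  also have "\<dots> = ?X ** J" by (simp add: resolvent_inverse[OF assms(1)])
  finally show ?thesis by (simp add: cayley_def mm_simps)
qed

lemma resolvent_minus_one:
  assumes "ctranspose A = - A"
  shows "resolvent A - mat 1 = resolvent A ** A"
  using resolvent_inverse(1)[OF assms] by (simp add: mm_simps algebra_simps)

lemma cayley_minus_one:
  assumes "ctranspose A = - A"
  shows "norm (cayley A - mat 1) \<le> 2 * norm A"
proof -
  have "cayley A - mat 1 = 2 *\<^sub>R (resolvent A - mat 1)" by (simp add: cayley_def scaleR_2)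
  then show ?thesis using norm_resolvent_mult[OF assms, of A] by (simp add: resolvent_minus_one[OF assms])
qed

lemma cayley_second_order:
  assumes "ctranspose A = - A"
  shows "norm (cayley A - mat 1 - 2 *\<^sub>R A) \<le> 2 * (norm A)\<^sup>2"
proof -
  have "cayley A - mat 1 - 2 *\<^sub>R A = 2 *\<^sub>R (resolvent A - mat 1 - A)"
    by (simp add: cayley_def scaleR_2)
  also have "resolvent A - mat 1 - A = (resolvent A - mat 1) ** A"
    by (subst (1) resolvent_minus_one[OF assms]) (simp only: mm.diff_left matrix_mul_lid)
  also have "\<dots> = resolvent A ** (A ** A)" by (simp add: resolvent_minus_one[OF assms] mm_simps)
  finally show ?thesis
    using norm_resolvent_mult[OF assms, of "A ** A"] norm_matrix_mult_le[of A A]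
    by (simp add: power2_eq_square)
qed

lemma resolvent_diff:
  assumes "ctranspose A = - A" "ctranspose B = - B"
  shows "resolvent A - resolvent B = resolvent A ** ((A - B) ** resolvent B)"
proof -
  have "A - B = (mat 1 - B) - (mat 1 - A)" by simp
  then have "resolvent A ** ((A - B) ** resolvent B) =
      resolvent A ** ((mat 1 - B) ** resolvent B) - (resolvent A ** (mat 1 - A)) ** resolvent B"
    by (simp only: mm.diff_left mm.diff_right matrix_mul_assoc)
  then show ?thesis by (simp only: resolvent_inverse[OF assms(1)] resolvent_inverse[OF assms(2)]) simp
qed

lemma cayley_Lipschitz:
  assumes "ctranspose A = - A" "ctranspose B = - B"
  shows "norm (cayley A - cayley B) \<le> 2 * norm (A - B)"
proof -
  have "cayley A - cayley B = 2 *\<^sub>R (resolvent A ** ((A - B) ** resolvent B))"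
    by (simp add: cayley_def resolvent_diff[OF assms, symmetric] scaleR_diff_right)
  then show ?thesis
    using order_trans[OF norm_resolvent_mult[OF assms(1)] norm_mult_resolvent[OF assms(2)]] by simp
qed

text \<open>The point is a bound by the product of both norms: it vanishes when either factor does.
  Both the product of deviations from 1 and the second difference of resolvents have this property,
  and each contributes 4 to the constant.\<close>

lemma cayley_mult:
  assumes A: "ctranspose A = - A" and B: "ctranspose B = - B"
  shows "norm (cayley B ** cayley A - cayley (A + B)) \<le> 8 * norm A * norm B"
proof -
  have AB: "ctranspose (A + B) = - (A + B)" using A B by (simp add: ct_simps)
  let ?X = "resolvent A" and ?Y = "resolvent B" and ?Z = "resolvent (A + B)"
  have Z: "?Z - ?X = ?Z ** (B ** ?X)" "?Z - ?Y = ?Z ** (A ** ?Y)"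
    using resolvent_diff[OF AB A] resolvent_diff[OF AB B] by simp_all
  have X: "?Y - mat 1 = ?Y ** B" "?X - mat 1 = ?X ** A"
    using resolvent_minus_one A B by auto
  have "?Z - ?X - ?Y + mat 1 = (?Z - ?X) - (?Y - mat 1)" by simp
  also have "\<dots> = ?Z ** (B ** ?X) - ?Y ** B" by (simp only: Z(1) X(1))
  also have "\<dots> = ?Z ** (B ** (?X - mat 1)) + (?Z - ?Y) ** B" by (simp add: mm_simps)
  also have "\<dots> = ?Z ** (B ** (?X ** A)) + ?Z ** (A ** (?Y ** B))"
    by (simp only: Z(2) X(2) matrix_mul_assoc)
  finally have "norm (?Z - ?X - ?Y + mat 1) \<le> norm (B ** (?X ** A)) + norm (A ** (?Y ** B))"
    by (simp only:) (intro norm_triangle_le add_mono norm_resolvent_mult[OF AB])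
  also have "\<dots> \<le> norm B * norm A + norm A * norm B"
    by (intro add_mono norm_mm_le norm_resolvent_mult A B order_refl)
  finally have 1: "norm (?Z - ?X - ?Y + mat 1) \<le> 2 * norm A * norm B" by simp
  have 2: "norm ((cayley B - mat 1) ** (cayley A - mat 1)) \<le> (2 * norm B) * (2 * norm A)"
    by (intro norm_mm_le cayley_minus_one A B)
  have "cayley B ** cayley A = (cayley B - mat 1) ** (cayley A - mat 1) + (cayley B + cayley A - mat 1)"
    by (simp add: mm.diff_left mm.diff_right)
  moreover have "cayley B + cayley A - mat 1 - cayley (A + B) = - (2 *\<^sub>R (?Z - ?X - ?Y + mat 1))"
    by (simp add: cayley_def scaleR_right_distrib scaleR_right_diff_distrib scaleR_2[of "mat 1"])
  ultimately have "cayley B ** cayley A - cayley (A + B) =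
      (cayley B - mat 1) ** (cayley A - mat 1) - 2 *\<^sub>R (?Z - ?X - ?Y + mat 1)"
    by (metis (no_types, lifting) add_diff_eq diff_conv_add_uminus)
  also have "norm \<dots> \<le> (2 * norm B) * (2 * norm A) + 2 * (2 * norm A * norm B)"
    using 1 2 by (intro order_trans[OF norm_triangle_ineq4] add_mono) auto
  finally show ?thesis by simp
qed

subsection \<open>Parallel transport\<close>

text \<open>Ordered products over finite partitions, later factors on the left. A relation is used
  because each partition has its own product and the limit only has to lie in the closure of all of
  them.\<close>

inductive chain :: "(real \<Rightarrow> real \<Rightarrow> complex^'m^'m) \<Rightarrow> real \<Rightarrow> real \<Rightarrow> complex^'m^'m \<Rightarrow> bool" for V where
  single: "s \<le> t \<Longrightarrow> chain V s t (V s t)"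
| step: "chain V r s p \<Longrightarrow> s \<le> t \<Longrightarrow> chain V r t (V s t ** p)"

lemma chain_le: "chain V s t p \<Longrightarrow> s \<le> t"
  by (induction rule: chain.induct) auto

text \<open>Since the error of one composition is bilinear in the increments of the control \<open>v\<close>, it can be
  summed along a chain without loss.\<close>

lemma chain_estimate:
  assumes "chain V r t p" "a \<le> r" "t \<le> b" "mono v"
    and uni: "\<And>s t. a \<le> s \<Longrightarrow> s \<le> t \<Longrightarrow> t \<le> b \<Longrightarrow> unitary (V s t)"
    and local: "\<And>r s t. a \<le> r \<Longrightarrow> r \<le> s \<Longrightarrow> s \<le> t \<Longrightarrow> t \<le> b \<Longrightarrow>
      norm (V s t ** V r s - V r t) \<le> K * ((v s - v r) * (v t - v s))"
    and "0 \<le> K"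
  shows "norm (p - V r t) \<le> K * (v t - v r)\<^sup>2"
  using assms(1-3)
proof (induction rule: chain.induct)
  case (single s t)
  then show ?case using \<open>0 \<le> K\<close> by simp
next
  case (step r s p t)
  have rs: "r \<le> s" using chain_le step(1) .
  define x y where "x = v s - v r" and "y = v t - v s"
  have xy: "0 \<le> x" "0 \<le> y" using monoD[OF \<open>mono v\<close>] rs step(2) by (auto simp: x_def y_def)
  \<comment> \<open>The unitary factor \<open>V s t\<close> passes the earlier error on without
    enlarging it.\<close>
  have "V s t ** p - V r t = V s t ** (p - V r s) + (V s t ** V r s - V r t)" by (simp add: mm_simps)
  then have "norm (V s t ** p - V r t) \<le> norm (V s t ** (p - V r s)) + norm (V s t ** V r s - V r t)"
    by (simp only: norm_triangle_ineq)
  also have "\<dots> \<le> K * x\<^sup>2 + K * (x * y)"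
    using step rs uni[of s t] local[of r s t] by (simp add: unitary_norm_left x_def y_def)
  \<comment> \<open>The mixed term of the square absorbs the new error, so the constant does not
    grow with the length of the chain.\<close>
  also have "\<dots> \<le> K * (x + y)\<^sup>2"
    using xy \<open>0 \<le> K\<close> by (simp add: power2_sum distrib_left)
  finally show ?case by (simp add: x_def y_def)
qed

text \<open>A new largest time \<open>b\<close> is reached from the previous maximum
  \<open>m\<close> by one step. Any chain ending in \<open>m\<close> is then prolonged by that step,
  so all pairs are consistent at once.\<close>

lemma chain_selection_finite:
  assumes "finite F" "F \<subseteq> I"
    and one: "\<And>t. t \<in> I \<Longrightarrow> V t t = mat 1"
    and G: "mat 1 \<in> G" "\<And>W. W \<in> G \<Longrightarrow> unitary W" "\<And>s t W. s \<in> I \<Longrightarrow> t \<in> I \<Longrightarrow> W \<in> G \<Longrightarrow> V s t ** W \<in> G"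
  shows "\<exists>U. (\<forall>t. U t \<in> G) \<and> (\<forall>s\<in>F. \<forall>t\<in>F. s \<le> t \<longrightarrow> chain V s t (U t ** ctranspose (U s)))"
  using assms(1,2)
proof (induction rule: finite_linorder_max_induct)
  case empty
  then show ?case using G(1) by (intro exI[of _ "\<lambda>_. mat 1"]) auto
next
  case (insert b F)
  have self: "chain V t t (W ** ctranspose W)" if "t \<in> I" "W \<in> G" for t W
    using chain.single[of t t V] one[OF that(1)] unitary_right[OF G(2)[OF that(2)]] by simp
  show ?case
  proof (cases "F = {}")
    case True
    then show ?thesis using self[of b "mat 1"] G(1) insert.prems
      by (intro exI[of _ "\<lambda>_. mat 1"]) auto
  next
    case False
    obtain U where "(\<forall>t. U t \<in> G) \<and> (\<forall>s\<in>F. \<forall>t\<in>F. s \<le> t \<longrightarrow> chain V s t (U t ** ctranspose (U s)))"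
      using insert.IH insert.prems by auto
    then have U: "\<And>t. U t \<in> G" "\<And>s t. s \<in> F \<Longrightarrow> t \<in> F \<Longrightarrow> s \<le> t \<Longrightarrow> chain V s t (U t ** ctranspose (U s))"
      by auto
    define m where "m = Max F"
    have m: "m \<in> F" "\<And>s. s \<in> F \<Longrightarrow> s \<le> m" using False insert.hyps(1) by (auto simp: m_def)
    have "b \<notin> F" "m < b" using insert.hyps(2) m(1) by auto
    define U' where "U' = U(b := V m b ** U m)"
    have "U' t \<in> G" for t
      using U(1) G(3) m(1) insert.prems by (auto simp: U'_def)
    moreover have "chain V s t (U' t ** ctranspose (U' s))"
      if st: "s \<in> insert b F" "t \<in> insert b F" "s \<le> t" for s t
    proof (cases "t = b")
      case True
      show ?thesis
      proof (cases "s = b")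
        case True
        then show ?thesis using \<open>t = b\<close> self[of b "U' b"] \<open>\<And>t. U' t \<in> G\<close> insert.prems by auto
      next
        case False
        then have "s \<in> F" using st by auto
        from chain.step[OF U(2)[OF this m(1) m(2)[OF this]], of b] \<open>m < b\<close>
        show ?thesis using True False by (simp add: U'_def matrix_mul_assoc)
      qed
    next
      case False
      then have "t \<in> F" using st by auto
      moreover have "s \<in> F" using st insert.hyps(2) \<open>t \<in> F\<close> by fastforce
      ultimately show ?thesis using U(2)[of s t] st \<open>b \<notin> F\<close> by (auto simp: U'_def)
    qed
    ultimately show ?thesis by blast
  qed
qed

text \<open>By Tychonoff's theorem the finite selections have a common refinement on all of \<open>I\<close>.\<close>

lemma chain_selection:
  fixes V :: "real \<Rightarrow> real \<Rightarrow> complex^'m^'m"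
  assumes one: "\<And>t. t \<in> I \<Longrightarrow> V t t = mat 1"
    and G: "mat 1 \<in> G" "\<And>W. W \<in> G \<Longrightarrow> unitary W" "\<And>s t W. s \<in> I \<Longrightarrow> t \<in> I \<Longrightarrow> W \<in> G \<Longrightarrow> V s t ** W \<in> G"
    and "closed G"
  obtains U where "\<And>t. U t \<in> G"
    "\<And>s t. s \<in> I \<Longrightarrow> t \<in> I \<Longrightarrow> s \<le> t \<Longrightarrow> U t ** ctranspose (U s) \<in> closure {p. chain V s t p}"
proof -
  define X where "X = (PiE UNIV (\<lambda>_. G) :: (real \<Rightarrow> complex^'m^'m) set)"
  define E where "E = (\<lambda>(s, t). {U :: real \<Rightarrow> complex^'m^'m. U t ** ctranspose (U s) \<in> closure {p. chain V s t p}})"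
  define Q where "Q = {(s, t). s \<in> I \<and> t \<in> I \<and> s \<le> t}"
  have "compact ({W. unitary W} \<inter> G)" using compact_unitary \<open>closed G\<close> by (rule compact_Int_closed)
  moreover have "{W. unitary W} \<inter> G = G" using G(2) by auto
  ultimately have "compact G" by simp
  then have "compactin (product_topology (\<lambda>i. euclidean) UNIV) X"
    unfolding X_def compactin_PiE by simp
  then have cX: "compact X" by (simp add: euclidean_product_topology)
  have "X \<inter> \<Inter>(E ` Q) \<noteq> {}"
  proof (rule compact_imp_fip[OF cX])
    fix T assume "T \<in> E ` Q"
    then obtain s t where T: "T = {U. U t ** ctranspose (U s) \<in> closure {p. chain V s t p}}"
      by (auto simp: E_def)
    \<comment> \<open>Each constraint involves only two coordinates of \<open>U\<close>, hence is
      closed in the product topology.\<close>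
    have "continuous_on UNIV (\<lambda>U :: real \<Rightarrow> complex^'m^'m. U t ** ctranspose (U s))"
      by (intro mm.continuous_on bounded_linear.continuous_on[OF bounded_linear_ctranspose]
          continuous_on_product_coordinates)
    then have "closed ((\<lambda>U :: real \<Rightarrow> complex^'m^'m. U t ** ctranspose (U s)) -` closure {p. chain V s t p})"
      by (intro closed_vimage) auto
    then show "closed T" unfolding T vimage_def .
  next
    fix T assume "finite T" "T \<subseteq> E ` Q"
    then obtain Q' where Q': "finite Q'" "Q' \<subseteq> Q" "T = E ` Q'" by (meson finite_subset_image)
    \<comment> \<open>Finitely many constraints mention finitely many times, so the finite selection
      satisfies them all.\<close>
    let ?F = "fst ` Q' \<union> snd ` Q'"
    have "finite ?F" "?F \<subseteq> I" using Q' by (auto simp: Q_def)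
    from chain_selection_finite[of ?F I V G, OF this one G]
    obtain U where U: "\<And>t. U t \<in> G" "\<And>s t. s \<in> ?F \<Longrightarrow> t \<in> ?F \<Longrightarrow> s \<le> t \<Longrightarrow> chain V s t (U t ** ctranspose (U s))"
      by blast
    have "U \<in> E q" if "q \<in> Q'" for q
    proof -
      obtain s t where q: "q = (s, t)" by (cases q)
      then have "s \<in> ?F" "t \<in> ?F" "s \<le> t" using that Q'(2) by (force simp: Q_def)+
      then have "U t ** ctranspose (U s) \<in> {p. chain V s t p}" using U(2) by blast
      then show ?thesis using closure_subset[of "{p. chain V s t p}"] by (auto simp: E_def q)
    qed
    then have "U \<in> X \<inter> \<Inter>T" using U(1) Q'(3) by (auto simp: X_def)
    then show "X \<inter> \<Inter>T \<noteq> {}" by blast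
  qed
  then obtain U where U: "U \<in> X" "\<forall>q\<in>Q. U \<in> E q" by blast
  show thesis
  proof (rule that[of U])
    show "U t \<in> G" for t using U(1) by (auto simp: X_def PiE_iff)
    show "U t ** ctranspose (U s) \<in> closure {p. chain V s t p}" if "s \<in> I" "t \<in> I" "s \<le> t" for s t
      using bspec[OF U(2), of "(s, t)"] that by (simp add: E_def Q_def)
  qed
qed

text \<open>Models \<open>R\<close> on the square root of \<open>H\<close> and \<open>S\<close> on
  its inverse. \<open>S_def\<close> is required at every \<open>t\<close>, so \<open>S\<close> is a
  linear image of the function \<open>R\<close> and inherits its increments and derivatives.\<close>

locale symmetric_frame =
  fixes J :: "complex^'m^'m" and I :: "real set" and R S :: "real \<Rightarrow> complex^'m^'m"
  assumes ctJ: "ctranspose J = J" and JJ: "J ** J = mat 1"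
    and interval: "is_interval I"
    and ac: "loc_abs_continuous_on I R"
    and ctR: "\<And>t. t \<in> I \<Longrightarrow> ctranspose (R t) = R t"
    and RS: "\<And>t. t \<in> I \<Longrightarrow> R t ** S t = mat 1"
    and S_def: "\<And>t. S t = J ** (R t ** J)"
begin

lemma SR: "t \<in> I \<Longrightarrow> S t ** R t = mat 1"
  using RS matrix_left_right_inverse by blast

lemma ctS: "t \<in> I \<Longrightarrow> ctranspose (S t) = S t"
  by (simp add: S_def ct_simps ctJ ctR mm_simps)

text \<open>Moving \<open>J\<close> across a product exchanges \<open>R\<close> and
  \<open>S\<close>; all commutation properties below rest on this.\<close>

lemma J_S: "J ** S t = R t ** J" and S_J: "S t ** J = J ** R t"
  by (simp_all add: S_def mm_simps JJ mm_cancel[OF JJ])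

lemma J_R: "J ** R t = S t ** J" and R_J: "R t ** J = J ** S t"
  by (simp_all add: J_S S_J)

lemma unitary_J: "unitary J"
  by (simp add: unitary_def ctJ JJ)

lemma norm_S: "norm (S t) = norm (R t)"
  by (simp add: S_def unitary_norm_left[OF unitary_J] unitary_norm_right[OF unitary_J])

lemma norm_S_diff: "norm (S t - S s) = norm (R t - R s)"
proof -
  have "S t - S s = J ** ((R t - R s) ** J)" by (simp add: S_def mm_simps)
  then show ?thesis by (simp add: unitary_norm_left[OF unitary_J] unitary_norm_right[OF unitary_J])
qed

text \<open>\<open>2 conn s t\<close> is, to second order, the increment between \<open>s\<close> and \<open>t\<close> of the connection form
  \<open>1/2 (R' S - S R')\<close>. The symmetrisation makes it exactly anti-Hermitian, \<open>J\<close>-commuting and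
  antisymmetric in \<open>s\<close> and \<open>t\<close>.\<close>

definition conn :: "real \<Rightarrow> real \<Rightarrow> complex^'m^'m" where
  "conn s t = (1/8) *\<^sub>R (R t ** S s - S s ** R t + S t ** R s - R s ** S t)"

lemma conn_antihermitian: "s \<in> I \<Longrightarrow> t \<in> I \<Longrightarrow> ctranspose (conn s t) = - conn s t"
  by (simp add: conn_def ct_simps ctR ctS scaleR_right_diff_distrib scaleR_right_distrib)

lemma conn_commute: "J ** conn s t = conn s t ** J"
proof -
  have "J ** (R u ** S w) = (S u ** R w) ** J" "J ** (S u ** R w) = (R u ** S w) ** J" for u w
    by (simp_all add: mm_cancel[OF J_R] mm_cancel[OF J_S] J_R J_S mm_simps)
  then show ?thesis
    by (simp add: conn_def mm.scaleR_left mm.scaleR_right mm.add_left mm.add_right mm.diff_left mm.diff_right)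
qed

lemma conn_swap: "conn t s = - conn s t"
  by (simp add: conn_def scaleR_right_diff_distrib scaleR_right_distrib)

lemma conn_self: "t \<in> I \<Longrightarrow> conn t t = 0"
  by (simp add: conn_def RS SR)

lemma norm_commutators_le:
  fixes A B C D A' B' C' D' :: "complex^'m^'m"
  assumes "norm (A ** B) \<le> c" "norm (A' ** B') \<le> c" "norm (C ** D) \<le> c" "norm (C' ** D') \<le> c"
  shows "norm ((1/8) *\<^sub>R (A ** B - A' ** B' + C ** D - C' ** D')) \<le> c / 2"
proof -
  have "norm (A ** B - A' ** B' + C ** D - C' ** D') \<le> c + c + c + c"
    by (intro norm_triangle_le norm_triangle_le_diff add_mono assms)
  then show ?thesis by simp
qed

text \<open>Since \<open>R s ** S s\<close> and \<open>S s ** R s\<close> are both 1, subtracting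
  them turns every product in \<open>conn s t\<close> into one with an increment as a
  factor.\<close>

lemma norm_conn:
  assumes "s \<in> I" "t \<in> I" "norm (R s) \<le> M" "norm (R t - R s) \<le> x"
  shows "norm (conn s t) \<le> M * x / 2"
proof -
  have "conn s t = (1/8) *\<^sub>R ((R t - R s) ** S s - S s ** (R t - R s) + (S t - S s) ** R s - R s ** (S t - S s))"
    unfolding conn_def using assms(1) by (simp add: mm.diff_left mm.diff_right RS SR)
  also have "norm \<dots> \<le> (M * x) / 2"
  proof (rule norm_commutators_le)
    show "norm ((R t - R s) ** S s) \<le> M * x" "norm ((S t - S s) ** R s) \<le> M * x"
      using assms by (subst mult.commute, intro norm_mm_le, simp_all add: norm_S norm_S_diff)+
    show "norm (S s ** (R t - R s)) \<le> M * x" "norm (R s ** (S t - S s)) \<le> M * x"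
      using assms by (auto intro!: norm_mm_le simp: norm_S norm_S_diff)
  qed
  finally show ?thesis .
qed

text \<open>The failure of additivity consists of products of an increment over
  \<open>[r, s]\<close> with one over \<open>[s, t]\<close>; everything of first order
  cancels.\<close>

lemma norm_conn_additive:
  assumes "s \<in> I" "norm (R s - R r) \<le> x" "norm (R t - R s) \<le> y"
  shows "norm (conn r t - (conn r s + conn s t)) \<le> x * y / 2"
proof -
  have "conn r t - (conn r s + conn s t) = (1/8) *\<^sub>R
    ((R t - R s) ** (S r - S s) - (S r - S s) ** (R t - R s) +
     (S t - S s) ** (R r - R s) - (R r - R s) ** (S t - S s))"
    unfolding conn_def scaleR_right_distrib[symmetric] scaleR_right_diff_distrib[symmetric]
    using assms(1) by (simp add: mm.diff_left mm.diff_right RS SR)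
  also have "norm \<dots> \<le> (x * y) / 2"
  proof (rule norm_commutators_le)
    show "norm ((R t - R s) ** (S r - S s)) \<le> x * y" "norm ((S t - S s) ** (R r - R s)) \<le> x * y"
      using assms by (subst mult.commute, intro norm_mm_le, simp_all add: norm_S_diff norm_minus_commute[of "R r"])+
    show "norm ((S r - S s) ** (R t - R s)) \<le> x * y" "norm ((R r - R s) ** (S t - S s)) \<le> x * y"
      using assms by (auto intro!: norm_mm_le simp: norm_S_diff norm_minus_commute[of "R r"])
  qed
  finally show ?thesis .
qed

definition step :: "real \<Rightarrow> real \<Rightarrow> complex^'m^'m" where
  "step s t = cayley (conn s t)"

lemma step_self: "t \<in> I \<Longrightarrow> step t t = mat 1"
  using cayley_minus_one[of "0 :: complex^'m^'m"] by (simp add: step_def conn_self)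

lemma unitary_step: "s \<in> I \<Longrightarrow> t \<in> I \<Longrightarrow> unitary (step s t)"
  unfolding step_def by (intro unitary_cayley conn_antihermitian)

lemma step_commute: "s \<in> I \<Longrightarrow> t \<in> I \<Longrightarrow> J ** step s t = step s t ** J"
  unfolding step_def by (intro cayley_commute conn_antihermitian conn_commute)

text \<open>The term \<open>2 * M\<^sup>2\<close> comes from composing Cayley transforms, 8 times
  two factors 1/2 from \<open>norm_conn\<close>; the 1 comes from the nonadditivity of
  \<open>conn\<close>. Both errors are bilinear in \<open>x\<close> and \<open>y\<close>.\<close>

lemma step_composition:
  assumes "r \<in> I" "s \<in> I" "t \<in> I" "norm (R r) \<le> M" "norm (R s) \<le> M"
    and "norm (R s - R r) \<le> x" "norm (R t - R s) \<le> y"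
  shows "norm (step s t ** step r s - step r t) \<le> (2 * M\<^sup>2 + 1) * (x * y)"
proof -
  note anti = conn_antihermitian
  have x: "0 \<le> x" and M: "0 \<le> M" using assms norm_ge_zero order_trans by blast+
  have sum: "ctranspose (conn r s + conn s t) = - (conn r s + conn s t)"
    using assms by (simp add: ct_simps anti)
  have "norm (step s t ** step r s - cayley (conn r s + conn s t)) \<le> 8 * norm (conn r s) * norm (conn s t)"
    unfolding step_def using assms by (intro cayley_mult anti)
  also have "\<dots> \<le> 8 * (M * x / 2) * (M * y / 2)"
    using assms x M by (intro mult_mono norm_conn) auto
  finally have 1: "norm (step s t ** step r s - cayley (conn r s + conn s t)) \<le> 2 * M\<^sup>2 * (x * y)"
    by (simp add: power2_eq_square)
  have "norm (cayley (conn r s + conn s t) - step r t) \<le> 2 * norm (conn r t - (conn r s + conn s t))"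
    unfolding step_def using cayley_Lipschitz[OF sum anti] assms by (simp add: norm_minus_commute)
  also have "\<dots> \<le> 2 * (x * y / 2)" using norm_conn_additive[of s r x t y] assms by simp
  finally have "norm (cayley (conn r s + conn s t) - step r t) \<le> x * y" by simp
  from norm_triangle_le[OF add_mono[OF 1 this]] show ?thesis by (simp add: algebra_simps)
qed

lemma local_control:
  assumes "{a..b} \<subseteq> I" "a \<le> b"
  obtains v :: "real \<Rightarrow> real" and M where "mono v" "abs_continuous_on {a..b} v" "0 \<le> M"
    "\<And>s t. a \<le> s \<Longrightarrow> s \<le> t \<Longrightarrow> t \<le> b \<Longrightarrow> norm (R t - R s) \<le> v t - v s"
    "\<And>t. a \<le> t \<Longrightarrow> t \<le> b \<Longrightarrow> norm (R t) \<le> M"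
proof -
  have R: "abs_continuous_on {a..b} R" using ac assms(1) by (simp add: loc_abs_continuous_on_def)
  obtain v :: "real \<Rightarrow> real" where v: "mono v" "abs_continuous_on {a..b} v"
    "\<And>s t. a \<le> s \<Longrightarrow> s \<le> t \<Longrightarrow> t \<le> b \<Longrightarrow> norm (R t - R s) \<le> v t - v s"
    using abs_continuous_on_control[OF R assms(2)] by metis
  have "compact (R ` {a..b})"
    by (intro compact_continuous_image abs_continuous_on_imp_continuous_on R compact_Icc)
  then obtain M where M: "M > 0" "\<And>t. t \<in> {a..b} \<Longrightarrow> norm (R t) \<le> M"
    using compact_imp_bounded bounded_pos by (metis image_eqI)
  show thesis using that[OF v(1,2) less_imp_le[OF M(1)] v(3)] M(2) by auto
qed

text \<open>\<open>U t ** ctranspose (U s)\<close> is the propagator from \<open>s\<close> to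
  \<open>t\<close>. No value is prescribed at any time, so no base point in \<open>I\<close> is
  needed.\<close>

definition transport :: "(real \<Rightarrow> complex^'m^'m) \<Rightarrow> bool" where
  "transport U \<longleftrightarrow> (\<forall>t. unitary (U t) \<and> J ** U t = U t ** J) \<and>
    (\<forall>s\<in>I. \<forall>t\<in>I. s \<le> t \<longrightarrow> U t ** ctranspose (U s) \<in> closure {p. chain step s t p})"

lemma transport_exists: "\<exists>U. transport U"
proof -
  let ?G = "{W. unitary W \<and> J ** W = W ** J}"
  have "continuous_on UNIV (\<lambda>W. J ** W)" "continuous_on UNIV (\<lambda>W. W ** J)"
    by (intro mm.continuous_on continuous_intros)+
  then have "closed {W. J ** W = W ** J}" by (rule closed_Collect_eq)
  then have closed: "closed ?G"
    unfolding Collect_conj_eq using compact_imp_closed[OF compact_unitary] by (intro closed_Int)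
  show ?thesis
  proof (rule chain_selection[of I step ?G, OF step_self _ _ _ closed])
    show "mat 1 \<in> ?G" by (simp add: unitary_def)
    show "step s t ** W \<in> ?G" if "s \<in> I" "t \<in> I" "W \<in> ?G" for s t W
    proof -
      have "J ** (step s t ** W) = step s t ** (J ** W)"
        using step_commute[OF that(1,2)] by (simp add: matrix_mul_assoc)
      also have "J ** W = W ** J" using that(3) by simp
      also have "step s t ** (W ** J) = (step s t ** W) ** J" by (rule matrix_mul_assoc)
      finally show ?thesis using that(3) unitary_mult[OF unitary_step[OF that(1,2)]] by simp
    qed
  next
    fix U assume "\<And>t. U t \<in> ?G"
      "\<And>s t. s \<in> I \<Longrightarrow> t \<in> I \<Longrightarrow> s \<le> t \<Longrightarrow> U t ** ctranspose (U s) \<in> closure {p. chain step s t p}"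
    then have "transport U" unfolding transport_def by blast
    then show "\<exists>U. transport U" by blast
  qed auto
qed

context
  fixes a b :: real and v :: "real \<Rightarrow> real" and M :: real and U :: "real \<Rightarrow> complex^'m^'m"
  assumes sub: "{a..b} \<subseteq> I" and mono: "mono v" and M: "0 \<le> M"
    and v: "\<And>s t. a \<le> s \<Longrightarrow> s \<le> t \<Longrightarrow> t \<le> b \<Longrightarrow> norm (R t - R s) \<le> v t - v s"
    and R: "\<And>t. a \<le> t \<Longrightarrow> t \<le> b \<Longrightarrow> norm (R t) \<le> M"
    and U: "transport U"
begin

text \<open>The chain estimate has the same bound for all partitions, so it defines a closed set
  containing every chain product and hence their closure.\<close>

lemma transport_step:
  assumes "a \<le> s" "s \<le> t" "t \<le> b"
  shows "norm (U t - step s t ** U s) \<le> (2 * M\<^sup>2 + 1) * (v t - v s)\<^sup>2"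
proof -
  have I: "s \<in> I" "t \<in> I" using assms sub by auto
  have "chain step s t p \<Longrightarrow> norm (p - step s t) \<le> (2 * M\<^sup>2 + 1) * (v t - v s)\<^sup>2" for p
    by (rule chain_estimate[of step s t p a b v "2 * M\<^sup>2 + 1"])
      (use assms sub in \<open>auto intro!: mono step_composition v R unitary_step\<close>)
  then have "{p. chain step s t p} \<subseteq> {p. norm (p - step s t) \<le> (2 * M\<^sup>2 + 1) * (v t - v s)\<^sup>2}"
    by auto
  moreover have "closed {p. norm (p - step s t) \<le> (2 * M\<^sup>2 + 1) * (v t - v s)\<^sup>2}"
    by (intro closed_Collect_le continuous_intros)
  ultimately have "closure {p. chain step s t p} \<subseteq> {p. norm (p - step s t) \<le> (2 * M\<^sup>2 + 1) * (v t - v s)\<^sup>2}"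
    by (rule closure_minimal)
  then have "norm (U t ** ctranspose (U s) - step s t) \<le> (2 * M\<^sup>2 + 1) * (v t - v s)\<^sup>2"
    using U I assms(2) by (auto simp: transport_def)
  moreover have "unitary (U s)" using U by (simp add: transport_def)
  moreover from this have "U t - step s t ** U s = (U t ** ctranspose (U s) - step s t) ** U s"
    by (simp add: mm_simps unitary_def)
  ultimately show ?thesis by (simp add: unitary_norm_right)
qed

text \<open>The additional \<open>M\<^sup>2\<close> in the constant pays for replacing the Cayley
  transform by \<open>1 + 2 conn\<close>.\<close>

lemma transport_first_order:
  assumes "a \<le> s" "s \<le> t" "t \<le> b"
  shows "norm (U t - U s - 2 *\<^sub>R (conn s t ** U s)) \<le> (3 * M\<^sup>2 + 1) * (v t - v s)\<^sup>2"
proof -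
  have I: "s \<in> I" "t \<in> I" using assms sub by auto
  have uni: "unitary (U s)" using U by (simp add: transport_def)
  have "norm (conn s t) \<le> M * (v t - v s) / 2" using assms by (intro norm_conn I R v) auto
  then have "2 * (norm (conn s t))\<^sup>2 \<le> 2 * (M * (v t - v s) / 2)\<^sup>2"
    by (intro mult_left_mono power_mono) auto
  also have "\<dots> \<le> M\<^sup>2 * (v t - v s)\<^sup>2" by (simp add: power_mult_distrib power_divide)
  finally have "norm (step s t - mat 1 - 2 *\<^sub>R conn s t) \<le> M\<^sup>2 * (v t - v s)\<^sup>2"
    using cayley_second_order[OF conn_antihermitian[OF I]] by (simp add: step_def)
  then have "norm ((step s t - mat 1 - 2 *\<^sub>R conn s t) ** U s) \<le> M\<^sup>2 * (v t - v s)\<^sup>2"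
    by (simp add: unitary_norm_right[OF uni])
  moreover have "U t - U s - 2 *\<^sub>R (conn s t ** U s) =
      (U t - step s t ** U s) + (step s t - mat 1 - 2 *\<^sub>R conn s t) ** U s"
    by (simp add: mm.diff_left mm.scaleR_left)
  ultimately have "norm (U t - U s - 2 *\<^sub>R (conn s t ** U s)) \<le>
      (2 * M\<^sup>2 + 1) * (v t - v s)\<^sup>2 + M\<^sup>2 * (v t - v s)\<^sup>2"
    using transport_step[OF assms] by (metis norm_triangle_mono)
  then show ?thesis by (simp add: algebra_simps)
qed

text \<open>One factor of the quadratic error is bounded by the total growth
  \<open>v b - v a\<close>, which leaves a bound linear in the increment of \<open>v\<close> and
  thus absolute continuity.\<close>

lemma transport_increment:
  assumes "a \<le> s" "s \<le> t" "t \<le> b"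
  shows "norm (U t - U s) \<le> (M + (3 * M\<^sup>2 + 1) * (v b - v a)) * (v t - v s)"
proof -
  have I: "s \<in> I" "t \<in> I" using assms sub by auto
  have uni: "unitary (U s)" using U by (simp add: transport_def)
  have ord: "v a \<le> v s" "v s \<le> v t" "v t \<le> v b" using assms by (auto intro!: monoD[OF mono])
  have "norm (conn s t) \<le> M * (v t - v s) / 2" using assms by (intro norm_conn I R v) auto
  then have "norm (2 *\<^sub>R (conn s t ** U s)) \<le> M * (v t - v s)"
    by (simp add: unitary_norm_right[OF uni])
  from norm_triangle_mono[OF transport_first_order[OF assms] this]
  have "norm (U t - U s) \<le> (3 * M\<^sup>2 + 1) * (v t - v s)\<^sup>2 + M * (v t - v s)" by simp
  moreover have "(v t - v s)\<^sup>2 \<le> (v b - v a) * (v t - v s)"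
    unfolding power2_eq_square using ord by (intro mult_right_mono) auto
  then have "(3 * M\<^sup>2 + 1) * (v t - v s)\<^sup>2 \<le> (3 * M\<^sup>2 + 1) * ((v b - v a) * (v t - v s))"
    by (intro mult_left_mono) auto
  ultimately have "norm (U t - U s) \<le> (3 * M\<^sup>2 + 1) * ((v b - v a) * (v t - v s)) + M * (v t - v s)"
    by linarith
  then show ?thesis by (simp only: distrib_right mult.assoc add.commute)
qed

text \<open>By antisymmetry of \<open>conn\<close> the first-order estimate also holds when looking backwards.\<close>

lemma transport_first_order_two_sided:
  assumes "s \<in> {a..b}" "t \<in> {a..b}"
  shows "norm (U s - U t - 2 *\<^sub>R (conn t s ** U t)) \<le>
    ((3 * M\<^sup>2 + 1) + M * (M + (3 * M\<^sup>2 + 1) * (v b - v a))) * (v s - v t)\<^sup>2"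
    (is "_ \<le> (?K + M * ?L) * _")
proof -
  have ab: "v a \<le> v b" using assms by (auto intro!: monoD[OF mono])
  have L: "0 \<le> ?L" using M ab by (intro add_nonneg_nonneg mult_nonneg_nonneg) auto
  show ?thesis
  proof (cases "t \<le> s")
    case True
    have "norm (U s - U t - 2 *\<^sub>R (conn t s ** U t)) \<le> ?K * (v s - v t)\<^sup>2"
      using transport_first_order[of t s] True assms by auto
    also have "\<dots> \<le> (?K + M * ?L) * (v s - v t)\<^sup>2"
      using M L by (intro mult_right_mono) auto
    finally show ?thesis .
  next
    case False
    then have st: "a \<le> s" "s \<le> t" "t \<le> b" using assms by auto
    have I: "s \<in> I" "t \<in> I" using assms sub by auto
    have ord: "v s \<le> v t" using st by (auto intro!: monoD[OF mono])
    have "norm (conn s t) \<le> M * (v t - v s) / 2" using st by (intro norm_conn I R v) auto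
    then have "norm (conn s t ** (U t - U s)) \<le> (M * (v t - v s) / 2) * (?L * (v t - v s))"
      by (intro norm_mm_le transport_increment[OF st])
    then have 1: "norm (2 *\<^sub>R (conn s t ** (U t - U s))) \<le> M * ?L * (v t - v s)\<^sup>2"
      by (simp add: power2_eq_square mult_ac)
    \<comment> \<open>The forward estimate is anchored at \<open>s\<close>; moving the anchor to
      \<open>t\<close> costs \<open>conn s t ** (U t - U s)\<close>, again a product of two
      increments.\<close>
    have "U s - U t - 2 *\<^sub>R (conn t s ** U t) =
        2 *\<^sub>R (conn s t ** (U t - U s)) - (U t - U s - 2 *\<^sub>R (conn s t ** U s))"
      by (simp add: conn_swap[of t s] mm_simps scaleR_right_diff_distrib)
    then have "norm (U s - U t - 2 *\<^sub>R (conn t s ** U t)) \<le>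
        norm (2 *\<^sub>R (conn s t ** (U t - U s))) + norm (U t - U s - 2 *\<^sub>R (conn s t ** U s))"
      by (simp only: norm_triangle_ineq4)
    also have "\<dots> \<le> M * ?L * (v t - v s)\<^sup>2 + ?K * (v t - v s)\<^sup>2"
      by (intro add_mono 1 transport_first_order[OF st])
    also have "\<dots> = (?K + M * ?L) * (v s - v t)\<^sup>2"
      by (simp only: distrib_right power2_commute[of "v s"] add.commute)
    finally show ?thesis .
  qed
qed

end

end

subsection \<open>Derivatives of gauges and energies\<close>

text \<open>At a point where \<open>v\<close> is differentiable, \<open>(v s - v t)\<^sup>2\<close>
  is of smaller order than \<open>s - t\<close>.\<close>

lemma has_vector_derivative_zero_quadratic:
  fixes g :: "real \<Rightarrow> 'a::real_normed_vector" and v :: "real \<Rightarrow> real"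
  assumes "v differentiable (at t)" "g t = 0"
    and le: "\<forall>\<^sub>F s in at t. norm (g s) \<le> C * (v s - v t)\<^sup>2"
  shows "(g has_vector_derivative 0) (at t)"
proof -
  obtain v' where v': "(v has_real_derivative v') (at t)"
    using assms(1) by (auto simp: real_differentiable_def)
  let ?h = "\<lambda>s. C * (v s - v t)\<^sup>2"
  have "(?h has_real_derivative 0) (at t)"
    unfolding power2_eq_square by (rule derivative_eq_intros v' refl | simp)+
  then have "((\<lambda>s. (?h s - ?h t) / (s - t)) \<longlongrightarrow> 0) (at t)"
    by (simp add: has_field_derivative_iff)
  then have lim: "((\<lambda>s. \<bar>(?h s - ?h t) / (s - t)\<bar>) \<longlongrightarrow> 0) (at t)"
    by (rule tendsto_rabs_zero)
  have "((\<lambda>s. norm (g s) / norm (s - t)) \<longlongrightarrow> 0) (at t)"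
  proof (rule Lim_null_comparison[OF _ lim])
    show "\<forall>\<^sub>F s in at t. norm (norm (g s) / norm (s - t)) \<le> \<bar>(?h s - ?h t) / (s - t)\<bar>"
      using le
    proof eventually_elim
      case (elim s)
      then have "norm (g s) \<le> \<bar>?h s\<bar>" by linarith
      then show ?case by (simp add: divide_right_mono)
    qed
  qed
  then show ?thesis
    unfolding has_vector_derivative_def has_derivative_iff_norm using assms(2) by simp
qed

lemma abs_continuous_on_const: "abs_continuous_on T (\<lambda>_. c)"
  unfolding abs_continuous_on_def by (auto intro!: exI[of _ 1])

context symmetric_frame
begin

lemma transport_gauge_abs_continuous:
  assumes "transport U"
  shows "loc_abs_continuous_on I (\<lambda>t. S t ** U t)"
  unfolding loc_abs_continuous_on_def
proof (intro allI impI)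
  fix a b assume sub: "{a..b} \<subseteq> I"
  show "abs_continuous_on {a..b} (\<lambda>t. S t ** U t)"
  proof (cases "a \<le> b")
    case True
    obtain v :: "real \<Rightarrow> real" and M where v: "mono v" "abs_continuous_on {a..b} v" "0 \<le> M"
      "\<And>s t. a \<le> s \<Longrightarrow> s \<le> t \<Longrightarrow> t \<le> b \<Longrightarrow> norm (R t - R s) \<le> v t - v s"
      "\<And>t. a \<le> t \<Longrightarrow> t \<le> b \<Longrightarrow> norm (R t) \<le> M"
      by (rule local_control[OF sub True]) blast
    define L where "L = M + (3 * M\<^sup>2 + 1) * (v b - v a)"
    have "v a \<le> v b" using monoD[OF v(1) True] .
    then have L: "0 \<le> L" unfolding L_def using v(3) by (intro add_nonneg_nonneg mult_nonneg_nonneg) auto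
    show ?thesis
    proof (rule abs_continuous_on_dominated[OF v(2), of "1 + M * L"])
      fix s t assume st: "a \<le> s" "s \<le> t" "t \<le> b"
      have d: "0 \<le> v t - v s" using monoD[OF v(1) st(2)] by simp
      have "norm (U t - U s) \<le> L * (v t - v s)"
        unfolding L_def using transport_increment[OF sub v(1,3,4,5) assms st] .
      then have "norm (S s ** (U t - U s)) \<le> M * (L * (v t - v s))"
        using v(5)[of s] st by (intro norm_mm_le) (auto simp: norm_S)
      moreover have "norm ((S t - S s) ** U t) \<le> v t - v s"
        using v(4)[OF st] assms by (simp add: unitary_norm_right transport_def norm_S_diff)
      moreover have "S t ** U t - S s ** U s = (S t - S s) ** U t + S s ** (U t - U s)"
        by (simp add: mm.diff_left mm.diff_right)
      ultimately have "norm (S t ** U t - S s ** U s) \<le> (v t - v s) + M * (L * (v t - v s))"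
        by (metis norm_triangle_mono)
      then show "norm (S t ** U t - S s ** U s) \<le> (1 + M * L) * norm (v t - v s)"
        using d by (simp add: algebra_simps)
    qed (use L v(3) in auto)
  next
    case False
    \<comment> \<open>The interval is empty here, so domination by a constant function holds
      vacuously.\<close>
    then show ?thesis
      by (intro abs_continuous_on_dominated[OF abs_continuous_on_const[of _ "0::real"], of 0]) auto
  qed
qed

lemma transport_has_vector_derivative:
  assumes U: "transport U" and sub: "{a..b} \<subseteq> I" and t: "t \<in> {a<..<b}"
    and v: "mono v" "0 \<le> M" "v differentiable (at t)"
      "\<And>s t. a \<le> s \<Longrightarrow> s \<le> t \<Longrightarrow> t \<le> b \<Longrightarrow> norm (R t - R s) \<le> v t - v s"
      "\<And>t. a \<le> t \<Longrightarrow> t \<le> b \<Longrightarrow> norm (R t) \<le> M"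
    and R': "(R has_vector_derivative R') (at t)" and S': "S' = J ** (R' ** J)"
  shows "(S has_vector_derivative S') (at t)"
    and "(U has_vector_derivative ((1/4) *\<^sub>R (R' ** S t - S t ** R' + S' ** R t - R t ** S')) ** U t) (at t)"
proof -
  note left = bounded_linear.has_vector_derivative[OF mm.bounded_linear_left]
  note right = bounded_linear.has_vector_derivative[OF mm.bounded_linear_right]
  show dS: "(S has_vector_derivative S') (at t)"
    unfolding S_def[abs_def] S' by (intro left right R')
  \<comment> \<open>\<open>F\<close> is linear in \<open>R s\<close> and \<open>S s\<close> and is
    differentiated with them; the remainder \<open>g\<close> is quadratic in \<open>v\<close> and
    contributes nothing.\<close>
  define F where "F s = 2 *\<^sub>R (conn t s ** U t)" for s
  define g where "g s = U s - U t - F s" for s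
  have F: "F s = ((1/4) *\<^sub>R (R s ** S t - S t ** R s + S s ** R t - R t ** S s)) ** U t" for s
    by (simp add: F_def conn_def mm.scaleR_left)
  have dF: "(F has_vector_derivative ((1/4) *\<^sub>R (R' ** S t - S t ** R' + S' ** R t - R t ** S')) ** U t) (at t)"
    unfolding F[abs_def]
    by (intro left bounded_linear.has_vector_derivative[OF bounded_linear_scaleR_right]
        has_vector_derivative_add has_vector_derivative_diff right R' dS)
  have tI: "t \<in> I" using t sub by auto
  have "(g has_vector_derivative 0) (at t)"
  proof (rule has_vector_derivative_zero_quadratic[OF v(3)])
    show "g t = 0" using tI by (simp add: g_def F_def conn_self mm.zero_left)
    have "\<forall>\<^sub>F s in at t. s \<in> {a<..<b}" using t by (intro eventually_at_in_open') auto
    then show "\<forall>\<^sub>F s in at t. norm (g s) \<le>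
      ((3 * M\<^sup>2 + 1) + M * (M + (3 * M\<^sup>2 + 1) * (v b - v a))) * (v s - v t)\<^sup>2"
    proof eventually_elim
      case (elim s)
      then show ?case unfolding g_def F_def
        using t by (intro transport_first_order_two_sided[OF sub v(1,2,4,5) U]) auto
    qed
  qed
  from has_vector_derivative_add[OF has_vector_derivative_add[OF this dF] has_vector_derivative_const[of "U t"]]
  have "((\<lambda>s. g s + F s + U t) has_vector_derivative
      ((1/4) *\<^sub>R (R' ** S t - S t ** R' + S' ** R t - R t ** S')) ** U t) (at t)" by simp
  moreover have "(\<lambda>s. g s + F s + U t) = U" by (auto simp: g_def)
  ultimately show "(U has_vector_derivative
      ((1/4) *\<^sub>R (R' ** S t - S t ** R' + S' ** R t - R t ** S')) ** U t) (at t)" by simp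
qed

end

section \<open>Potentials, logarithmic velocity and the pointwise energy identity\<close>

lemma mat_mult: "mat c ** (A :: complex^'m^'m) = (\<chi> i j. c * A $ i $ j)"
  by (simp add: mat_def matrix_matrix_mult_def vec_eq_iff if_distrib[of "\<lambda>x. x * _"] cong: if_cong)

lemma mult_mat: "(A :: complex^'m^'m) ** mat c = mat c ** A"
  unfolding mat_mult
  by (simp add: mat_def matrix_matrix_mult_def vec_eq_iff if_distrib[of "\<lambda>x. _ * x"] mult.commute cong: if_cong)

lemma unitary_minus_i: "unitary (mat (- \<i>))"
  unfolding unitary_def ctranspose_mat mat_mult by (simp add: mat_def vec_eq_iff)

lemma J_unitary_inverse:
  fixes J :: "complex^'m^'m"
  assumes "ctranspose J = J" "J ** J = mat 1" "J_unitary J T"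
  shows "(J ** (ctranspose T ** J)) ** T = mat 1" "T ** (J ** (ctranspose T ** J)) = mat 1"
    "matrix_inv T = J ** (ctranspose T ** J)" "matrix_inv (ctranspose T) = J ** (T ** J)"
proof -
  show 1: "(J ** (ctranspose T ** J)) ** T = mat 1"
    using assms(2,3) unfolding J_unitary_def by (simp add: mm_simps)
  then show 2: "T ** (J ** (ctranspose T ** J)) = mat 1" using matrix_left_right_inverse by blast
  then show "matrix_inv T = J ** (ctranspose T ** J)" by (rule matrix_inv_eq)
  have "ctranspose T ** (J ** (T ** J)) = mat 1"
    using arg_cong[OF 1, of ctranspose] assms(1) by (simp add: ct_simps mm_simps)
  then show "matrix_inv (ctranspose T) = J ** (T ** J)" by (rule matrix_inv_eq)
qed

lemma gauge_representation:
  fixes J :: "complex^'m^'m"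
  assumes "ctranspose J = J" "J ** J = mat 1" "J_unitary J T"
  shows "matrix_inv (ctranspose T) ** matrix_inv T = J ** (T ** (ctranspose T ** J))"
  by (simp add: J_unitary_inverse[OF assms] mm_simps mm_cancel[OF assms(2)])

text \<open>Differentiate the constant function \<open>ctranspose (T s) ** J ** T s\<close>. The two
  terms of the product rule are adjoint to each other because \<open>J\<close> is Hermitian.\<close>

lemma J_unitary_derivative:
  fixes J :: "complex^'m^'m"
  assumes "ctranspose J = J" "t \<in> interior I" "\<And>s. s \<in> I \<Longrightarrow> J_unitary J (T s)"
    and T': "(T has_vector_derivative D) (at t)"
  shows "ctranspose (ctranspose (T t) ** (J ** D)) = - (ctranspose (T t) ** (J ** D))"
proof -
  have ct: "((\<lambda>s. ctranspose (T s)) has_vector_derivative ctranspose D) (at t)"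
    by (rule bounded_linear.has_vector_derivative[OF bounded_linear_ctranspose T'])
  have d: "((\<lambda>s. ctranspose (T s) ** (J ** T s)) has_vector_derivative
      (ctranspose (T t) ** (J ** D) + ctranspose D ** (J ** T t))) (at t)"
    by (rule mm.has_vector_derivative[OF ct bounded_linear.has_vector_derivative[OF mm.bounded_linear_right T']])
  have c: "ctranspose (T s) ** (J ** T s) = J" if "s \<in> interior I" for s
    using assms(3)[of s] that interior_subset unfolding J_unitary_def by (auto simp: matrix_mul_assoc)
  have "((\<lambda>s. J) has_vector_derivative
      (ctranspose (T t) ** (J ** D) + ctranspose D ** (J ** T t))) (at t)"
    by (rule has_vector_derivative_transform_within_open[OF d open_interior assms(2) c])
  then have "ctranspose (T t) ** (J ** D) + ctranspose D ** (J ** T t) = 0"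
    using vector_derivative_unique_at has_vector_derivative_const by blast
  then show ?thesis using assms(1) by (simp add: ct_simps mm_simps eq_neg_iff_add_eq_0 add.commute)
qed

lemma vector_derivative_within_interior:
  assumes "t \<in> interior I" "(f has_vector_derivative D) (at t)"
  shows "vector_derivative f (at t within I) = D"
  unfolding at_within_interior[OF assms(1)] by (rule vector_derivative_at[OF assms(2)])

lemma potential_eq:
  assumes "t \<in> interior I" "(T has_vector_derivative D) (at t)"
  shows "potential J I T t = mat (- \<i>) ** (ctranspose (T t) ** (J ** D))"
  by (simp only: potential_def vector_derivative_within_interior[OF assms] matrix_mul_assoc)

lemma norm_potential:
  assumes "t \<in> interior I" "(T has_vector_derivative D) (at t)"
  shows "norm (potential J I T t) = norm (ctranspose (T t) ** (J ** D))"
  by (simp add: potential_eq[OF assms] unitary_norm_left[OF unitary_minus_i])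

lemma parallel_part_potential_eq_0_iff:
  fixes J :: "complex^'m^'m"
  assumes "t \<in> interior I" "(T has_vector_derivative D) (at t)"
  defines "G \<equiv> ctranspose (T t) ** (J ** D)"
  shows "parallel_part J (potential J I T t) = 0 \<longleftrightarrow> G + J ** (G ** J) = 0"
proof -
  have "J ** (mat (- \<i>) ** G) ** J = mat (- \<i>) ** (J ** (G ** J))"
    by (simp only: matrix_mul_assoc mult_mat[of J])
  then have "parallel_part J (potential J I T t) = (1/2) *\<^sub>R (mat (- \<i>) ** (G + J ** (G ** J)))"
    by (simp only: parallel_part_def potential_eq[OF assms(1,2)] G_def mm.add_right)
  then have "norm (parallel_part J (potential J I T t)) = norm (G + J ** (G ** J)) / 2"
    by (simp add: unitary_norm_left[OF unitary_minus_i])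
  then show ?thesis by (metis divide_eq_0_iff norm_eq_zero zero_neq_numeral)
qed

text \<open>With \<open>G = \<Theta>\<^sup>* J \<Theta>'\<close> the logarithmic velocity of \<open>H\<close> is similar to \<open>(J G J - G) J\<close>, so its
  energy only sees the part of \<open>G\<close> that anticommutes with \<open>J\<close>.\<close>

lemma trace_log_velocity:
  fixes J :: "complex^'m^'m"
  assumes J: "ctranspose J = J" "J ** J = mat 1" and t: "t \<in> interior I"
    and T: "\<And>s. s \<in> I \<Longrightarrow> J_unitary J (T s)"
    and T': "(T has_vector_derivative D) (at t)"
    and H: "\<And>s. s \<in> I \<Longrightarrow> H s = J ** (T s ** (ctranspose (T s) ** J))"
    and S: "matrix_inv (msqrt (H t)) = P" "P ** P = T t ** ctranspose (T t)"
  defines "G \<equiv> ctranspose (T t) ** (J ** D)"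
  shows "Re (trace (log_velocity I H t ** log_velocity I H t)) = (norm (J ** (G ** J) - G))\<^sup>2"
proof -
  let ?C = "ctranspose (T t)"
  have tI: "t \<in> I" using t interior_subset by blast
  note cancel = J(2) mm_cancel[OF J(2)]
  have cG: "ctranspose G = - G" unfolding G_def by (rule J_unitary_derivative[OF J(1) t T T'])
  have CJT: "?C ** (J ** T t) = J" using T[OF tI] by (simp add: J_unitary_def matrix_mul_assoc)
  \<comment> \<open>Solves the definition of \<open>G\<close> for the derivative \<open>D\<close>,
    using that \<open>J ** (ctranspose (T t) ** J)\<close> inverts \<open>T t\<close>.\<close>
  have "T t ** (J ** G) = (T t ** (J ** (?C ** J))) ** D" by (simp add: G_def mm_simps)
  then have D: "D = T t ** (J ** G)" using J_unitary_inverse(2)[OF J T[OF tI]] by simp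
  have cD: "ctranspose D = - (G ** (J ** ?C))"
    by (subst D) (simp add: ct_simps J(1) cG mm_simps)
  have ct: "((\<lambda>s. ctranspose (T s)) has_vector_derivative ctranspose D) (at t)"
    by (rule bounded_linear.has_vector_derivative[OF bounded_linear_ctranspose T'])
  define H' where "H' = J ** (T t ** (ctranspose D ** J) + D ** (?C ** J))"
  have d: "((\<lambda>s. J ** (T s ** (ctranspose (T s) ** J))) has_vector_derivative H') (at t)"
    unfolding H'_def
    by (intro bounded_linear.has_vector_derivative[OF mm.bounded_linear_right] mm.has_vector_derivative T'
        bounded_linear.has_vector_derivative[OF mm.bounded_linear_left] ct)
  have c: "J ** (T s ** (ctranspose (T s) ** J)) = H s" if "s \<in> interior I" for s
    using H that interior_subset by (metis subsetD)
  have "(H has_vector_derivative H') (at t)"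
    by (rule has_vector_derivative_transform_within_open[OF d open_interior t c])
  then have N: "log_velocity I H t = P ** (H' ** P)"
    by (simp only: log_velocity_def S(1) vector_derivative_within_interior[OF t] matrix_mul_assoc)
  define E where "E = J ** (G ** J) - G"
  have "H' ** (T t ** ?C) = J ** (T t ** ((J ** G - G ** J) ** (?C ** (J ** (T t ** ?C)))))"
    unfolding H'_def cD by (subst D) (simp add: mm_simps)
  also have "?C ** (J ** (T t ** ?C)) = J ** ?C" using CJT by (simp add: matrix_mul_assoc)
  also have "(J ** G - G ** J) ** (J ** ?C) = E ** ?C"
    by (simp add: E_def mm_simps cancel)
  finally have HK: "H' ** (T t ** ?C) = J ** (T t ** (E ** ?C))" .
  have JEJ: "J ** (E ** J) = - E" by (simp add: E_def mm_simps cancel)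
  have cE: "ctranspose E = - E" using cG by (simp add: E_def ct_simps J(1) mm_simps)
  \<comment> \<open>Cyclicity of the trace joins the outer factors \<open>P\<close> to
    \<open>P ** P\<close>, so the root itself disappears and only the gauge remains.\<close>
  have "trace (log_velocity I H t ** log_velocity I H t) = trace (P ** (H' ** ((P ** P) ** (H' ** P))))"
    unfolding N by (simp add: mm_simps)
  also have "\<dots> = trace ((H' ** ((P ** P) ** (H' ** P))) ** P)" by (rule trace_mul_sym)
  also have "(H' ** ((P ** P) ** (H' ** P))) ** P = (H' ** (P ** P)) ** (H' ** (P ** P))"
    by (simp add: mm_simps)
  also have "\<dots> = (J ** (T t ** (E ** ?C))) ** (J ** (T t ** (E ** ?C)))"
    by (simp only: S(2) HK)
  also have "\<dots> = (J ** T t) ** (E ** ((?C ** (J ** T t)) ** (E ** ?C)))"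
    by (simp add: mm_simps)
  also have "trace \<dots> = trace ((E ** ((?C ** (J ** T t)) ** (E ** ?C))) ** (J ** T t))" by (rule trace_mul_sym)
  also have "(E ** ((?C ** (J ** T t)) ** (E ** ?C))) ** (J ** T t) = E ** (J ** (E ** (?C ** (J ** T t))))"
    by (simp only: CJT matrix_mul_assoc[symmetric])
  \<comment> \<open>\<open>E\<close> anticommutes with \<open>J\<close> and is anti-Hermitian, so
    \<open>E J E J\<close> equals \<open>- E E\<close>, the Gram matrix of \<open>E\<close>.\<close>
  also have "\<dots> = ctranspose E ** E" by (simp add: CJT JEJ cE mm_simps)
  finally show ?thesis by (simp add: E_def[symmetric] inner_matrix power2_norm_eq_inner)
qed

lemma parallelogram_J:
  fixes G J :: "complex^'m^'m"
  assumes "unitary J"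
  shows "(norm G)\<^sup>2 = (norm (J ** (G ** J) - G))\<^sup>2 / 4 + (norm (G + J ** (G ** J)))\<^sup>2 / 4"
proof -
  let ?K = "J ** (G ** J)"
  have "norm ?K = norm G" by (simp add: unitary_norm_left[OF assms] unitary_norm_right[OF assms])
  then have "?K \<bullet> ?K = G \<bullet> G" by (metis power2_norm_eq_inner)
  then show ?thesis
    by (simp add: power2_norm_eq_inner inner_add_left inner_add_right inner_diff_left inner_diff_right
        inner_commute field_simps)
qed

section \<open>Passage to almost everywhere statements and integrals\<close>

lemma AE_interior:
  assumes "is_interval I"
    and ae: "\<And>a b. {a..b} \<subseteq> I \<Longrightarrow> a < b \<Longrightarrow> negligible {x \<in> {a<..<b}. \<not> P x}"
  shows "AE x\<in>I in lebesgue. x \<in> interior I \<and> P (x::real)"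
proof -
  \<comment> \<open>Rational end points make the exceptional set a countable union; the frontier
    accounts for the points of \<open>I\<close> that are not interior.\<close>
  define Q where "Q = {(a, b). a \<in> \<rat> \<and> b \<in> \<rat> \<and> a < b \<and> {a..b} \<subseteq> I}"
  define N where "N = frontier I \<union> (\<Union>(a, b)\<in>Q. {x \<in> {a<..<b}. \<not> P x})"
  have "countable Q" by (rule countable_subset[of _ "\<rat> \<times> \<rat>"]) (auto simp: Q_def countable_rat)
  moreover have "negligible (case q of (a, b) \<Rightarrow> {x \<in> {a<..<b}. \<not> P x})" if "q \<in> Q" for q
    using that ae by (cases q) (simp add: Q_def del: greaterThanLessThan_iff)
  ultimately have "negligible (\<Union>((\<lambda>(a, b). {x \<in> {a<..<b}. \<not> P x}) ` Q))"
    by (intro negligible_countable_Union countable_image) (blast, force simp del: greaterThanLessThan_iff)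
  moreover have "negligible (frontier I)"
    using assms(1) by (intro negligible_convex_frontier is_interval_convex)
  ultimately have "N \<in> null_sets lebesgue"
    unfolding N_def negligible_iff_null_sets[symmetric] by (intro negligible_Un)
  moreover have "{x \<in> space lebesgue. \<not> (x \<in> I \<longrightarrow> x \<in> interior I \<and> P x)} \<subseteq> N"
  proof (rule subsetI, rule ccontr)
    fix x assume "x \<in> {x \<in> space lebesgue. \<not> (x \<in> I \<longrightarrow> x \<in> interior I \<and> P x)}" and nN: "x \<notin> N"
    then have "x \<in> I" and nP: "\<not> (x \<in> interior I \<and> P x)" by auto
    then have "x \<in> interior I"
      using nN closure_subset[of I] by (auto simp: N_def frontier_def)
    then obtain e where e: "e > 0" "ball x e \<subseteq> I" by (meson mem_interior)
    obtain a where a: "a \<in> \<rat>" "x - e < a" "a < x" using Rats_dense_in_real[of "x - e" x] e by auto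
    obtain b where b: "b \<in> \<rat>" "x < b" "b < x + e" using Rats_dense_in_real[of x "x + e"] e by auto
    have "{a..b} \<subseteq> ball x e" using a b by (auto simp: dist_real_def)
    then have "(a, b) \<in> Q" using a b e by (auto simp: Q_def)
    then have "P x" using nN a b by (auto simp: N_def)
    then show False using \<open>x \<in> interior I\<close> nP by simp
  qed
  ultimately show ?thesis by (rule AE_I')
qed

lemma loc_abs_continuous_on_AE_differentiable:
  fixes f :: "real \<Rightarrow> 'a::euclidean_space"
  assumes "is_interval I" "loc_abs_continuous_on I f"
  shows "AE t\<in>I in lebesgue. t \<in> interior I \<and> f differentiable (at t)"
  using assms
  by (intro AE_interior abs_continuous_on_ae_differentiable) (auto simp: loc_abs_continuous_on_def)

text \<open>The integral is a supremum over simple functions below the integrand, and scaling such a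
  function by \<open>c\<close> keeps it below \<open>c * f\<close>; this uses no measurability of
  \<open>f\<close>.\<close>

lemma nn_integral_cmult_le:
  fixes c :: ennreal
  shows "c * integral\<^sup>N M f \<le> (\<integral>\<^sup>+x. c * f x \<partial>M)"
proof -
  have "c * integral\<^sup>N M f = (SUP g\<in>{g. simple_function M g \<and> g \<le> f}. c * integral\<^sup>S M g)"
    unfolding nn_integral_def by (subst SUP_mult_left_ennreal) auto
  also have "\<dots> \<le> (\<integral>\<^sup>+x. c * f x \<partial>M)"
  proof (rule SUP_least)
    fix g assume "g \<in> {g. simple_function M g \<and> g \<le> f}"
    then have g: "simple_function M g" "g \<le> f" by auto
    have "c * integral\<^sup>S M g = (\<integral>\<^sup>+x. c * g x \<partial>M)"
      using g(1) by (simp add: nn_integral_eq_simple_integral[symmetric] nn_integral_cmult borel_measurable_simple_function)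
    also have "\<dots> \<le> (\<integral>\<^sup>+x. c * f x \<partial>M)"
      using g(2) by (intro nn_integral_mono mult_left_mono) (auto simp: le_fun_def)
    finally show "c * integral\<^sup>S M g \<le> (\<integral>\<^sup>+x. c * f x \<partial>M)" .
  qed
  finally show ?thesis .
qed

text \<open>The integrands of the energies are not known to be measurable, so \<open>nn_integral_cmult\<close> does not
  apply to them.\<close>

lemma nn_integral_cmult_pos:
  assumes "0 < c"
  shows "(\<integral>\<^sup>+x. ennreal c * f x \<partial>M) = ennreal c * integral\<^sup>N M f"
proof (rule antisym)
  have inv: "ennreal c * (ennreal (1 / c) * y) = y" "ennreal (1 / c) * (ennreal c * y) = y" for y
    using assms by (simp_all add: mult.assoc[symmetric] ennreal_mult[symmetric])
  have "ennreal (1 / c) * (\<integral>\<^sup>+x. ennreal c * f x \<partial>M) \<le> integral\<^sup>N M f"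
    using nn_integral_cmult_le[of "ennreal (1 / c)" M "\<lambda>x. ennreal c * f x"] by (simp add: inv)
  then have "ennreal c * (ennreal (1 / c) * (\<integral>\<^sup>+x. ennreal c * f x \<partial>M)) \<le> ennreal c * integral\<^sup>N M f"
    by (rule mult_left_mono) simp
  then show "(\<integral>\<^sup>+x. ennreal c * f x \<partial>M) \<le> ennreal c * integral\<^sup>N M f" by (simp only: inv)
qed (rule nn_integral_cmult_le)

lemma pos_def_imp_pos_semidef: "pos_def A \<Longrightarrow> pos_semidef A"
  unfolding pos_def_def pos_semidef_def by (metis cip_zero(2) order_less_imp_le order_refl qform_cip zero_complex.sel(1))

text \<open>\<open>K = J A J\<close> is the inverse of \<open>A\<close>. Both the inverse of the
  root and its conjugate by \<open>J\<close> are positive semidefinite roots of \<open>K\<close>, so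
  they coincide.\<close>

lemma msqrt_symplectic:
  fixes A J :: "complex^'m^'m"
  assumes A: "pos_semidef A" "A ** J ** A = J" and J: "ctranspose J = J" "J ** J = mat 1"
  shows "msqrt A ** (J ** (msqrt A ** J)) = mat 1"
proof -
  define R K where "R = msqrt A" and "K = J ** (A ** J)"
  have R: "pos_semidef R" "R ** R = A" unfolding R_def by (rule msqrt_pos_semidef[OF A(1)])+
  note cR = pos_semidefD(1)[OF R(1)]
  have AK: "A ** K = mat 1" using A(2) J(2) by (simp add: K_def matrix_mul_assoc)
  define P where "P = R ** K"
  have RP: "R ** P = mat 1" using AK R(2) by (simp add: P_def matrix_mul_assoc)
  then have PR: "P ** R = mat 1" using matrix_left_right_inverse by blast
  have cP: "ctranspose P = P"
  proof -
    have "ctranspose P ** R = mat 1" using arg_cong[OF RP, of ctranspose] cR by (simp add: ct_simps)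
    then have "ctranspose P ** (R ** P) = P" by (simp add: matrix_mul_assoc)
    then show ?thesis by (simp add: RP)
  qed
  have "pos_semidef P"
  proof (rule pos_semidefI[OF cP])
    fix x
    have "cip x (P *v x) = cip (P *v x) (R *v (P *v x))"
      using cip_adjoint[of x P "R *v (P *v x)"] cP RP PR
      by (simp add: matrix_vector_mul_assoc matrix_mul_assoc)
    then show "0 \<le> Re (cip x (P *v x))" using pos_semidefD(2)[OF R(1), of "P *v x"] by simp
  qed
  moreover have "pos_semidef (J ** (R ** J))"
  proof (rule pos_semidefI)
    show "ctranspose (J ** (R ** J)) = J ** (R ** J)" by (simp add: ct_simps J(1) cR mm_simps)
    fix x
    have "cip x ((J ** (R ** J)) *v x) = cip (J *v x) (R *v (J *v x))"
      using cip_adjoint[of x J "R *v (J *v x)"] J(1) by (simp add: matrix_vector_mul_assoc)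
    then show "0 \<le> Re (cip x ((J ** (R ** J)) *v x))" using pos_semidefD(2)[OF R(1), of "J *v x"] by simp
  qed
  moreover have "P ** P = (J ** (R ** J)) ** (J ** (R ** J))"
  proof -
    have "P ** P = P ** (P ** (A ** K))" using AK by simp
    also have "\<dots> = (P ** (P ** R ** R)) ** K" by (simp add: R(2)[symmetric] mm_simps)
    also have "\<dots> = K" by (simp add: PR)
    also have "K = (J ** (R ** J)) ** (J ** (R ** J))"
      by (simp add: K_def R(2)[symmetric] mm_simps mm_cancel[OF J(2)])
    finally show ?thesis .
  qed
  ultimately have "P = J ** (R ** J)" by (rule pos_semidef_sqrt_unique)
  then show ?thesis using RP by (simp add: R_def)
qed

lemma norm_sqrt_power2_le:
  assumes "pos_semidef R"
  shows "(norm R)\<^sup>2 \<le> norm (mat 1 :: complex^'m^'m) * norm (R ** (R :: complex^'m^'m))"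
proof -
  have "(norm R)\<^sup>2 = mat 1 \<bullet> (R ** R)"
    using pos_semidefD(1)[OF assms] by (simp add: power2_norm_eq_inner inner_matrix)
  then show ?thesis using Cauchy_Schwarz_ineq2[of "mat 1" "R ** R"] by simp
qed

text \<open>The Lipschitz constant of the root involves the trace of its inverse. That inverse is a
  \<open>J\<close>-conjugate of the root and has the same norm, so an upper bound for
  \<open>H\<close> on a compact interval controls it.\<close>

lemma loc_abs_continuous_on_msqrt:
  fixes J :: "complex^'m^'m"
  assumes J: "ctranspose J = J" "J ** J = mat 1"
    and ac: "loc_abs_continuous_on I H"
    and psd: "\<And>t. t \<in> I \<Longrightarrow> pos_semidef (H t)"
    and HJH: "\<And>t. t \<in> I \<Longrightarrow> H t ** J ** H t = J"
  shows "loc_abs_continuous_on I (\<lambda>t. msqrt (H t))"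
  unfolding loc_abs_continuous_on_def
proof (intro allI impI)
  fix a b assume sub: "{a..b} \<subseteq> I"
  let ?R = "\<lambda>t. msqrt (H t)" and ?one = "mat 1 :: complex^'m^'m"
  have H: "abs_continuous_on {a..b} H" using ac sub by (simp add: loc_abs_continuous_on_def)
  have "compact (H ` {a..b})"
    by (intro compact_continuous_image abs_continuous_on_imp_continuous_on H compact_Icc)
  then obtain M where M: "M > 0" "\<And>t. t \<in> {a..b} \<Longrightarrow> norm (H t) \<le> M"
    using compact_imp_bounded bounded_pos by (metis image_eqI)
  have uJ: "unitary J" by (simp add: unitary_def J)
  have R: "norm (?R t) \<le> sqrt (norm ?one * M)" if "t \<in> {a..b}" for t
  proof (rule real_le_rsqrt)
    have "(norm (?R t))\<^sup>2 \<le> norm ?one * norm (H t)"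
      using norm_sqrt_power2_le[OF msqrt_pos_semidef(1)] msqrt_pos_semidef(2) psd that sub by (metis subsetD)
    also have "\<dots> \<le> norm ?one * M" using M(2)[OF that] by (intro mult_left_mono) auto
    finally show "(norm (?R t))\<^sup>2 \<le> norm ?one * M" .
  qed
  let ?C = "norm ?one * sqrt (norm ?one * M)"
  show "abs_continuous_on {a..b} ?R"
  proof (rule abs_continuous_on_dominated[OF H, of ?C])
    show "0 \<le> ?C" using M(1) by simp
    fix s t assume st: "a \<le> s" "s \<le> t" "t \<le> b"
    then have I: "s \<in> I" "t \<in> I" "t \<in> {a..b}" using sub by auto
    note psd_R = msqrt_pos_semidef[OF psd[OF I(2)]] and psd_R' = msqrt_pos_semidef[OF psd[OF I(1)]]
    let ?S = "J ** (?R t ** J)"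
    have RS: "?R t ** ?S = mat 1" by (rule msqrt_symplectic[OF psd[OF I(2)] HJH[OF I(2)] J])
    then have SR: "?S ** ?R t = mat 1" using matrix_left_right_inverse by blast
    have cS: "ctranspose ?S = ?S" using pos_semidefD(1)[OF psd_R(1)] by (simp add: ct_simps J(1) mm_simps)
    have "Re (trace ?S) = ?one \<bullet> ?S" by (simp add: inner_matrix)
    also have "\<dots> \<le> norm ?one * norm ?S" using Cauchy_Schwarz_ineq2[of ?one ?S] by simp
    also have "norm ?S = norm (?R t)" by (simp add: unitary_norm_left[OF uJ] unitary_norm_right[OF uJ])
    also have "norm ?one * norm (?R t) \<le> ?C" using R[OF I(3)] by (intro mult_left_mono) auto
    finally have tr: "Re (trace ?S) \<le> ?C" .
    have "norm (?R t - ?R s) \<le> Re (trace ?S) * norm (H t - H s)"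
      using sqrt_Lipschitz[OF psd_R(1) SR cS psd_R'(1)] by (simp add: psd_R(2) psd_R'(2))
    also have "\<dots> \<le> ?C * norm (H t - H s)" using tr by (intro mult_right_mono) auto
    finally show "norm (?R t - ?R s) \<le> ?C * norm (H t - H s)" .
  qed
qed

context symmetric_frame
begin

lemma transport_J_unitary:
  assumes "transport U" "t \<in> I"
  shows "J_unitary J (S t ** U t)"
proof -
  have u: "ctranspose (U t) ** U t = mat 1" "J ** U t = U t ** J"
    using assms by (auto simp: transport_def unitary_def)
  have "ctranspose (S t ** U t) ** J ** (S t ** U t) = ctranspose (U t) ** ((S t ** J) ** (S t ** U t))"
    by (simp add: ct_simps ctS[OF assms(2)] mm_simps)
  also have "\<dots> = ctranspose (U t) ** (J ** ((R t ** S t) ** U t))" by (simp add: S_J mm_simps)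
  also have "\<dots> = (ctranspose (U t) ** U t) ** J" by (simp add: RS[OF assms(2)] u(2) mm_simps)
  finally show ?thesis by (simp add: J_unitary_def u(1))
qed

text \<open>The unitary factor cancels in \<open>\<Theta>\<close> times its adjoint; it is exactly
  the freedom left by prescribing \<open>H\<close>.\<close>

lemma transport_represents:
  assumes "transport U" "t \<in> I"
  shows "J ** ((S t ** U t) ** (ctranspose (S t ** U t) ** J)) = R t ** R t"
proof -
  have u: "U t ** ctranspose (U t) = mat 1" using assms by (auto simp: transport_def unitary_right)
  have "J ** ((S t ** U t) ** (ctranspose (S t ** U t) ** J)) =
      (J ** S t) ** ((U t ** ctranspose (U t)) ** (S t ** J))"
    by (simp add: ct_simps ctS[OF assms(2)] mm_simps)
  also have "\<dots> = R t ** R t" by (simp add: u J_S S_J mm_simps mm_cancel[OF JJ])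
  finally show ?thesis .
qed

lemma derivative_inverse:
  assumes t: "t \<in> interior I" and R': "(R has_vector_derivative R') (at t)"
    and S': "(S has_vector_derivative S') (at t)"
  shows "R' ** S t = - (R t ** S')" "S' ** R t = - (S t ** R')"
proof -
  have "((\<lambda>s. R s ** S s) has_vector_derivative (R t ** S' + R' ** S t)) (at t)"
    "((\<lambda>s. S s ** R s) has_vector_derivative (S t ** R' + S' ** R t)) (at t)"
    by (rule mm.has_vector_derivative[OF R' S'], rule mm.has_vector_derivative[OF S' R'])
  note d = has_vector_derivative_transform_within_open[OF this(1) open_interior t, of "\<lambda>_. mat 1"]
    has_vector_derivative_transform_within_open[OF this(2) open_interior t, of "\<lambda>_. mat 1"]
  have "R t ** S' + R' ** S t = 0"
    by (rule vector_derivative_unique_at[OF d(1) has_vector_derivative_const])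
      (use RS interior_subset in blast)
  moreover have "S t ** R' + S' ** R t = 0"
    by (rule vector_derivative_unique_at[OF d(2) has_vector_derivative_const])
      (use SR interior_subset in blast)
  ultimately show "R' ** S t = - (R t ** S')" "S' ** R t = - (S t ** R')"
    by (simp_all add: eq_neg_iff_add_eq_0 add.commute)
qed

lemma transport_parallel:
  assumes U: "transport U"
  shows "AE t\<in>I in lebesgue. t \<in> interior I \<and> parallel_part J (potential J I (\<lambda>t. S t ** U t) t) = 0"
proof (rule AE_interior[OF interval])
  fix a b assume sub: "{a..b} \<subseteq> I" and "a < b"
  obtain v :: "real \<Rightarrow> real" and M where v: "mono v" "abs_continuous_on {a..b} v" "0 \<le> M"
    "\<And>s t. a \<le> s \<Longrightarrow> s \<le> t \<Longrightarrow> t \<le> b \<Longrightarrow> norm (R t - R s) \<le> v t - v s"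
    "\<And>t. a \<le> t \<Longrightarrow> t \<le> b \<Longrightarrow> norm (R t) \<le> M"
    by (rule local_control[OF sub less_imp_le[OF \<open>a < b\<close>]]) blast
  \<comment> \<open>Besides \<open>R\<close>, the control \<open>v\<close> must be differentiable,
    since the error of the transport is measured in \<open>v\<close>.\<close>
  let ?bad = "{t \<in> {a<..<b}. \<not> v differentiable (at t)} \<union> {t \<in> {a<..<b}. \<not> R differentiable (at t)}"
  have neg: "negligible ?bad"
    using ac sub v(2)
    by (intro negligible_Un abs_continuous_on_ae_differentiable) (auto simp: loc_abs_continuous_on_def)
  have "{t \<in> {a<..<b}. \<not> parallel_part J (potential J I (\<lambda>t. S t ** U t) t) = 0} \<subseteq> ?bad"
  proof (rule subsetI, rule ccontr)
    fix t assume t0: "t \<in> {t \<in> {a<..<b}. \<not> parallel_part J (potential J I (\<lambda>t. S t ** U t) t) = 0}"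
      and "t \<notin> ?bad"
    then have t: "t \<in> {a<..<b}" and dv: "v differentiable (at t)" and dR: "R differentiable (at t)" by auto
    have "t \<in> interior {a..b}" using t by auto
    then have tI: "t \<in> interior I" using interior_mono[OF sub] by blast
    obtain R' where R': "(R has_vector_derivative R') (at t)"
      using dR by (auto simp: differentiable_iff_scaleR has_vector_derivative_def)
    define S' where "S' = J ** (R' ** J)"
    define A where "A = (1/4) *\<^sub>R (R' ** S t - S t ** R' + S' ** R t - R t ** S')"
    note der = transport_has_vector_derivative[OF U sub t v(1,3) dv v(4,5) R' S'_def]
    have dS: "(S has_vector_derivative S') (at t)" using der(1) by blast
    have dU: "(U has_vector_derivative A ** U t) (at t)" unfolding A_def using der(2) by blast
    let ?D = "S t ** (A ** U t) + S' ** U t" and ?c = "ctranspose (U t)"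
    have dT: "((\<lambda>t. S t ** U t) has_vector_derivative ?D) (at t)"
      by (rule mm.has_vector_derivative[OF dS dU])
    \<comment> \<open>Conjugation by \<open>U t\<close>, which commutes with \<open>J\<close>, is
      stripped off: the parallel part vanishes once \<open>W\<close> anticommutes with
      \<open>J\<close>.\<close>
    define W where "W = A + R t ** S'"
    have tt: "t \<in> I" using tI interior_subset by blast
    have cJ: "J ** U t = U t ** J" using U by (simp add: transport_def)
    have cJ': "?c ** J = J ** ?c" using arg_cong[OF cJ, of ctranspose] by (simp add: ct_simps ctJ)
    have "ctranspose (S t ** U t) ** (J ** ?D) = ?c ** ((S t ** J) ** ?D)"
      by (simp only: ctranspose_mult ctS[OF tt] matrix_mul_assoc)
    also have "\<dots> = ?c ** (J ** ((R t ** S t) ** (A ** U t) + R t ** (S' ** U t)))"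
      by (simp add: S_J mm_simps)
    also have "\<dots> = ?c ** (J ** (W ** U t))" by (simp add: RS[OF tt] W_def mm_simps)
    finally have G: "ctranspose (S t ** U t) ** (J ** ?D) = ?c ** (J ** (W ** U t))" .
    have "J ** ((?c ** (J ** (W ** U t))) ** J) = (J ** ?c) ** (J ** (W ** (U t ** J)))"
      by (simp only: matrix_mul_assoc)
    also have "\<dots> = ?c ** (J ** (J ** (W ** (J ** U t))))"
      by (simp only: cJ'[symmetric] cJ[symmetric]) (simp only: matrix_mul_assoc)
    also have "\<dots> = ?c ** (W ** (J ** U t))" by (simp add: mm_cancel[OF JJ])
    finally have "?c ** (J ** (W ** U t)) + J ** ((?c ** (J ** (W ** U t))) ** J) =
        ?c ** ((J ** W + W ** J) ** U t)"
      by (simp add: mm_simps)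
    moreover have "J ** W + W ** J = 0"
    proof -
      have S'J: "S' ** J = J ** R'" "J ** S' = R' ** J" "J ** R' = S' ** J" "R' ** J = J ** S'"
        by (simp_all add: S'_def mm_simps JJ mm_cancel[OF JJ])
      note d = derivative_inverse[OF tI R' dS]
      have "- X - Y + - Y - X = (-2) *\<^sub>R (X + Y)" for X Y :: "complex^'m^'m"
        by (simp add: scaleR_2)
      \<comment> \<open>Thus \<open>W\<close> is half the difference of \<open>R t ** S'\<close> and
        \<open>S t ** R'\<close>, two products that are exchanged when \<open>J\<close> is moved
        across them.\<close>
      then have A: "A = (-1/2) *\<^sub>R (R t ** S' + S t ** R')"
        unfolding A_def d by simp
      have 1: "J ** (R t ** S') = (S t ** R') ** J" "J ** (S t ** R') = (R t ** S') ** J"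
        by (simp_all add: mm_cancel[OF J_R] mm_cancel[OF J_S] S'J(2,3)  matrix_mul_assoc[symmetric])
      have "J ** W + W ** J = (-1/2) *\<^sub>R ((S t ** R' + R t ** S') ** J) + (S t ** R') ** J +
          ((-1/2) *\<^sub>R ((R t ** S' + S t ** R') ** J) + (R t ** S') ** J)"
        unfolding W_def A by (simp only: mm.add_right mm.add_left mm.scaleR_left mm.scaleR_right 1)
      also have "\<dots> = 0"
      proof -
        have "(-1/2) *\<^sub>R Z + (-1/2) *\<^sub>R Z = - Z" for Z :: "complex^'m^'m"
          by (simp only: scaleR_left_distrib[symmetric]) simp
        moreover have "(-1/2) *\<^sub>R (X + Y) + X + ((-1/2) *\<^sub>R (Y + X) + Y) =
            ((-1/2) *\<^sub>R (X + Y) + (-1/2) *\<^sub>R (X + Y)) + (X + Y)" for X Y :: "complex^'m^'m"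
          by (simp only: add.commute[of Y X] add_ac)
        ultimately show ?thesis by (simp only: mm.add_left) simp
      qed
      finally show ?thesis .
    qed
    ultimately have "parallel_part J (potential J I (\<lambda>t. S t ** U t) t) = 0"
      unfolding parallel_part_potential_eq_0_iff[OF tI dT] G by (simp add: mm.zero_left mm.zero_right)
    then show False using t0 by simp
  qed
  with neg show "negligible {t \<in> {a<..<b}. \<not> parallel_part J (potential J I (\<lambda>t. S t ** U t) t) = 0}"
    by (rule negligible_subset)
qed

end

section \<open>The energy bound and its attainment\<close>

theorem proposition2p2:
  fixes n :: nat
    and J B :: "complex^'m^'m"
    and I :: "real set"
    and H :: "real \<Rightarrow> complex^'m^'m"
  assumes "n \<ge> 1" and "CARD('m) = 2 * n"
    and "hermitian J" and "hermitian B"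
    and "J ** J = mat 1" and "B ** B = mat 1" and "J ** B = - (B ** J)"
    and "is_interval I"
    and "loc_abs_continuous_on I H"
    and "\<And>t. t \<in> I \<Longrightarrow> pos_def (H t)"
    and "\<And>t. t \<in> I \<Longrightarrow> H t ** J ** H t = J"
  shows "(INF \<Theta>\<in>representing_gauges J I H. gauge_energy J I \<Theta>)
           = ennreal (1/4) * hamiltonian_energy I H
       \<and> (\<exists>\<Theta>\<in>representing_gauges J I H.
             AE t\<in>I in lebesgue. parallel_part J (potential J I \<Theta> t) = 0)
       \<and> (\<forall>\<Theta>\<in>representing_gauges J I H.
             (AE t\<in>I in lebesgue. parallel_part J (potential J I \<Theta> t) = 0) \<longrightarrow>
             gauge_energy J I \<Theta> = (INF \<Theta>'\<in>representing_gauges J I H. gauge_energy J I \<Theta>'))"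
proof -
  have J: "ctranspose J = J" "J ** J = mat 1" using assms(3,5) by (auto simp: hermitian_def)
  have uJ: "unitary J" by (simp add: unitary_def J)
  have psd: "pos_semidef (H t)" if "t \<in> I" for t using assms(10)[OF that] by (rule pos_def_imp_pos_semidef)
  let ?R = "\<lambda>t. msqrt (H t)" and ?S = "\<lambda>t. J ** (msqrt (H t) ** J)"
  note RR = msqrt_pos_semidef[OF psd]
  interpret symmetric_frame J I ?R ?S
  proof
    show "loc_abs_continuous_on I ?R"
      by (rule loc_abs_continuous_on_msqrt[OF J assms(9) psd assms(11)])
    show "?R t ** ?S t = mat 1" if "t \<in> I" for t
      by (rule msqrt_symplectic[OF psd[OF that] assms(11)[OF that] J])
  qed (use J assms(8) pos_semidefD(1)[OF RR(1)] in auto)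

  define E where "E \<Theta> t = Re (trace (mabs (potential J I \<Theta> t) ** mabs (potential J I \<Theta> t)))" for \<Theta> t
  define L where "L t = Re (trace (log_velocity I H t ** log_velocity I H t))" for t
  have pointwise: "AE t in lebesgue. t \<in> I \<longrightarrow> L t / 4 \<le> E \<Theta> t \<and>
      (parallel_part J (potential J I \<Theta> t) = 0 \<longrightarrow> E \<Theta> t = L t / 4)"
    if "\<Theta> \<in> representing_gauges J I H" for \<Theta>
  proof -
    have T: "loc_abs_continuous_on I \<Theta>" "\<And>t. t \<in> I \<Longrightarrow> J_unitary J (\<Theta> t)"
      "\<And>t. t \<in> I \<Longrightarrow> H t = J ** (\<Theta> t ** (ctranspose (\<Theta> t) ** J))"
      using that gauge_representation[OF J] by (auto simp: representing_gauges_def)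
    from loc_abs_continuous_on_AE_differentiable[OF assms(8) T(1)] show ?thesis
    proof eventually_elim
      case (elim t)
      show ?case
      proof
        assume "t \<in> I"
        with elim have t: "t \<in> interior I" and "\<Theta> differentiable (at t)" by auto
        then obtain D where D: "(\<Theta> has_vector_derivative D) (at t)"
          by (auto simp: differentiable_iff_scaleR has_vector_derivative_def)
        define G where "G = ctranspose (\<Theta> t) ** (J ** D)"
        have inv: "matrix_inv (?R t) = ?S t" by (rule matrix_inv_eq[OF RS[OF \<open>t \<in> I\<close>]])
        \<comment> \<open>The trace formula needs only the square of the inverse root; the
          representation of \<open>H\<close> identifies it with
          \<open>\<Theta> t ** ctranspose (\<Theta> t)\<close>.\<close>
        have "?S t ** ?S t = J ** (H t ** J)"
          by (simp add: mm_simps mm_cancel[OF J(2)] mm_cancel[OF RR(2)[OF \<open>t \<in> I\<close>]])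
        then have SS: "?S t ** ?S t = \<Theta> t ** ctranspose (\<Theta> t)"
          by (simp add: T(3)[OF \<open>t \<in> I\<close>] mm_simps mm_cancel[OF J(2)] J(2))
        have "L t = (norm (J ** (G ** J) - G))\<^sup>2"
          unfolding L_def G_def using trace_log_velocity[OF J t T(2) D T(3) inv SS] .
        moreover have "E \<Theta> t = (norm G)\<^sup>2"
          by (simp add: E_def trace_mabs_square norm_potential[OF t D] G_def)
        moreover have "parallel_part J (potential J I \<Theta> t) = 0 \<longleftrightarrow> G + J ** (G ** J) = 0"
          unfolding G_def by (rule parallel_part_potential_eq_0_iff[OF t D])
        ultimately show "L t / 4 \<le> E \<Theta> t \<and> (parallel_part J (potential J I \<Theta> t) = 0 \<longrightarrow> E \<Theta> t = L t / 4)"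
          using parallelogram_J[OF uJ, of G] by simp
      qed
    qed
  qed
  have ham: "ennreal (1/4) * hamiltonian_energy I H = (\<integral>\<^sup>+t\<in>I. ennreal (L t / 4) \<partial>lebesgue)"
    unfolding hamiltonian_energy_def
    by (subst nn_integral_cmult_pos[symmetric])
      (auto simp: L_def ennreal_mult'[symmetric] mult.assoc[symmetric] intro!: nn_integral_cong)
  have energy: "gauge_energy J I \<Theta> = (\<integral>\<^sup>+t\<in>I. ennreal (E \<Theta> t) \<partial>lebesgue)" for \<Theta>
    by (simp add: gauge_energy_def E_def)
  have lower: "ennreal (1/4) * hamiltonian_energy I H \<le> gauge_energy J I \<Theta>"
    if "\<Theta> \<in> representing_gauges J I H" for \<Theta>
    unfolding ham energy
    by (rule nn_integral_mono_AE) (use pointwise[OF that] in \<open>auto elim!: eventually_mono simp: indicator_def intro: ennreal_leI\<close>)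
  have attained: "gauge_energy J I \<Theta> = ennreal (1/4) * hamiltonian_energy I H"
    if "\<Theta> \<in> representing_gauges J I H" "AE t\<in>I in lebesgue. parallel_part J (potential J I \<Theta> t) = 0" for \<Theta>
  proof -
    have "AE t in lebesgue. t \<in> I \<longrightarrow> ennreal (E \<Theta> t) = ennreal (L t / 4)"
      using pointwise[OF that(1)] that(2) by eventually_elim metis
    then show ?thesis
      unfolding ham energy by (intro nn_integral_cong_AE) (auto elim!: eventually_mono simp: indicator_def)
  qed

  obtain U where U: "transport U" using transport_exists by blast
  define \<Theta> where "\<Theta> = (\<lambda>t. ?S t ** U t)"
  have "H t = matrix_inv (ctranspose (\<Theta> t)) ** matrix_inv (\<Theta> t)" if "t \<in> I" for t
    unfolding \<Theta>_def gauge_representation[OF J transport_J_unitary[OF U that]]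
      transport_represents[OF U that] RR(2)[OF that] ..
  then have gauge: "\<Theta> \<in> representing_gauges J I H"
    using transport_gauge_abs_continuous[OF U] transport_J_unitary[OF U]
    by (auto simp: representing_gauges_def \<Theta>_def)
  have par: "AE t\<in>I in lebesgue. parallel_part J (potential J I \<Theta> t) = 0"
    using transport_parallel[OF U] by (auto simp: \<Theta>_def elim: eventually_mono)
  have inf: "(INF \<Theta>\<in>representing_gauges J I H. gauge_energy J I \<Theta>) = ennreal (1/4) * hamiltonian_energy I H"
  proof (rule antisym)
    show "(INF \<Theta>\<in>representing_gauges J I H. gauge_energy J I \<Theta>) \<le> ennreal (1/4) * hamiltonian_energy I H"
      using INF_lower[OF gauge, of "gauge_energy J I"] attained[OF gauge par] by simp
  qed (intro INF_greatest lower)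
  show ?thesis using inf gauge par attained by auto
qed

end
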